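(* Let $\mathbb{K}$ be a field, $R=\mathbb{K}[x_1,\ldots,x_n]$ the standard graded polynomial ring, $I\subset R$ a homogeneous ideal, and $f\in R$ a homogeneous polynomial of degree $d>0$ such that $I:f=I$. If subadditivity holds for $R/I$, then subadditivity holds for $R/(I,f)$.
   Context: For a finitely generated graded $R$-module $M$ with graded Betti numbers $\beta_{i,j}^R(M)$, set $t_i^R(M)=\sup\{j:\beta_{i,j}^R(M)\neq 0\}$ (with $\sup\emptyset=-\infty$). Subadditivity holds for $M$ if $t_{a+b}^R(M)\le t_a^R(M)+t_b^R(M)$ for all $a,b\ge 0$ with $a+b\le \operatorname{pd}_R(M)$, where $\operatorname{pd}$ denotes projective dimension. *)

theory Defs
  imports
    "HOL-Algebra.QuotRing"
    "HOL-Algebra.Module"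
    "HOL-Library.Poly_Mapping"
    "HOL-Library.Extended_Real"
begin

section \<open>The standard graded polynomial ring\<close>

text \<open>
  The variables are indexed by a finite type \<open>'n\<close>, so \<open>n\<close> is \<open>CARD('n)\<close>.  Exponent vectors are
  elements of \<open>'n \<Rightarrow>\<^sub>0 nat\<close>, and multiplication of \<open>mpoly\<close> is the convolution product of
  \<open>Poly_Mapping\<close>.
\<close>

type_synonym ('n, 'k) mpoly = "('n \<Rightarrow>\<^sub>0 nat) \<Rightarrow>\<^sub>0 'k"

definition mpoly_ring :: "('n::finite, 'k::field) mpoly ring" where
  "mpoly_ring = \<lparr>carrier = UNIV, monoid.mult = (*), one = 1, ring.zero = 0, add = (+)\<rparr>"

definition mdeg :: "('n::finite \<Rightarrow>\<^sub>0 nat) \<Rightarrow> nat" where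
  "mdeg m = (\<Sum>i\<in>UNIV. Poly_Mapping.lookup m i)"

text \<open>Zero is homogeneous of every degree; in negative degrees it is the only such element.\<close>

definition homogeneous :: "int \<Rightarrow> ('n::finite, 'k::field) mpoly \<Rightarrow> bool" where
  "homogeneous j p \<longleftrightarrow> (\<forall>m\<in>Poly_Mapping.keys p. int (mdeg m) = j)"

definition homogeneous_ideal :: "('n::finite, 'k::field) mpoly set \<Rightarrow> bool" where
  "homogeneous_ideal I \<longleftrightarrow>
     (\<exists>S. (\<forall>p\<in>S. \<exists>j. homogeneous j p) \<and> I = Idl\<^bsub>mpoly_ring\<^esub> S)"

definition irrelevant_ideal :: "('n::finite, 'k::field) mpoly set" where
  "irrelevant_ideal =
     Idl\<^bsub>mpoly_ring\<^esub> (range (\<lambda>i. Poly_Mapping.single (Poly_Mapping.single i 1) 1))"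

definition colon_ideal :: "('n::finite, 'k::field) mpoly set \<Rightarrow> ('n, 'k) mpoly \<Rightarrow> ('n, 'k) mpoly set"
  where "colon_ideal I f = {g. g * f \<in> I}"

section \<open>Linear maps, free modules and resolutions\<close>

definition linear_map ::
  "('r, 'x) ring_scheme \<Rightarrow> ('r, 'm, 'y) module_scheme \<Rightarrow> ('r, 'p, 'z) module_scheme \<Rightarrow> ('m \<Rightarrow> 'p) \<Rightarrow> bool"
  where
  "linear_map R M N h \<longleftrightarrow>
     h \<in> carrier M \<rightarrow> carrier N \<and>
     (\<forall>x\<in>carrier M. \<forall>y\<in>carrier M. h (x \<oplus>\<^bsub>M\<^esub> y) = h x \<oplus>\<^bsub>N\<^esub> h y) \<and>
     (\<forall>a\<in>carrier R. \<forall>x\<in>carrier M. h (a \<odot>\<^bsub>M\<^esub> x) = a \<odot>\<^bsub>N\<^esub> h x)"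

text \<open>
  The free module \<open>R\<^sup>r\<close>.  Module records extend ring records; the fields for multiplication and
  unit of a module carry no meaning.
\<close>

definition free_module :: "('r, 'x) ring_scheme \<Rightarrow> nat \<Rightarrow> ('r, nat \<Rightarrow> 'r) module" where
  "free_module R r =
     \<lparr>carrier = {v. (\<forall>k<r. v k \<in> carrier R) \<and> (\<forall>k\<ge>r. v k = \<zero>\<^bsub>R\<^esub>)},
      monoid.mult = undefined, one = undefined,
      ring.zero = (\<lambda>_. \<zero>\<^bsub>R\<^esub>),
      add = (\<lambda>v w k. v k \<oplus>\<^bsub>R\<^esub> w k),
      smult = (\<lambda>a v k. a \<otimes>\<^bsub>R\<^esub> v k)\<rparr>"

text \<open>
  An exact sequence \<open>\<cdots> \<rightarrow> P 2 \<rightarrow> P 1 \<rightarrow> P 0 \<rightarrow> M \<rightarrow> 0\<close>, where \<open>\<delta> i\<close> goes from \<open>P (i + 1)\<close> to \<open>P i\<close>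
  and \<open>\<epsilon>\<close> is the augmentation.
\<close>

definition resolution ::
  "('r, 'x) ring_scheme \<Rightarrow> ('r, 'm, 'y) module_scheme \<Rightarrow> (nat \<Rightarrow> ('r, 'p, 'z) module_scheme) \<Rightarrow>
   (nat \<Rightarrow> 'p \<Rightarrow> 'p) \<Rightarrow> ('p \<Rightarrow> 'm) \<Rightarrow> bool" where
  "resolution R M P \<delta> \<epsilon> \<longleftrightarrow>
     (\<forall>i. Module.module R (P i)) \<and>
     (\<forall>i. linear_map R (P (Suc i)) (P i) (\<delta> i)) \<and>
     linear_map R (P 0) M \<epsilon> \<and>
     \<epsilon> ` carrier (P 0) = carrier M \<and>
     \<delta> 0 ` carrier (P 1) = {x \<in> carrier (P 0). \<epsilon> x = \<zero>\<^bsub>M\<^esub>} \<and>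
     (\<forall>i. \<delta> (Suc i) ` carrier (P (Suc (Suc i))) = {x \<in> carrier (P (Suc i)). \<delta> i x = \<zero>\<^bsub>P i\<^esub>})"

text \<open>Finitely generated projective modules are the retracts of the modules \<open>R\<^sup>r\<close>.\<close>

definition fg_projective :: "('r, 'x) ring_scheme \<Rightarrow> ('r, 'p, 'y) module_scheme \<Rightarrow> bool" where
  "fg_projective R P \<longleftrightarrow> Module.module R P \<and>
     (\<exists>r s q. linear_map R P (free_module R r) s \<and> linear_map R (free_module R r) P q \<and>
        (\<forall>x\<in>carrier P. q (s x) = x))"

text \<open>
  The least length of a projective resolution, \<open>\<infinity>\<close> if there is no finite one.  It is meant for
  finitely generated modules over a Noetherian ring, for which it suffices to consider resolutions
  by finitely generated projectives; up to isomorphism these live inside some \<open>R\<^sup>r\<close>, hence on the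
  type \<open>nat \<Rightarrow> 'r\<close>.  The zero module gets the value \<open>0\<close>.
\<close>

definition proj_dim :: "('r, 'x) ring_scheme \<Rightarrow> ('r, 'm, 'y) module_scheme \<Rightarrow> enat" where
  "proj_dim R M = Inf {enat p | p.
     \<exists>(P :: nat \<Rightarrow> ('r, nat \<Rightarrow> 'r) module) \<delta> \<epsilon>.
       resolution R M P \<delta> \<epsilon> \<and> (\<forall>i. fg_projective R (P i)) \<and>
       (\<forall>i>p. carrier (P i) = {\<zero>\<^bsub>P i\<^esub>})}"

section \<open>Graded modules and graded Betti numbers\<close>

text \<open>\<open>component M j\<close> is the set of homogeneous elements of degree \<open>j\<close>.\<close>

record ('r, 'm) graded_module = "('r, 'm) module" +
  component :: "int \<Rightarrow> 'm set"

text \<open>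
  For a list \<open>s = [s\<^sub>0, \<dots>, s\<^sub>r\<^sub>-\<^sub>1]\<close> of degrees, the graded free module \<open>R(-s\<^sub>0) \<oplus> \<cdots> \<oplus> R(-s\<^sub>r\<^sub>-\<^sub>1)\<close>: the
  \<open>k\<close>-th basis vector is homogeneous of degree \<open>s\<^sub>k\<close>.
\<close>

definition graded_free ::
  "int list \<Rightarrow> (('n::finite, 'k::field) mpoly, nat \<Rightarrow> ('n, 'k) mpoly) graded_module" where
  "graded_free s = module.extend (free_module mpoly_ring (length s))
     (graded_module.fields (\<lambda>j. {v \<in> carrier (free_module mpoly_ring (length s)).
        \<forall>k<length s. homogeneous (j - s ! k) (v k)}))"

text \<open>The residue class module \<open>R/I\<close> with the grading induced from \<open>R\<close>.\<close>

definition quot_module ::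
  "('n::finite, 'k::field) mpoly set \<Rightarrow> (('n, 'k) mpoly, ('n, 'k) mpoly set) graded_module" where
  "quot_module I = module.extend
     (ring.extend (mpoly_ring Quot I)
       (module.fields (\<lambda>a X. (I +>\<^bsub>mpoly_ring\<^esub> a) \<otimes>\<^bsub>mpoly_ring Quot I\<^esub> X)))
     (graded_module.fields (\<lambda>j. (\<lambda>p. I +>\<^bsub>mpoly_ring\<^esub> p) ` {p. homogeneous j p}))"

text \<open>
  Minimal graded free resolutions by finitely generated graded free modules
  \<open>F i = graded_free (\<sigma> i)\<close>: all maps preserve degrees, and \<open>\<delta> i (F (i + 1)) \<subseteq> \<mm> F i\<close> for the
  irrelevant ideal \<open>\<mm>\<close>.
\<close>

definition minimal_graded_free_resolution ::
  "(('n::finite, 'k::field) mpoly, 'm, 'y) graded_module_scheme \<Rightarrow> (nat \<Rightarrow> int list) \<Rightarrow>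
   (nat \<Rightarrow> (nat \<Rightarrow> ('n, 'k) mpoly) \<Rightarrow> (nat \<Rightarrow> ('n, 'k) mpoly)) \<Rightarrow>
   ((nat \<Rightarrow> ('n, 'k) mpoly) \<Rightarrow> 'm) \<Rightarrow> bool" where
  "minimal_graded_free_resolution M \<sigma> \<delta> \<epsilon> \<longleftrightarrow>
     resolution mpoly_ring M (\<lambda>i. graded_free (\<sigma> i)) \<delta> \<epsilon> \<and>
     (\<forall>i j. \<delta> i ` component (graded_free (\<sigma> (Suc i))) j \<subseteq> component (graded_free (\<sigma> i)) j) \<and>
     (\<forall>j. \<epsilon> ` component (graded_free (\<sigma> 0)) j \<subseteq> component M j) \<and>
     (\<forall>i. \<forall>v\<in>carrier (graded_free (\<sigma> (Suc i))). \<forall>k. \<delta> i v k \<in> irrelevant_ideal)"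

text \<open>
  The graded Betti number \<open>\<beta>\<^sub>i\<^sub>,\<^sub>j(M)\<close> is the multiplicity of \<open>R(-j)\<close> in the \<open>i\<close>-th module of the
  minimal graded free resolution of \<open>M\<close>, which exists for every finitely generated graded module
  and is unique up to isomorphism.
\<close>

definition graded_betti ::
  "(('n::finite, 'k::field) mpoly, 'm, 'y) graded_module_scheme \<Rightarrow> nat \<Rightarrow> int \<Rightarrow> nat" where
  "graded_betti M i j =
     count_list ((SOME \<sigma>. \<exists>\<delta> \<epsilon>. minimal_graded_free_resolution M \<sigma> \<delta> \<epsilon>) i) j"

definition max_shift ::
  "(('n::finite, 'k::field) mpoly, 'm, 'y) graded_module_scheme \<Rightarrow> nat \<Rightarrow> ereal" where
  "max_shift M i = Sup {ereal (real_of_int j) | j. graded_betti M i j \<noteq> 0}"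

definition subadditivity ::
  "(('n::finite, 'k::field) mpoly, 'm, 'y) graded_module_scheme \<Rightarrow> bool" where
  "subadditivity M \<longleftrightarrow>
     (\<forall>a b. enat (a + b) \<le> proj_dim mpoly_ring M \<longrightarrow>
        max_shift M (a + b) \<le> max_shift M a + max_shift M b)"

end

theory Submission
  imports Defs
begin

text \<open>
  As \<open>f\<close> is a nonzerodivisor on \<open>R/I\<close>, the mapping cone of multiplication by \<open>f\<close> on the minimal
  resolution of \<open>R/I\<close> resolves \<open>R/(I,f)\<close>, and it is minimal because \<open>f\<close> has positive degree.  Hence
  \<open>t\<^sub>i(R/(I,f)) = max {t\<^sub>i(R/I), t\<^sub>i\<^sub>-\<^sub>1(R/I) + d}\<close>, and subadditivity passes from \<open>R/I\<close> to \<open>R/(I,f)\<close> by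
  monotonicity of addition.  The projective dimension of \<open>R/(I,f)\<close> plays no role: since
  \<open>t\<^sub>i(R/I) = -\<infinity>\<close> for \<open>i > pd(R/I)\<close>, the inequality for \<open>R/I\<close> holds for all \<open>a\<close> and \<open>b\<close>.
\<close>

section \<open>Polynomials\<close>

text \<open>\<open>graded_betti\<close> picks an arbitrary minimal resolution by
  \<open>SOME\<close>, so exhibiting the cone says nothing about Betti numbers until two facts are
  established: R/I has a minimal graded free resolution, and any two of them have the same shifts
  with multiplicities. Existence rests on finite generation of syzygy modules, obtained from
  Dickson's lemma by division along leading terms, and on a graded Nakayama argument for a
  homogeneous generating set of least cardinality. Uniqueness comes from constant coefficients:
  comparison maps between two minimal resolutions are mutually inverse modulo the irrelevant ideal,
  and they respect degrees, so the ranks agree degree by degree. The same comparison, run against a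
  finite projective resolution that need not be graded, shows that the minimal resolution vanishes
  beyond \<open>proj_dim\<close>.\<close>

lemma mpoly_ring_simps [simp]:
  "carrier mpoly_ring = UNIV"
  "x \<oplus>\<^bsub>mpoly_ring\<^esub> y = x + y"
  "x \<otimes>\<^bsub>mpoly_ring\<^esub> y = x * y"
  "\<zero>\<^bsub>mpoly_ring\<^esub> = 0"
  "\<one>\<^bsub>mpoly_ring\<^esub> = 1"
  by (simp_all add: mpoly_ring_def)

lemma cring_mpoly_ring: "cring (mpoly_ring :: ('n::finite, 'k::field) mpoly ring)"
proof (rule cringI)
  show "abelian_group (mpoly_ring :: ('n, 'k) mpoly ring)"
  proof (rule abelian_groupI)
    show "\<exists>y\<in>carrier mpoly_ring. y \<oplus>\<^bsub>mpoly_ring\<^esub> x = \<zero>\<^bsub>mpoly_ring\<^esub>" for x :: "('n, 'k) mpoly"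
      by (auto intro: exI [of _ "- x"])
  qed (auto simp: algebra_simps)
qed (auto simp: algebra_simps comm_monoid_def Group.monoid_def comm_monoid_axioms_def)

interpretation mpoly_ring: cring "mpoly_ring :: ('n::finite, 'k::field) mpoly ring"
  by (rule cring_mpoly_ring)

lemma ideal_mpoly_ring_iff:
  fixes I :: "('n::finite, 'k::field) mpoly set"
  shows "ideal I mpoly_ring \<longleftrightarrow> 0 \<in> I \<and> (\<forall>x\<in>I. \<forall>y\<in>I. x + y \<in> I) \<and> (\<forall>a. \<forall>x\<in>I. a * x \<in> I)"
proof safe
  assume I: "ideal I mpoly_ring"
  then interpret ideal I mpoly_ring .
  show "x + y \<in> I" if "x \<in> I" "y \<in> I" for x y
    using additive_subgroup.a_closed [OF is_additive_subgroup that] by simp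
  show "0 \<in> I" using additive_subgroup.zero_closed [OF is_additive_subgroup] by simp
  show "a * x \<in> I" if "x \<in> I" for x a using I_l_closed that by auto
next
  assume I: "0 \<in> I" "\<forall>x\<in>I. \<forall>y\<in>I. x + y \<in> I" "\<forall>a. \<forall>x\<in>I. a * x \<in> I"
  show "ideal I mpoly_ring"
  proof (rule idealI)
    show "ring (mpoly_ring :: ('n, 'k) mpoly ring)" by (rule mpoly_ring.ring_axioms)
    show "subgroup I (add_monoid mpoly_ring)"
    proof (rule mpoly_ring.add.subgroupI)
      show "\<ominus>\<^bsub>mpoly_ring\<^esub> a \<in> I" if "a \<in> I" for a
      proof -
        have "\<ominus>\<^bsub>mpoly_ring\<^esub> a = - a"
          using mpoly_ring.minus_equality [of "- a" a] by simp
        moreover have "(- 1) * a \<in> I" using I that by blast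
        ultimately show ?thesis by simp
      qed
    qed (use I in auto)
  next
    show "x \<otimes>\<^bsub>mpoly_ring\<^esub> a \<in> I" "a \<otimes>\<^bsub>mpoly_ring\<^esub> x \<in> I" if "a \<in> I" for a x
      using I(3) that by (simp_all add: mult.commute [of a])
  qed
qed

lemma ideal_facts:
  fixes I :: "('n::finite, 'k::field) mpoly set"
  assumes "ideal I mpoly_ring"
  shows ideal_zero: "0 \<in> I"
    and ideal_add: "x \<in> I \<Longrightarrow> y \<in> I \<Longrightarrow> x + y \<in> I"
    and ideal_mult: "x \<in> I \<Longrightarrow> a * x \<in> I"
    and ideal_diff: "x \<in> I \<Longrightarrow> y \<in> I \<Longrightarrow> x - y \<in> I"
    and ideal_sum: "(\<And>i. i \<in> A \<Longrightarrow> g i \<in> I) \<Longrightarrow> sum g A \<in> I"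
proof -
  note I = assms [unfolded ideal_mpoly_ring_iff]
  show "0 \<in> I" "x \<in> I \<Longrightarrow> y \<in> I \<Longrightarrow> x + y \<in> I" and mult: "x \<in> I \<Longrightarrow> a * x \<in> I" for x y a
    using I by auto
  have minus: "x \<in> I \<Longrightarrow> - x \<in> I" for x
    using mult [of x "-1"] by simp
  show "x \<in> I \<Longrightarrow> y \<in> I \<Longrightarrow> x - y \<in> I"
    using I minus [of y] by (metis diff_conv_add_uminus)
  show "(\<And>i. i \<in> A \<Longrightarrow> g i \<in> I) \<Longrightarrow> sum g A \<in> I"
    using I by (induction A rule: infinite_finite_induct) auto
qed

lemma coset_mpoly_ring: "I +>\<^bsub>mpoly_ring\<^esub> p = (\<lambda>i. i + p) ` I"
  by (auto simp: a_r_coset_def r_coset_def)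

lemma coset_eq_iff:
  fixes I :: "('n::finite, 'k::field) mpoly set"
  assumes "ideal I mpoly_ring"
  shows "I +>\<^bsub>mpoly_ring\<^esub> p = I +>\<^bsub>mpoly_ring\<^esub> q \<longleftrightarrow> p - q \<in> I"
proof
  assume "I +>\<^bsub>mpoly_ring\<^esub> p = I +>\<^bsub>mpoly_ring\<^esub> q"
  moreover have "p \<in> I +>\<^bsub>mpoly_ring\<^esub> p"
    using ideal_zero [OF assms] by (auto simp: coset_mpoly_ring image_iff intro!: bexI [of _ 0])
  ultimately show "p - q \<in> I" by (auto simp: coset_mpoly_ring)
next
  assume pq: "p - q \<in> I"
  show "I +>\<^bsub>mpoly_ring\<^esub> p = I +>\<^bsub>mpoly_ring\<^esub> q"
  proof safe
    fix x assume "x \<in> I +>\<^bsub>mpoly_ring\<^esub> p"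
    then obtain i where "i \<in> I" "x = i + p" by (auto simp: coset_mpoly_ring)
    then show "x \<in> I +>\<^bsub>mpoly_ring\<^esub> q"
      using ideal_add [OF assms _ pq, of i]
      by (auto simp: coset_mpoly_ring image_iff algebra_simps intro!: bexI [of _ "i + (p - q)"])
  next
    fix x assume "x \<in> I +>\<^bsub>mpoly_ring\<^esub> q"
    then obtain i where "i \<in> I" "x = i + q" by (auto simp: coset_mpoly_ring)
    then show "x \<in> I +>\<^bsub>mpoly_ring\<^esub> p"
      using ideal_diff [OF assms _ pq, of i]
      by (auto simp: coset_mpoly_ring image_iff algebra_simps intro!: bexI [of _ "i - (p - q)"])
  qed
qed

lemma quot_module_simps:
  fixes I :: "('n::finite, 'k::field) mpoly set"
  assumes "ideal I mpoly_ring"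
  shows "carrier (quot_module I) = range (\<lambda>p. I +>\<^bsub>mpoly_ring\<^esub> p)"
    and "\<zero>\<^bsub>quot_module I\<^esub> = I +>\<^bsub>mpoly_ring\<^esub> 0"
    and "(I +>\<^bsub>mpoly_ring\<^esub> p) \<oplus>\<^bsub>quot_module I\<^esub> (I +>\<^bsub>mpoly_ring\<^esub> q) = I +>\<^bsub>mpoly_ring\<^esub> (p + q)"
    and "a \<odot>\<^bsub>quot_module I\<^esub> (I +>\<^bsub>mpoly_ring\<^esub> p) = I +>\<^bsub>mpoly_ring\<^esub> (a * p)"
    and "component (quot_module I) j = (\<lambda>p. I +>\<^bsub>mpoly_ring\<^esub> p) ` {p. homogeneous j p}"
proof -
  note defs = quot_module_def module.defs ring.defs graded_module.defs FactRing_def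
  show "carrier (quot_module I) = range (\<lambda>p. I +>\<^bsub>mpoly_ring\<^esub> p)"
    by (auto simp: defs A_RCOSETS_def' coset_mpoly_ring)
  show "\<zero>\<^bsub>quot_module I\<^esub> = I +>\<^bsub>mpoly_ring\<^esub> 0"
    by (simp add: defs coset_mpoly_ring)
  show "(I +>\<^bsub>mpoly_ring\<^esub> p) \<oplus>\<^bsub>quot_module I\<^esub> (I +>\<^bsub>mpoly_ring\<^esub> q) = I +>\<^bsub>mpoly_ring\<^esub> (p + q)"
    using ideal.a_rcos_sum [OF assms, of p q] by (simp add: defs)
  show "a \<odot>\<^bsub>quot_module I\<^esub> (I +>\<^bsub>mpoly_ring\<^esub> p) = I +>\<^bsub>mpoly_ring\<^esub> (a * p)"
    using ideal.rcoset_mult_add [OF assms, of a p] by (simp add: defs)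
  show "component (quot_module I) j = (\<lambda>p. I +>\<^bsub>mpoly_ring\<^esub> p) ` {p. homogeneous j p}"
    by (simp add: defs)
qed

lemma module_quot_module:
  fixes I :: "('n::finite, 'k::field) mpoly set"
  assumes "ideal I mpoly_ring"
  shows "Module.module mpoly_ring (quot_module I)"
proof (rule moduleI)
  note [simp] = quot_module_simps [OF assms]
  show "abelian_group (quot_module I)"
  proof (rule abelian_groupI)
    fix x assume "x \<in> carrier (quot_module I)"
    then obtain p where "x = I +>\<^bsub>mpoly_ring\<^esub> p" by auto
    then show "\<exists>y\<in>carrier (quot_module I). y \<oplus>\<^bsub>quot_module I\<^esub> x = \<zero>\<^bsub>quot_module I\<^esub>"
      by (auto intro: exI [of _ "- p"])
  qed (auto simp: algebra_simps)
qed (auto simp: cring_mpoly_ring quot_module_simps [OF assms] algebra_simps)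

lemma Idl_insert:
  fixes I :: "('n::finite, 'k::field) mpoly set"
  assumes "ideal I mpoly_ring"
  shows "Idl\<^bsub>mpoly_ring\<^esub> (insert f I) = {i + a * f | i a. i \<in> I}"
proof
  let ?J = "{i + a * f | i a. i \<in> I}"
  have "ideal ?J mpoly_ring"
    unfolding ideal_mpoly_ring_iff
  proof (intro conjI ballI allI)
    show "0 \<in> ?J"
      using ideal_zero [OF assms] by (metis (mono_tags, lifting) add_0 mem_Collect_eq mult_zero_left)
    fix x y assume "x \<in> ?J"
    then obtain i a where x: "x = i + a * f" "i \<in> I" by auto
    show "b * x \<in> ?J" for b
    proof -
      have "b * x = b * i + (b * a) * f" by (simp add: x(1) algebra_simps)
      then show ?thesis using ideal_mult [OF assms x(2), of b] by blast
    qed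
    assume "y \<in> ?J"
    then obtain i' a' where y: "y = i' + a' * f" "i' \<in> I" by auto
    have "x + y = (i + i') + (a + a') * f" by (simp add: x(1) y(1) algebra_simps)
    then show "x + y \<in> ?J" using ideal_add [OF assms x(2) y(2)] by blast
  qed
  moreover have "insert f I \<subseteq> ?J"
  proof safe
    show "\<exists>i a. f = i + a * f \<and> i \<in> I"
      using ideal_zero [OF assms] by (intro exI [of _ 0] exI [of _ 1]) auto
    show "\<exists>i a. x = i + a * f \<and> i \<in> I" if "x \<in> I" for x
      using that by (intro exI [of _ x] exI [of _ 0]) auto
  qed
  ultimately show "Idl\<^bsub>mpoly_ring\<^esub> (insert f I) \<subseteq> ?J"
    by (rule mpoly_ring.genideal_minimal)
next
  have J: "ideal (Idl\<^bsub>mpoly_ring\<^esub> (insert f I)) mpoly_ring"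
    by (rule mpoly_ring.genideal_ideal) simp
  have "insert f I \<subseteq> Idl\<^bsub>mpoly_ring\<^esub> (insert f I)"
    by (rule mpoly_ring.genideal_self) simp
  then show "{i + a * f | i a. i \<in> I} \<subseteq> Idl\<^bsub>mpoly_ring\<^esub> (insert f I)"
    by (auto intro!: ideal_add [OF J] ideal_mult [OF J])
qed

section \<open>Homogeneous components of polynomials\<close>

definition hcomp :: "int \<Rightarrow> ('n::finite, 'k::field) mpoly \<Rightarrow> ('n, 'k) mpoly" where
  "hcomp j p = Abs_poly_mapping (\<lambda>m. Poly_Mapping.lookup p m when int (mdeg m) = j)"

lemma lookup_hcomp:
  "Poly_Mapping.lookup (hcomp j p) m = (Poly_Mapping.lookup p m when int (mdeg m) = j)"
proof -
  have "finite {m. (Poly_Mapping.lookup p m when int (mdeg m) = j) \<noteq> 0}"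
    by (rule finite_subset [OF _ finite_lookup [of p]]) auto
  then show ?thesis by (simp add: hcomp_def)
qed

lemma homogeneous_hcomp [simp]: "homogeneous j (hcomp j p)"
  by (auto simp: homogeneous_def in_keys_iff lookup_hcomp)

lemma homogeneous_lookup:
  "homogeneous j p \<longleftrightarrow> (\<forall>m. int (mdeg m) \<noteq> j \<longrightarrow> Poly_Mapping.lookup p m = 0)"
  by (auto simp: homogeneous_def in_keys_iff)

lemma homogeneous_0 [simp]: "homogeneous j 0"
  by (simp add: homogeneous_def)

lemma homogeneous_1 [simp]: "homogeneous 0 1"
  by (simp add: homogeneous_def mdeg_def)

lemma homogeneous_add: "homogeneous j p \<Longrightarrow> homogeneous j q \<Longrightarrow> homogeneous j (p + q)"
  by (simp add: homogeneous_lookup lookup_add)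

lemma homogeneous_uminus: "homogeneous j p \<Longrightarrow> homogeneous j (- p)"
  by (simp add: homogeneous_lookup)

lemma mdeg_add: "mdeg (m + m') = mdeg m + mdeg m'"
  by (simp add: mdeg_def lookup_add sum.distrib)

lemma mdeg_eq_0_iff: "mdeg m = 0 \<longleftrightarrow> m = 0"
  by (auto simp: mdeg_def intro!: poly_mapping_eqI)

lemma homogeneous_mult:
  assumes "homogeneous i p" "homogeneous j q" shows "homogeneous (i + j) (p * q)"
  using assms keys_mult [of p q] by (fastforce simp: homogeneous_def mdeg_add)

lemma hcomp_homogeneous: "homogeneous j p \<Longrightarrow> hcomp j p = p"
  by (rule poly_mapping_eqI) (auto simp: lookup_hcomp homogeneous_lookup when_def)

lemma hcomp_add: "hcomp j (p + q) = hcomp j p + hcomp j q"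
  by (rule poly_mapping_eqI) (auto simp: lookup_hcomp lookup_add when_def)

lemma hcomp_diff: "hcomp j (p - q) = hcomp j p - hcomp j q"
  by (rule poly_mapping_eqI) (auto simp: lookup_hcomp lookup_minus when_def)

lemma hcomp_0 [simp]: "hcomp j 0 = 0"
  by (rule poly_mapping_eqI) (auto simp: lookup_hcomp)

lemma hcomp_sum: "hcomp j (sum g A) = (\<Sum>i\<in>A. hcomp j (g i))"
  by (induction A rule: infinite_finite_induct) (auto simp: hcomp_add)

text \<open>Split \<open>p\<close> into its component of degree \<open>j - s\<close> and the rest. A
  monomial of degree \<open>j\<close> in the product of the rest with \<open>q\<close> would need a
  factor of degree \<open>j - s\<close> from the rest, and there is none.\<close>

lemma hcomp_mult:
  assumes "homogeneous s q" shows "hcomp j (p * q) = hcomp (j - s) p * q"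
proof -
  let ?r = "p - hcomp (j - s) p"
  have "hcomp j (?r * q) = 0"
  proof (rule poly_mapping_eqI)
    fix m
    have "m \<notin> Poly_Mapping.keys (?r * q)" if "int (mdeg m) = j"
    proof
      assume "m \<in> Poly_Mapping.keys (?r * q)"
      then obtain u v where uv: "m = u + v" "u \<in> Poly_Mapping.keys ?r" "v \<in> Poly_Mapping.keys q"
        using keys_mult by blast
      then have "int (mdeg u) = j - s"
        using assms that by (auto simp: homogeneous_def mdeg_add)
      then show False
        using uv by (simp add: in_keys_iff lookup_minus lookup_hcomp)
    qed
    then show "Poly_Mapping.lookup (hcomp j (?r * q)) m = Poly_Mapping.lookup 0 m"
      by (auto simp: lookup_hcomp in_keys_iff when_def)
  qed
  moreover have "hcomp j (hcomp (j - s) p * q) = hcomp (j - s) p * q"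
    using homogeneous_mult [OF homogeneous_hcomp assms, of "j - s" p]
    by (intro hcomp_homogeneous) simp
  ultimately show ?thesis
    using hcomp_add [of j "?r * q" "hcomp (j - s) p * q"] by (simp add: algebra_simps)
qed

text \<open>Evaluation at the origin, that is, the ring homomorphism to the residue field of the
  irrelevant ideal. Reduction modulo that ideal thus becomes reading off one coefficient.\<close>

definition const_coeff :: "('n::finite, 'k::field) mpoly \<Rightarrow> 'k" where
  "const_coeff p = Poly_Mapping.lookup p 0"

lemma const_coeff_simps [simp]:
  "const_coeff 0 = 0" "const_coeff 1 = 1"
  "const_coeff (p + q) = const_coeff p + const_coeff q"
  "const_coeff (p - q) = const_coeff p - const_coeff q"
  "const_coeff (- p) = - const_coeff p"
  "const_coeff (Poly_Mapping.single 0 c) = c"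
  by (simp_all add: const_coeff_def lookup_add lookup_minus)

lemma const_coeff_sum: "const_coeff (sum g A) = (\<Sum>i\<in>A. const_coeff (g i))"
  by (simp add: const_coeff_def lookup_sum)

lemma pm_nat_add_eq_0_iff: "m + m' = 0 \<longleftrightarrow> m = 0 \<and> m' = (0 :: 'n::finite \<Rightarrow>\<^sub>0 nat)"
  by (metis add_eq_0_iff_both_eq_0 add_0 mdeg_add mdeg_eq_0_iff)

text \<open>Subtracting its constant term from \<open>p\<close> leaves a polynomial whose multiples
  have no constant term, since exponent vectors adding up to 0 are both 0.\<close>

lemma const_coeff_mult [simp]: "const_coeff (p * q) = const_coeff p * const_coeff q"
proof -
  let ?p0 = "Poly_Mapping.single 0 (const_coeff p)"
  have "0 \<notin> Poly_Mapping.keys ((p - ?p0) * q)"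
  proof
    assume "0 \<in> Poly_Mapping.keys ((p - ?p0) * q)"
    then obtain u v where uv: "0 = u + v" "u \<in> Poly_Mapping.keys (p - ?p0)"
      using keys_mult by blast
    then have "u = 0" by (metis pm_nat_add_eq_0_iff)
    then show False
      using uv by (simp add: in_keys_iff lookup_minus const_coeff_def)
  qed
  then have "const_coeff ((p - ?p0) * q) = 0"
    by (simp add: in_keys_iff const_coeff_def)
  moreover have "const_coeff (?p0 * q) = const_coeff p * const_coeff q"
    by (simp add: mult_map_scale_conv_mult [symmetric] const_coeff_def map.rep_eq when_def)
  ultimately show ?thesis
    by (simp add: left_diff_distrib)
qed

lemma sum_single: "p = (\<Sum>m\<in>Poly_Mapping.keys p. Poly_Mapping.single m (Poly_Mapping.lookup p m))"
  by (rule poly_mapping_eqI)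
    (auto simp: lookup_sum lookup_single when_def in_keys_iff sum.delta)

text \<open>The variables lie in the kernel of \<open>const_coeff\<close>, which is an ideal.
  Conversely, a polynomial without constant term is a sum of monomials each divisible by some
  variable.\<close>

lemma irrelevant_ideal_iff: "p \<in> irrelevant_ideal \<longleftrightarrow> const_coeff p = 0"
proof
  let ?X = "range (\<lambda>i. Poly_Mapping.single (Poly_Mapping.single i 1) 1) :: ('a, 'b) mpoly set"
  have ideal: "ideal (irrelevant_ideal :: ('a, 'b) mpoly set) mpoly_ring"
    unfolding irrelevant_ideal_def by (rule mpoly_ring.genideal_ideal) simp
  have X: "?X \<subseteq> irrelevant_ideal"
    unfolding irrelevant_ideal_def by (rule mpoly_ring.genideal_self) simp
  {
    assume "p \<in> irrelevant_ideal"
    moreover have "irrelevant_ideal \<subseteq> {p :: ('a, 'b) mpoly. const_coeff p = 0}"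
      unfolding irrelevant_ideal_def
    proof (rule mpoly_ring.genideal_minimal)
      show "ideal {p :: ('a, 'b) mpoly. const_coeff p = 0} mpoly_ring"
        by (auto simp: ideal_mpoly_ring_iff)
      show "?X \<subseteq> {p. const_coeff p = 0}"
      proof -
        have "Poly_Mapping.single (i :: 'a) (1 :: nat) \<noteq> 0" for i
          by (metis lookup_single_eq lookup_zero zero_neq_one)
        then show ?thesis by (auto simp: const_coeff_def lookup_single_not_eq)
      qed
    qed
    ultimately show "const_coeff p = 0" by auto
  }
  assume p: "const_coeff p = 0"
  have "Poly_Mapping.single m (Poly_Mapping.lookup p m) \<in> irrelevant_ideal"
    if "m \<in> Poly_Mapping.keys p" for m
  proof -
    have "m \<noteq> 0" using p that by (auto simp: const_coeff_def in_keys_iff)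
    then obtain i where i: "Poly_Mapping.lookup m i \<noteq> 0"
      by (metis lookup_zero poly_mapping_eqI)
    have "m = (m - Poly_Mapping.single i 1) + Poly_Mapping.single i 1"
      by (rule poly_mapping_eqI) (use i in \<open>auto simp: lookup_add lookup_minus lookup_single when_def\<close>)
    then have "Poly_Mapping.single m (Poly_Mapping.lookup p m) =
      Poly_Mapping.single (m - Poly_Mapping.single i 1) (Poly_Mapping.lookup p m) *
      Poly_Mapping.single (Poly_Mapping.single i 1) 1"
      by (simp add: mult_single)
    then show ?thesis
      using X by (auto intro!: ideal_mult [OF ideal])
  qed
  then show "p \<in> irrelevant_ideal"
    by (subst sum_single [of p]) (rule ideal_sum [OF ideal])
qed

lemma homogeneous_const_coeff:
  "homogeneous j p \<Longrightarrow> j \<noteq> 0 \<Longrightarrow> const_coeff p = 0"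
  by (auto simp: homogeneous_lookup const_coeff_def mdeg_def)

lemma hcomp_0_eq: "hcomp 0 p = Poly_Mapping.single 0 (const_coeff p)"
  by (rule poly_mapping_eqI)
    (auto simp: lookup_hcomp lookup_single when_def const_coeff_def mdeg_eq_0_iff)

lemma homogeneous_ideal_imp_ideal: "homogeneous_ideal I \<Longrightarrow> ideal I mpoly_ring"
  by (auto simp: homogeneous_ideal_def intro: mpoly_ring.genideal_ideal)

lemma homogeneous_ideal_hcomp:
  fixes I :: "('n::finite, 'k::field) mpoly set"
  assumes "homogeneous_ideal I" "p \<in> I"
  shows "hcomp j p \<in> I"
proof -
  from assms(1) obtain S where S: "\<forall>p\<in>S. \<exists>j. homogeneous j p" and I: "I = Idl\<^bsub>mpoly_ring\<^esub> S"
    by (auto simp: homogeneous_ideal_def)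
  note ideal = homogeneous_ideal_imp_ideal [OF assms(1)]
  have SI: "S \<subseteq> I" unfolding I by (rule mpoly_ring.genideal_self) simp
  \<comment> \<open>Quantifying over all multiples \<open>a * p\<close> makes \<open>?T\<close>
    closed under multiplication by construction; homogeneity is then used for the generators
    alone.\<close>
  let ?T = "{p. \<forall>a j. hcomp j (a * p) \<in> I}"
  have "I \<subseteq> ?T"
  proof (subst I, rule mpoly_ring.genideal_minimal)
    show "ideal ?T mpoly_ring"
      unfolding ideal_mpoly_ring_iff
      by (auto simp: distrib_left hcomp_add mult.assoc [symmetric]
          intro: ideal_zero [OF ideal] ideal_add [OF ideal])
    show "S \<subseteq> ?T"
    proof safe
      fix s a j assume "s \<in> S"
      then obtain i where "homogeneous i s" using S by auto
      then show "hcomp j (a * s) \<in> I"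
        using \<open>s \<in> S\<close> SI by (auto simp: hcomp_mult intro!: ideal_mult [OF ideal])
    qed
  qed
  then have "hcomp j (1 * p) \<in> I" using assms(2) by blast
  then show ?thesis by simp
qed

section \<open>Free modules and lifting\<close>

lemma linear_mapD:
  assumes "linear_map R M N h"
  shows linear_map_closed: "x \<in> carrier M \<Longrightarrow> h x \<in> carrier N"
    and linear_map_add: "x \<in> carrier M \<Longrightarrow> y \<in> carrier M \<Longrightarrow> h (x \<oplus>\<^bsub>M\<^esub> y) = h x \<oplus>\<^bsub>N\<^esub> h y"
    and linear_map_smult: "a \<in> carrier R \<Longrightarrow> x \<in> carrier M \<Longrightarrow> h (a \<odot>\<^bsub>M\<^esub> x) = a \<odot>\<^bsub>N\<^esub> h x"
  using assms by (auto simp: linear_map_def)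

lemma linear_map_zero:
  assumes "linear_map R M N h" "Module.module R M" "Module.module R N"
  shows "h \<zero>\<^bsub>M\<^esub> = \<zero>\<^bsub>N\<^esub>"
proof -
  interpret M: Module.module R M by fact
  interpret N: Module.module R N by fact
  have "h (\<zero>\<^bsub>R\<^esub> \<odot>\<^bsub>M\<^esub> \<zero>\<^bsub>M\<^esub>) = \<zero>\<^bsub>R\<^esub> \<odot>\<^bsub>N\<^esub> h \<zero>\<^bsub>M\<^esub>"
    by (rule linear_map_smult [OF assms(1)]) auto
  moreover have "h \<zero>\<^bsub>M\<^esub> \<in> carrier N" by (rule linear_map_closed [OF assms(1)]) simp
  ultimately show ?thesis by simp
qed

lemma linear_map_comp:
  assumes "linear_map R M N h" "linear_map R N P g"
  shows "linear_map R M P (\<lambda>x. g (h x))"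
  using assms by (auto simp: linear_map_def Pi_iff)

text \<open>Recursion on the number of terms works in any module record, so one notion serves the
  free modules, the quotient \<open>R/I\<close> and the projective modules alike.\<close>

primrec lincomb ::
  "('r, 'm, 'z) module_scheme \<Rightarrow> (nat \<Rightarrow> 'm) \<Rightarrow> (nat \<Rightarrow> 'r) \<Rightarrow> nat \<Rightarrow> 'm" where
  "lincomb M b v 0 = \<zero>\<^bsub>M\<^esub>"
| "lincomb M b v (Suc r) = lincomb M b v r \<oplus>\<^bsub>M\<^esub> v r \<odot>\<^bsub>M\<^esub> b r"

definition unit_vec :: "nat \<Rightarrow> nat \<Rightarrow> ('n::finite, 'k::field) mpoly" where
  "unit_vec k l = (if l = k then 1 else 0)"

lemma graded_free_simps [simp]:
  "carrier (graded_free s) = {v. \<forall>k\<ge>length s. v k = 0}"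
  "\<zero>\<^bsub>graded_free s\<^esub> = (\<lambda>_. 0)"
  "v \<oplus>\<^bsub>graded_free s\<^esub> w = (\<lambda>k. v k + w k)"
  "a \<odot>\<^bsub>graded_free s\<^esub> v = (\<lambda>k. a * v k)"
  by (auto simp: graded_free_def free_module_def module.defs ring.defs graded_module.defs)

lemma component_graded_free:
  "v \<in> component (graded_free s) j \<longleftrightarrow>
     (\<forall>k\<ge>length s. v k = 0) \<and> (\<forall>k<length s. homogeneous (j - s ! k) (v k))"
  by (auto simp: graded_free_def free_module_def module.defs ring.defs graded_module.defs)

lemma unit_vec_carrier: "k < length s \<Longrightarrow> unit_vec k \<in> carrier (graded_free s)"
  by (auto simp: unit_vec_def)

lemma unit_vec_component: "k < length s \<Longrightarrow> unit_vec k \<in> component (graded_free s) (s ! k)"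
  by (auto simp: component_graded_free unit_vec_def)

lemma component_subset_carrier: "component (graded_free s) j \<subseteq> carrier (graded_free s)"
  by (auto simp: component_graded_free)

lemma module_graded_free:
  "Module.module (mpoly_ring :: ('n::finite, 'k::field) mpoly ring) (graded_free s)"
proof (rule moduleI)
  show "abelian_group (graded_free s :: (('n, 'k) mpoly, nat \<Rightarrow> ('n, 'k) mpoly) graded_module)"
  proof (rule abelian_groupI)
    fix x :: "nat \<Rightarrow> ('n, 'k) mpoly" assume "x \<in> carrier (graded_free s)"
    then show "\<exists>y\<in>carrier (graded_free s). y \<oplus>\<^bsub>graded_free s\<^esub> x = \<zero>\<^bsub>graded_free s\<^esub>"
      by (auto intro!: exI [of _ "\<lambda>k. - x k"])
  qed (auto simp: algebra_simps)
qed (auto simp: cring_mpoly_ring algebra_simps)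

text \<open>The grading is an extra record field that \<open>linear_map\<close> ignores. This rule
  and the next pass between \<open>free_module\<close>, which occurs in
  \<open>fg_projective\<close>, and its graded version.\<close>

lemma linear_map_graded_free_dom:
  "linear_map R (free_module mpoly_ring (length s)) N h \<longleftrightarrow> linear_map R (graded_free s) N h"
  by (simp add: linear_map_def graded_free_def free_module_def module.defs ring.defs graded_module.defs)

lemma linear_map_graded_free_cod:
  "linear_map R N (free_module mpoly_ring (length s)) h \<longleftrightarrow> linear_map R N (graded_free s) h"
  by (simp add: linear_map_def graded_free_def free_module_def module.defs ring.defs graded_module.defs)

lemma lincomb_graded_free: "lincomb (graded_free s) b v r = (\<lambda>k. \<Sum>l<r. v l * b l k)"
  by (induction r) auto

lemma lincomb_cong:
  "(\<And>k. k < r \<Longrightarrow> b k = b' k) \<Longrightarrow> lincomb M b v r = lincomb M b' v r"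
  by (induction r) auto

lemma lincomb_unit_vec:
  "v \<in> carrier (graded_free s) \<Longrightarrow> lincomb (graded_free s) unit_vec v (length s) = v"
  by (auto simp: lincomb_graded_free fun_eq_iff unit_vec_def if_distrib cong: if_cong)

lemma lincomb_closed:
  assumes "Module.module R M" "\<And>k. k < r \<Longrightarrow> b k \<in> carrier M" "\<And>k. k < r \<Longrightarrow> v k \<in> carrier R"
  shows "lincomb M b v r \<in> carrier M"
proof -
  interpret Module.module R M by fact
  show ?thesis using assms(2,3) by (induction r) auto
qed

lemma linear_map_lincomb:
  assumes "linear_map R M N h" "Module.module R M" "Module.module R N"
    and "\<And>k. k < r \<Longrightarrow> b k \<in> carrier M" "\<And>k. k < r \<Longrightarrow> v k \<in> carrier R"
  shows "h (lincomb M b v r) = lincomb N (\<lambda>k. h (b k)) v r"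
  using assms(4,5)
proof (induction r)
  case 0
  then show ?case using linear_map_zero [OF assms(1-3)] by simp
next
  case (Suc r)
  interpret M: Module.module R M by fact
  show ?case
    using Suc lincomb_closed [OF assms(2), of r b v]
    by (simp add: linear_map_add [OF assms(1)] linear_map_smult [OF assms(1)])
qed

lemma linear_map_eq_lincomb:
  assumes "linear_map mpoly_ring (graded_free s) N h" "Module.module mpoly_ring N"
    and "v \<in> carrier (graded_free s)"
  shows "h v = lincomb N (\<lambda>k. h (unit_vec k)) v (length s)"
proof -
  have "h (lincomb (graded_free s) unit_vec v (length s)) = lincomb N (\<lambda>k. h (unit_vec k)) v (length s)"
    by (rule linear_map_lincomb [OF assms(1) module_graded_free assms(2)])
      (auto intro: unit_vec_carrier simp del: graded_free_simps)
  then show ?thesis by (simp only: lincomb_unit_vec [OF assms(3)])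
qed

lemma linear_map_graded_free_eq_sum:
  assumes "linear_map mpoly_ring (graded_free s) (graded_free t) h" "v \<in> carrier (graded_free s)"
  shows "h v k = (\<Sum>l<length s. v l * h (unit_vec l) k)"
  using linear_map_eq_lincomb [OF assms(1) module_graded_free assms(2)]
  by (simp add: lincomb_graded_free)

lemma lincomb_linear_map:
  assumes "Module.module mpoly_ring M" "\<And>k. k < length s \<Longrightarrow> b k \<in> carrier M"
  shows "linear_map mpoly_ring (graded_free s) M (\<lambda>v. lincomb M b v (length s))"
proof -
  interpret Module.module mpoly_ring M by fact
  have closed: "r \<le> length s \<Longrightarrow> lincomb M b v r \<in> carrier M" for v r
    by (rule lincomb_closed [OF assms(1)]) (auto intro: assms(2))
  have add: "r \<le> length s \<Longrightarrow>
      lincomb M b (\<lambda>k. v k + w k) r = lincomb M b v r \<oplus>\<^bsub>M\<^esub> lincomb M b w r" for v w r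
  proof (induction r)
    case (Suc r)
    have "b r \<in> carrier M" using Suc.prems assms(2) by auto
    then show ?case
      using Suc closed [of r v] closed [of r w] smult_l_distr [of "v r" "w r" "b r"]
      by (simp add: M.a_ac)
  qed simp
  have smult: "r \<le> length s \<Longrightarrow>
      lincomb M b (\<lambda>k. a * v k) r = a \<odot>\<^bsub>M\<^esub> lincomb M b v r" for a v r
  proof (induction r)
    case (Suc r)
    have "b r \<in> carrier M" using Suc.prems assms(2) by auto
    then show ?case
      using Suc closed [of r v] smult_assoc1 [of a "v r" "b r"]
      by (simp add: smult_r_distr)
  qed simp
  show ?thesis
    unfolding linear_map_def by (simp add: Pi_iff closed add smult)
qed

lemma lincomb_unit_vec_eq:
  assumes "Module.module mpoly_ring M" "\<And>k. k < r \<Longrightarrow> b k \<in> carrier M" "k < r"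
  shows "lincomb M b (unit_vec k) r = b k"
proof -
  interpret Module.module mpoly_ring M by fact
  have "n \<le> r \<Longrightarrow> lincomb M b (unit_vec k) n = (if k < n then b k else \<zero>\<^bsub>M\<^esub>)" for n
  proof (induction n)
    case (Suc n)
    have "b n \<in> carrier M" "b k \<in> carrier M" using Suc.prems assms(2,3) by auto
    then show ?case
      using Suc smult_one smult_l_null by (auto simp: unit_vec_def less_Suc_eq)
  qed simp
  then show ?thesis using assms(3) by simp
qed

text \<open>Both sides are linear in \<open>v\<close> and agree on the basis vectors: this is
  projectivity of a free module, with the preimages \<open>b k\<close> already chosen.\<close>

lemma free_lift:
  assumes "Module.module mpoly_ring M" "Module.module mpoly_ring N"
    and g: "linear_map mpoly_ring (graded_free s) N g" and p: "linear_map mpoly_ring M N p"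
    and b: "\<And>k. k < length s \<Longrightarrow> b k \<in> carrier M"
    and pb: "\<And>k. k < length s \<Longrightarrow> p (b k) = g (unit_vec k)"
    and v: "v \<in> carrier (graded_free s)"
  shows "p (lincomb M b v (length s)) = g v"
proof -
  have "p (lincomb M b v (length s)) = lincomb N (\<lambda>k. p (b k)) v (length s)"
    by (rule linear_map_lincomb [OF p assms(1,2) b]) auto
  also have "\<dots> = lincomb N (\<lambda>k. g (unit_vec k)) v (length s)"
    by (rule lincomb_cong) (rule pb)
  also have "\<dots> = g v"
    by (rule linear_map_eq_lincomb [OF g assms(2) v, symmetric])
  finally show ?thesis .
qed

text \<open>The composite of \<open>g\<close> with the retraction \<open>q\<close> is lifted on the
  basis of the free module, and the lift is restricted along the section \<open>s\<close>;
  \<open>q (s x) = x\<close> removes the retraction again. The image condition \<open>gp\<close>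
  takes the place of surjectivity of \<open>p\<close>, because the differentials of a resolution
  only cover kernels.\<close>

lemma fg_projective_lift:
  assumes "fg_projective mpoly_ring P" "Module.module mpoly_ring M" "Module.module mpoly_ring N"
    and g: "linear_map mpoly_ring P N g" and p: "linear_map mpoly_ring M N p"
    and gp: "\<And>x. x \<in> carrier P \<Longrightarrow> g x \<in> p ` carrier M"
  shows "\<exists>h. linear_map mpoly_ring P M h \<and> (\<forall>x\<in>carrier P. p (h x) = g x)"
proof -
  from assms(1) obtain r s q where
    "linear_map mpoly_ring P (free_module mpoly_ring r) s"
    "linear_map mpoly_ring (free_module mpoly_ring r) P q"
    and qs: "\<And>x. x \<in> carrier P \<Longrightarrow> q (s x) = x"
    unfolding fg_projective_def by blast
  \<comment> \<open>The degrees are set to 0 arbitrarily: the projective module carries no grading,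
    and only the length \<open>r\<close> of the list matters.\<close>
  then have s: "linear_map mpoly_ring P (graded_free (replicate r 0)) s"
    and q: "linear_map mpoly_ring (graded_free (replicate r 0)) P q"
    by (metis length_replicate linear_map_graded_free_cod)
      (metis \<open>linear_map mpoly_ring (free_module mpoly_ring r) P q\<close> length_replicate linear_map_graded_free_dom)
  let ?F = "graded_free (replicate r 0)"
  have gq: "linear_map mpoly_ring ?F N (\<lambda>x. g (q x))"
    by (rule linear_map_comp [OF q g])
  have "\<forall>k<r. \<exists>b. b \<in> carrier M \<and> p b = g (q (unit_vec k))"
  proof (intro allI impI)
    fix k assume "k < r"
    then have "q (unit_vec k) \<in> carrier P"
      using unit_vec_carrier [of k "replicate r 0"] linear_map_closed [OF q] by simp
    from gp [OF this] show "\<exists>b. b \<in> carrier M \<and> p b = g (q (unit_vec k))"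
      by (auto simp: image_iff)
  qed
  then obtain b where b: "\<And>k. k < r \<Longrightarrow> b k \<in> carrier M" "\<And>k. k < r \<Longrightarrow> p (b k) = g (q (unit_vec k))"
    by metis
  have lin: "linear_map mpoly_ring ?F M (\<lambda>v. lincomb M b v (length (replicate r (0::int))))"
    by (rule lincomb_linear_map [OF assms(2)]) (use b in auto)
  have "p (lincomb M b (s x) (length (replicate r (0::int)))) = g x" if "x \<in> carrier P" for x
    using free_lift [OF assms(2,3) gq p, of b "s x"] b linear_map_closed [OF s that] qs [OF that]
    by simp
  then show ?thesis
    using linear_map_comp [OF s lin] by blast
qed

lemma fg_projective_graded_free: "fg_projective mpoly_ring (graded_free s)"
  unfolding fg_projective_def
proof (intro conjI exI ballI)
  show "linear_map mpoly_ring (graded_free s) (free_module mpoly_ring (length s)) (\<lambda>x. x)"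
    by (subst linear_map_graded_free_cod) (auto simp: linear_map_def)
  show "linear_map mpoly_ring (free_module mpoly_ring (length s)) (graded_free s) (\<lambda>x. x)"
    by (subst linear_map_graded_free_dom) (auto simp: linear_map_def)
qed (auto intro: module_graded_free)

section \<open>Comparison of resolutions\<close>

lemma resolutionD:
  assumes "resolution R M P \<delta> \<epsilon>"
  shows resolution_module: "Module.module R (P i)"
    and resolution_linear: "linear_map R (P (Suc i)) (P i) (\<delta> i)"
    and resolution_aug_linear: "linear_map R (P 0) M \<epsilon>"
    and resolution_aug_surj: "\<epsilon> ` carrier (P 0) = carrier M"
    and resolution_exact_0: "\<delta> 0 ` carrier (P (Suc 0)) = {x \<in> carrier (P 0). \<epsilon> x = \<zero>\<^bsub>M\<^esub>}"
    and resolution_exact: "\<delta> (Suc i) ` carrier (P (Suc (Suc i))) = {x \<in> carrier (P (Suc i)). \<delta> i x = \<zero>\<^bsub>P i\<^esub>}"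
  using assms by (auto simp: resolution_def)

lemma resolution_aug_diff:
  "resolution R M P \<delta> \<epsilon> \<Longrightarrow> x \<in> carrier (P (Suc 0)) \<Longrightarrow> \<epsilon> (\<delta> 0 x) = \<zero>\<^bsub>M\<^esub>"
  using resolution_exact_0 [of R M P \<delta> \<epsilon>] by blast

lemma resolution_diff_diff:
  "resolution R M P \<delta> \<epsilon> \<Longrightarrow> x \<in> carrier (P (Suc (Suc i))) \<Longrightarrow> \<delta> i (\<delta> (Suc i) x) = \<zero>\<^bsub>P i\<^esub>"
  using resolution_exact [of R M P \<delta> \<epsilon> i] by blast

text \<open>\<open>good\<close> is a property that the constructed maps acquire degree by degree:
  trivial for the comparison with projectives, preservation of degrees for the comparison of graded
  resolutions. The lifts themselves are left to \<open>base\<close> and \<open>step\<close>;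
  exactness is exploited here.\<close>

lemma comparison_chain_map:
  fixes good :: "nat \<Rightarrow> ('p \<Rightarrow> 'q) \<Rightarrow> bool"
  assumes P: "resolution R M P \<delta> \<epsilon>" and Q: "resolution R M Q \<delta>' \<epsilon>'"
    and base: "\<exists>h. linear_map R (P 0) (Q 0) h \<and> good 0 h \<and> (\<forall>x\<in>carrier (P 0). \<epsilon>' (h x) = \<epsilon> x)"
    and step: "\<And>i h. linear_map R (P i) (Q i) h \<Longrightarrow> good i h \<Longrightarrow>
        (\<And>x. x \<in> carrier (P (Suc i)) \<Longrightarrow> h (\<delta> i x) \<in> \<delta>' i ` carrier (Q (Suc i))) \<Longrightarrow>
        \<exists>h'. linear_map R (P (Suc i)) (Q (Suc i)) h' \<and> good (Suc i) h' \<and>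
          (\<forall>x\<in>carrier (P (Suc i)). \<delta>' i (h' x) = h (\<delta> i x))"
  shows "\<exists>\<phi>. (\<forall>i. linear_map R (P i) (Q i) (\<phi> i) \<and> good i (\<phi> i)) \<and>
    (\<forall>x\<in>carrier (P 0). \<epsilon>' (\<phi> 0 x) = \<epsilon> x) \<and>
    (\<forall>i. \<forall>x\<in>carrier (P (Suc i)). \<delta>' i (\<phi> (Suc i) x) = \<phi> i (\<delta> i x))"
proof -
  \<comment> \<open>The invariant includes that \<open>h\<close> after the differential lands in the
    image of \<open>\<delta>' i\<close>: the next lift needs this, and exactness of \<open>Q\<close>
    provides it. The clause for \<open>i = 0\<close> carries the augmentation condition through the
    dependent choice.\<close>
  define ok where "ok i h \<longleftrightarrow> linear_map R (P i) (Q i) h \<and> good i h \<and>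
    (\<forall>x\<in>carrier (P (Suc i)). h (\<delta> i x) \<in> \<delta>' i ` carrier (Q (Suc i))) \<and>
    (i = 0 \<longrightarrow> (\<forall>x\<in>carrier (P 0). \<epsilon>' (h x) = \<epsilon> x))" for i h
  have "\<exists>\<phi>. \<forall>i. ok i (\<phi> i) \<and> (\<forall>x\<in>carrier (P (Suc i)). \<delta>' i (\<phi> (Suc i) x) = \<phi> i (\<delta> i x))"
  proof (rule dependent_nat_choice)
    from base obtain h where h: "linear_map R (P 0) (Q 0) h" "good 0 h"
      "\<And>x. x \<in> carrier (P 0) \<Longrightarrow> \<epsilon>' (h x) = \<epsilon> x"
      by blast
    have "h (\<delta> 0 x) \<in> \<delta>' 0 ` carrier (Q (Suc 0))" if x: "x \<in> carrier (P (Suc 0))" for x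
    proof -
      note dx = linear_map_closed [OF resolution_linear [OF P] x]
      show ?thesis
        unfolding resolution_exact_0 [OF Q]
        using linear_map_closed [OF h(1) dx] h(3) [OF dx] resolution_aug_diff [OF P x] by simp
    qed
    with h show "\<exists>h. ok 0 h" unfolding ok_def by blast
  next
    fix h i assume ok: "ok i h"
    then obtain h' where h': "linear_map R (P (Suc i)) (Q (Suc i)) h'" "good (Suc i) h'"
      "\<And>x. x \<in> carrier (P (Suc i)) \<Longrightarrow> \<delta>' i (h' x) = h (\<delta> i x)"
      using step [of i h] unfolding ok_def by blast
    have "h' (\<delta> (Suc i) x) \<in> \<delta>' (Suc i) ` carrier (Q (Suc (Suc i)))"
      if x: "x \<in> carrier (P (Suc (Suc i)))" for x
    proof -
      note dx = linear_map_closed [OF resolution_linear [OF P] x]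
      have "linear_map R (P i) (Q i) h" using ok by (simp add: ok_def)
      then have "h \<zero>\<^bsub>P i\<^esub> = \<zero>\<^bsub>Q i\<^esub>"
        by (rule linear_map_zero [OF _ resolution_module [OF P] resolution_module [OF Q]])
      then show ?thesis
        unfolding resolution_exact [OF Q]
        using linear_map_closed [OF h'(1) dx] h'(3) [OF dx] resolution_diff_diff [OF P x] by simp
    qed
    with h' show "\<exists>h'. ok (Suc i) h' \<and> (\<forall>x\<in>carrier (P (Suc i)). \<delta>' i (h' x) = h (\<delta> i x))"
      unfolding ok_def by blast
  qed
  then obtain \<phi> where \<phi>: "\<And>i. ok i (\<phi> i)"
    "\<And>i. \<forall>x\<in>carrier (P (Suc i)). \<delta>' i (\<phi> (Suc i) x) = \<phi> i (\<delta> i x)"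
    by metis
  have "\<forall>x\<in>carrier (P 0). \<epsilon>' (\<phi> 0 x) = \<epsilon> x" using \<phi>(1) [of 0] by (simp add: ok_def)
  moreover have "\<forall>i. linear_map R (P i) (Q i) (\<phi> i) \<and> good i (\<phi> i)"
    using \<phi>(1) by (simp add: ok_def)
  ultimately show ?thesis using \<phi>(2) by blast
qed

lemma projective_chain_map:
  assumes P: "resolution mpoly_ring M P \<delta> \<epsilon>" and Q: "resolution mpoly_ring M Q \<delta>' \<epsilon>'"
    and M: "Module.module mpoly_ring M" and proj: "\<And>i. fg_projective mpoly_ring (P i)"
  shows "\<exists>\<phi>. (\<forall>i. linear_map mpoly_ring (P i) (Q i) (\<phi> i)) \<and>
    (\<forall>x\<in>carrier (P 0). \<epsilon>' (\<phi> 0 x) = \<epsilon> x) \<and>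
    (\<forall>i. \<forall>x\<in>carrier (P (Suc i)). \<delta>' i (\<phi> (Suc i) x) = \<phi> i (\<delta> i x))"
proof -
  have "\<exists>\<phi>. (\<forall>i. linear_map mpoly_ring (P i) (Q i) (\<phi> i) \<and> True) \<and>
    (\<forall>x\<in>carrier (P 0). \<epsilon>' (\<phi> 0 x) = \<epsilon> x) \<and>
    (\<forall>i. \<forall>x\<in>carrier (P (Suc i)). \<delta>' i (\<phi> (Suc i) x) = \<phi> i (\<delta> i x))"
  proof (rule comparison_chain_map [OF P Q, where good = "\<lambda>_ _. True"])
    have "\<exists>h. linear_map mpoly_ring (P 0) (Q 0) h \<and> (\<forall>x\<in>carrier (P 0). \<epsilon>' (h x) = \<epsilon> x)"
    proof (rule fg_projective_lift [OF proj resolution_module [OF Q] M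
          resolution_aug_linear [OF P] resolution_aug_linear [OF Q]])
      show "\<epsilon> x \<in> \<epsilon>' ` carrier (Q 0)" if "x \<in> carrier (P 0)" for x
        unfolding resolution_aug_surj [OF Q] resolution_aug_surj [OF P, symmetric] using that by blast
    qed
    then show "\<exists>h. linear_map mpoly_ring (P 0) (Q 0) h \<and> True \<and> (\<forall>x\<in>carrier (P 0). \<epsilon>' (h x) = \<epsilon> x)"
      by blast
    fix i h assume h: "linear_map mpoly_ring (P i) (Q i) h"
      and hd: "\<And>x. x \<in> carrier (P (Suc i)) \<Longrightarrow> h (\<delta> i x) \<in> \<delta>' i ` carrier (Q (Suc i))"
    have "\<exists>h'. linear_map mpoly_ring (P (Suc i)) (Q (Suc i)) h' \<and>
          (\<forall>x\<in>carrier (P (Suc i)). \<delta>' i (h' x) = h (\<delta> i x))"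
      by (rule fg_projective_lift [OF proj resolution_module [OF Q] resolution_module [OF Q]
          linear_map_comp [OF resolution_linear [OF P] h] resolution_linear [OF Q] hd])
    then show "\<exists>h'. linear_map mpoly_ring (P (Suc i)) (Q (Suc i)) h' \<and> True \<and>
          (\<forall>x\<in>carrier (P (Suc i)). \<delta>' i (h' x) = h (\<delta> i x))"
      by blast
  qed
  then show ?thesis by simp
qed

lemma minimal_resolutionD:
  assumes "minimal_graded_free_resolution M \<sigma> \<delta> \<epsilon>"
  shows minimal_resolution: "resolution mpoly_ring M (\<lambda>i. graded_free (\<sigma> i)) \<delta> \<epsilon>"
    and minimal_graded: "v \<in> component (graded_free (\<sigma> (Suc i))) j \<Longrightarrow>
      \<delta> i v \<in> component (graded_free (\<sigma> i)) j"
    and minimal_aug_graded: "v \<in> component (graded_free (\<sigma> 0)) j \<Longrightarrow> \<epsilon> v \<in> component M j"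
    and minimal_const_coeff: "v \<in> carrier (graded_free (\<sigma> (Suc i))) \<Longrightarrow> const_coeff (\<delta> i v k) = 0"
proof -
  note min = assms [unfolded minimal_graded_free_resolution_def irrelevant_ideal_iff]
  show "resolution mpoly_ring M (\<lambda>i. graded_free (\<sigma> i)) \<delta> \<epsilon>"
    by (rule min [THEN conjunct1])
  show "v \<in> component (graded_free (\<sigma> (Suc i))) j \<Longrightarrow> \<delta> i v \<in> component (graded_free (\<sigma> i)) j"
    by (rule subsetD [OF min [THEN conjunct2, THEN conjunct1, rule_format] imageI])
  show "v \<in> component (graded_free (\<sigma> 0)) j \<Longrightarrow> \<epsilon> v \<in> component M j"
    by (rule subsetD [OF min [THEN conjunct2, THEN conjunct2, THEN conjunct1, rule_format] imageI])
  show "v \<in> carrier (graded_free (\<sigma> (Suc i))) \<Longrightarrow> const_coeff (\<delta> i v k) = 0"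
    by (rule min [THEN conjunct2, THEN conjunct2, THEN conjunct2, rule_format])
qed

lemma linear_map_diff:
  assumes "linear_map mpoly_ring M (graded_free s) h" "linear_map mpoly_ring M (graded_free s) g"
  shows "linear_map mpoly_ring M (graded_free s) (\<lambda>x k. h x k - g x k)"
  using assms by (auto simp: linear_map_def Pi_iff algebra_simps)

lemma linear_map_const_coeff:
  assumes "linear_map mpoly_ring (graded_free s) (graded_free t) h" "v \<in> carrier (graded_free s)"
    and "\<And>l. const_coeff (v l) = 0"
  shows "const_coeff (h v k) = 0"
  using assms(3) by (simp add: linear_map_graded_free_eq_sum [OF assms(1,2)] const_coeff_sum)

lemma linear_map_graded_free_diff:
  assumes "linear_map mpoly_ring (graded_free s) (graded_free t) h"
    and "v \<in> carrier (graded_free s)" "w \<in> carrier (graded_free s)"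
  shows "h (\<lambda>k. v k - w k) = (\<lambda>k. h v k - h w k)"
proof
  fix k
  have "(\<lambda>k. v k - w k) \<in> carrier (graded_free s)" using assms(2,3) by auto
  then show "h (\<lambda>k. v k - w k) k = h v k - h w k"
    using assms(2,3)
    by (simp add: linear_map_graded_free_eq_sum [OF assms(1)] algebra_simps sum_subtractf)
qed

text \<open>A chain endomorphism of a minimal resolution that lifts zero is null-homotopic, and a
  null-homotopic one vanishes modulo the irrelevant ideal because the differentials do.\<close>

lemma chain_map_over_zero_const_coeff:
  fixes M :: "(('n::finite, 'k::field) mpoly, 'm, 'y) graded_module_scheme"
  assumes min: "minimal_graded_free_resolution M \<sigma> \<delta> \<epsilon>" and M: "Module.module mpoly_ring M"
    and lin: "\<And>i. linear_map mpoly_ring (graded_free (\<sigma> i)) (graded_free (\<sigma> i)) (\<theta> i)"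
    and aug: "\<And>x. x \<in> carrier (graded_free (\<sigma> 0)) \<Longrightarrow> \<epsilon> (\<theta> 0 x) = \<zero>\<^bsub>M\<^esub>"
    and chain: "\<And>i x. x \<in> carrier (graded_free (\<sigma> (Suc i))) \<Longrightarrow> \<delta> i (\<theta> (Suc i) x) = \<theta> i (\<delta> i x)"
    and v: "v \<in> carrier (graded_free (\<sigma> i))"
  shows "const_coeff (\<theta> i v k) = 0"
proof -
  let ?F = "\<lambda>i. graded_free (\<sigma> i) :: (('n, 'k) mpoly, nat \<Rightarrow> ('n, 'k) mpoly) graded_module"
  note res = minimal_resolution [OF min]
  note d_lin = resolution_linear [OF res]
  \<comment> \<open>A null-homotopy would give \<open>\<theta> i x = \<delta> i (h i x) + h (i - 1)
    (\<delta> (i - 1) x)\<close>. At \<open>x = \<delta> i y\<close> the last term dies, so the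
    condition below carries just what the next homotopy needs and has the same form for
    \<open>i = 0\<close>.\<close>
  have "(\<exists>h. linear_map mpoly_ring (?F i) (?F (Suc i)) h \<and>
      (\<forall>x\<in>carrier (?F (Suc i)). \<delta> i (h (\<delta> i x)) = \<theta> i (\<delta> i x))) \<and>
      (\<forall>v\<in>carrier (?F i). \<forall>k. const_coeff (\<theta> i v k) = 0)"
  proof (induction i)
    case 0
    have "\<exists>h. linear_map mpoly_ring (?F 0) (?F (Suc 0)) h \<and> (\<forall>x\<in>carrier (?F 0). \<delta> 0 (h x) = \<theta> 0 x)"
    proof (rule fg_projective_lift [OF fg_projective_graded_free module_graded_free
          module_graded_free lin d_lin])
      show "\<theta> 0 x \<in> \<delta> 0 ` carrier (?F (Suc 0))" if "x \<in> carrier (?F 0)" for x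
        unfolding resolution_exact_0 [OF res]
        using aug [OF that] linear_map_closed [OF lin that] by simp
    qed
    then obtain h where h: "linear_map mpoly_ring (?F 0) (?F (Suc 0)) h"
      "\<And>x. x \<in> carrier (?F 0) \<Longrightarrow> \<delta> 0 (h x) = \<theta> 0 x"
      by blast
    have "const_coeff (\<theta> 0 v k) = 0" if "v \<in> carrier (?F 0)" for v k
      using h(2) [OF that] minimal_const_coeff [OF min linear_map_closed [OF h(1) that], of k] by simp
    moreover have "\<delta> 0 (h (\<delta> 0 x)) = \<theta> 0 (\<delta> 0 x)" if "x \<in> carrier (?F (Suc 0))" for x
      by (rule h(2) [OF linear_map_closed [OF d_lin that]])
    ultimately show ?case using h(1) by blast
  next
    case (Suc i)
    then obtain h where h: "linear_map mpoly_ring (?F i) (?F (Suc i)) h"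
      "\<And>x. x \<in> carrier (?F (Suc i)) \<Longrightarrow> \<delta> i (h (\<delta> i x)) = \<theta> i (\<delta> i x)"
      by blast
    \<comment> \<open>The part of \<open>\<theta> (Suc i)\<close> that the next homotopy must
      account for. It is killed by \<open>\<delta> i\<close>, since \<open>\<theta>\<close> is a
      chain map and by the induction hypothesis.\<close>
    let ?g = "\<lambda>x k. \<theta> (Suc i) x k - h (\<delta> i x) k"
    have hd: "linear_map mpoly_ring (?F (Suc i)) (?F (Suc i)) (\<lambda>x. h (\<delta> i x))"
      by (rule linear_map_comp [OF d_lin h(1)])
    have g: "linear_map mpoly_ring (?F (Suc i)) (?F (Suc i)) ?g"
      by (rule linear_map_diff [OF lin hd])
    have "\<exists>h'. linear_map mpoly_ring (?F (Suc i)) (?F (Suc (Suc i))) h' \<and>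
        (\<forall>x\<in>carrier (?F (Suc i)). \<delta> (Suc i) (h' x) = ?g x)"
    proof (rule fg_projective_lift [OF fg_projective_graded_free module_graded_free
          module_graded_free g d_lin])
      fix x assume x: "x \<in> carrier (?F (Suc i))"
      have "\<delta> i (?g x) = (\<lambda>k. \<delta> i (\<theta> (Suc i) x) k - \<delta> i (h (\<delta> i x)) k)"
        by (rule linear_map_graded_free_diff [OF d_lin linear_map_closed [OF lin x] linear_map_closed [OF hd x]])
      also have "\<dots> = (\<lambda>_. 0)"
        using chain [OF x] h(2) [OF x] by simp
      finally show "?g x \<in> \<delta> (Suc i) ` carrier (?F (Suc (Suc i)))"
        unfolding resolution_exact [OF res] using linear_map_closed [OF g x] by simp
    qed
    then obtain h' where h': "linear_map mpoly_ring (?F (Suc i)) (?F (Suc (Suc i))) h'"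
      "\<And>x. x \<in> carrier (?F (Suc i)) \<Longrightarrow> \<delta> (Suc i) (h' x) = ?g x"
      by blast
    have "const_coeff (\<theta> (Suc i) x k) = 0" if x: "x \<in> carrier (?F (Suc i))" for x k
    proof -
      have "const_coeff (?g x k) = 0"
        using h'(2) [OF x] minimal_const_coeff [OF min linear_map_closed [OF h'(1) x], of k] by simp
      moreover have "const_coeff (h (\<delta> i x) k) = 0"
        by (rule linear_map_const_coeff [OF h(1) linear_map_closed [OF d_lin x]])
          (rule minimal_const_coeff [OF min x])
      ultimately show ?thesis by simp
    qed
    moreover have "\<delta> (Suc i) (h' (\<delta> (Suc i) x)) = \<theta> (Suc i) (\<delta> (Suc i) x)"
      if x: "x \<in> carrier (?F (Suc (Suc i)))" for x
    proof -
      note dx = linear_map_closed [OF d_lin x]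
      have "h (\<delta> i (\<delta> (Suc i) x)) = (\<lambda>_. 0)"
        using resolution_diff_diff [OF res x]
          linear_map_zero [OF h(1) module_graded_free module_graded_free] by simp
      then show ?thesis using h'(2) [OF dx] by simp
    qed
    ultimately show ?case using h'(1) by blast
  qed
  then show ?thesis using v by blast
qed

text \<open>The composite and the identity both lift the identity of \<open>M\<close>, so their
  difference is a chain endomorphism over zero and the previous lemma applies. The family
  \<open>Q\<close> is kept arbitrary because it will be a projective resolution in one use and a
  second minimal resolution in the other.\<close>

lemma chain_map_retract_const_coeff:
  fixes M :: "(('n::finite, 'k::field) mpoly, 'm, 'y) graded_module_scheme"
  assumes min: "minimal_graded_free_resolution M \<sigma> \<delta> \<epsilon>" and M: "Module.module mpoly_ring M"
    and \<phi>: "\<And>i. linear_map mpoly_ring (graded_free (\<sigma> i)) (Q i) (\<phi> i)"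
      "\<And>x. x \<in> carrier (graded_free (\<sigma> 0)) \<Longrightarrow> \<epsilon>' (\<phi> 0 x) = \<epsilon> x"
      "\<And>i x. x \<in> carrier (graded_free (\<sigma> (Suc i))) \<Longrightarrow> \<delta>' i (\<phi> (Suc i) x) = \<phi> i (\<delta> i x)"
    and \<psi>: "\<And>i. linear_map mpoly_ring (Q i) (graded_free (\<sigma> i)) (\<psi> i)"
      "\<And>x. x \<in> carrier (Q 0) \<Longrightarrow> \<epsilon> (\<psi> 0 x) = \<epsilon>' x"
      "\<And>i x. x \<in> carrier (Q (Suc i)) \<Longrightarrow> \<delta> i (\<psi> (Suc i) x) = \<psi> i (\<delta>' i x)"
    and v: "v \<in> carrier (graded_free (\<sigma> i))"
  shows "const_coeff (\<psi> i (\<phi> i v) k) = const_coeff (v k)"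
proof -
  let ?F = "\<lambda>i. graded_free (\<sigma> i) :: (('n, 'k) mpoly, nat \<Rightarrow> ('n, 'k) mpoly) graded_module"
  define \<theta> where "\<theta> = (\<lambda>i x k. \<psi> i (\<phi> i x) k - x k)"
  note res = minimal_resolution [OF min]
  have id: "linear_map mpoly_ring (?F i) (?F i) (\<lambda>x. x)" for i
    by (simp add: linear_map_def)
  have \<psi>\<phi>: "linear_map mpoly_ring (?F i) (?F i) (\<lambda>x. \<psi> i (\<phi> i x))" for i
    by (rule linear_map_comp [OF \<phi>(1) \<psi>(1)])
  have lin: "linear_map mpoly_ring (?F i) (?F i) (\<theta> i)" for i
    unfolding \<theta>_def by (rule linear_map_diff [OF \<psi>\<phi> id])
  interpret M: Module.module mpoly_ring M by fact
  have "const_coeff (\<theta> i v k) = 0"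
  proof (rule chain_map_over_zero_const_coeff [OF min M lin _ _ v])
    fix x assume x: "x \<in> carrier (?F 0)"
    have e: "\<epsilon> (\<psi> 0 (\<phi> 0 x)) = \<epsilon> x"
      using \<psi>(2) [OF linear_map_closed [OF \<phi>(1) x]] \<phi>(2) [OF x] by simp
    note aug = resolution_aug_linear [OF res]
    have "\<psi> 0 (\<phi> 0 x) = \<theta> 0 x \<oplus>\<^bsub>?F 0\<^esub> x" by (simp add: \<theta>_def)
    then have "\<epsilon> x = \<epsilon> (\<theta> 0 x) \<oplus>\<^bsub>M\<^esub> \<epsilon> x"
      using e linear_map_add [OF aug linear_map_closed [OF lin x] x] by simp
    then show "\<epsilon> (\<theta> 0 x) = \<zero>\<^bsub>M\<^esub>"
      using M.add.r_cancel_one' [OF linear_map_closed [OF aug x]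
          linear_map_closed [OF aug linear_map_closed [OF lin x]]] by blast
  next
    fix i x assume x: "x \<in> carrier (?F (Suc i))"
    note d_lin = resolution_linear [OF res]
    have "\<delta> i (\<theta> (Suc i) x) = (\<lambda>k. \<delta> i (\<psi> (Suc i) (\<phi> (Suc i) x)) k - \<delta> i x k)"
      unfolding \<theta>_def by (rule linear_map_graded_free_diff [OF d_lin linear_map_closed [OF \<psi>\<phi> x] x])
    also have "\<dots> = \<theta> i (\<delta> i x)"
      using \<psi>(3) [OF linear_map_closed [OF \<phi>(1) x]] \<phi>(3) [OF x] by (simp add: \<theta>_def)
    finally show "\<delta> i (\<theta> (Suc i) x) = \<theta> i (\<delta> i x)" .
  qed
  then show ?thesis by (simp add: \<theta>_def)
qed

text \<open>Modulo the irrelevant ideal, the identity of the \<open>i\<close>-th free module factors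
  through the \<open>i\<close>-th module of a projective resolution of length \<open>p < i\<close>,
  which is zero. A basis vector, having a constant coefficient 1, cannot survive this.\<close>

lemma minimal_resolution_beyond_proj_dim:
  fixes M :: "(('n::finite, 'k::field) mpoly, 'm, 'y) graded_module_scheme"
  assumes min: "minimal_graded_free_resolution M \<sigma> \<delta> \<epsilon>" and M: "Module.module mpoly_ring M"
    and i: "proj_dim mpoly_ring M < enat i"
  shows "\<sigma> i = []"
proof -
  from i obtain p and P :: "nat \<Rightarrow> (('n, 'k) mpoly, nat \<Rightarrow> ('n, 'k) mpoly) module" and \<delta>' \<epsilon>'
    where p: "p < i" and P: "resolution mpoly_ring M P \<delta>' \<epsilon>'"
      and proj: "\<And>i. fg_projective mpoly_ring (P i)"
      and zero: "\<And>i. i > p \<Longrightarrow> carrier (P i) = {\<zero>\<^bsub>P i\<^esub>}"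
    by (auto simp: proj_dim_def Inf_less_iff)
  let ?F = "\<lambda>i. graded_free (\<sigma> i) :: (('n, 'k) mpoly, nat \<Rightarrow> ('n, 'k) mpoly) graded_module"
  note res = minimal_resolution [OF min]
  obtain \<phi> where \<phi>: "\<And>i. linear_map mpoly_ring (?F i) (P i) (\<phi> i)"
      "\<And>x. x \<in> carrier (?F 0) \<Longrightarrow> \<epsilon>' (\<phi> 0 x) = \<epsilon> x"
      "\<And>i x. x \<in> carrier (?F (Suc i)) \<Longrightarrow> \<delta>' i (\<phi> (Suc i) x) = \<phi> i (\<delta> i x)"
    using projective_chain_map [OF res P M fg_projective_graded_free] by blast
  obtain \<psi> where \<psi>: "\<And>i. linear_map mpoly_ring (P i) (?F i) (\<psi> i)"
      "\<And>x. x \<in> carrier (P 0) \<Longrightarrow> \<epsilon> (\<psi> 0 x) = \<epsilon>' x"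
      "\<And>i x. x \<in> carrier (P (Suc i)) \<Longrightarrow> \<delta> i (\<psi> (Suc i) x) = \<psi> i (\<delta>' i x)"
    using projective_chain_map [OF P res M proj] by blast
  show ?thesis
  proof (rule ccontr)
    assume "\<sigma> i \<noteq> []"
    then have e: "unit_vec 0 \<in> carrier (?F i)" by (intro unit_vec_carrier) simp
    have "\<phi> i (unit_vec 0) = \<zero>\<^bsub>P i\<^esub>"
      using linear_map_closed [OF \<phi>(1) e] zero [OF p] by simp
    then have "\<psi> i (\<phi> i (unit_vec 0)) = (\<lambda>_. 0)"
      using linear_map_zero [OF \<psi>(1) resolution_module [OF P] module_graded_free] by simp
    moreover have "const_coeff (\<psi> i (\<phi> i (unit_vec 0)) 0) = const_coeff (unit_vec 0 0 :: ('n, 'k) mpoly)"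
      by (rule chain_map_retract_const_coeff
          [where Q = P and \<phi> = \<phi> and \<psi> = \<psi> and \<delta>' = \<delta>' and \<epsilon>' = \<epsilon>', OF min M])
        (fact \<phi> \<psi> e)+
    ultimately show False by (simp add: unit_vec_def)
  qed
qed

section \<open>Uniqueness of the shifts\<close>

text \<open>Projection to degree \<open>j\<close> in \<open>graded_free s\<close>. Beyond the length
  of \<open>s\<close> the value \<open>s ! k\<close> is unspecified, which is harmless because
  elements of the module vanish there.\<close>

definition vproj ::
  "int list \<Rightarrow> int \<Rightarrow> (nat \<Rightarrow> ('n::finite, 'k::field) mpoly) \<Rightarrow> nat \<Rightarrow> ('n, 'k) mpoly" where
  "vproj s j v k = hcomp (j - s ! k) (v k)"

lemma vproj_component:
  "v \<in> carrier (graded_free s) \<Longrightarrow> vproj s j v \<in> component (graded_free s) j"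
  by (simp add: component_graded_free vproj_def)

lemma vproj_of_component:
  "v \<in> component (graded_free s) j \<Longrightarrow> vproj s j v = v"
proof
  fix k assume "v \<in> component (graded_free s) j"
  then show "vproj s j v k = v k"
    by (cases "k < length s") (simp_all add: component_graded_free vproj_def hcomp_homogeneous)
qed

text \<open>The matrix entry from basis vector \<open>l\<close> to basis vector \<open>k\<close> is
  homogeneous of degree \<open>s ! l - t ! k\<close>, so extracting components passes through every
  product in the matrix sum.\<close>

lemma vproj_linear_map:
  fixes h :: "(nat \<Rightarrow> ('n::finite, 'k::field) mpoly) \<Rightarrow> nat \<Rightarrow> ('n, 'k) mpoly"
  assumes h: "linear_map mpoly_ring (graded_free s) (graded_free t) h"
    and e: "\<And>k. k < length s \<Longrightarrow> h (unit_vec k) \<in> component (graded_free t) (s ! k)"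
    and v: "v \<in> carrier (graded_free s)"
  shows "vproj t j (h v) = h (vproj s j v)"
proof
  fix k
  have v': "vproj s j v \<in> carrier (graded_free s)"
    using vproj_component [OF v] component_subset_carrier by blast
  show "vproj t j (h v) k = h (vproj s j v) k"
  proof (cases "k < length t")
    case True
    have "vproj t j (h v) k = (\<Sum>l<length s. hcomp (j - t ! k) (v l * h (unit_vec l) k))"
      by (simp add: vproj_def linear_map_graded_free_eq_sum [OF h v] hcomp_sum)
    also have "\<dots> = (\<Sum>l<length s. vproj s j v l * h (unit_vec l) k)"
    proof (rule sum.cong)
      fix l assume "l \<in> {..<length s}"
      then have "homogeneous (s ! l - t ! k) (h (unit_vec l) k)"
        using e [of l] True by (simp add: component_graded_free)
      from hcomp_mult [OF this, of "j - t ! k" "v l"]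
      show "hcomp (j - t ! k) (v l * h (unit_vec l) k) = vproj s j v l * h (unit_vec l) k"
        by (simp add: vproj_def)
    qed simp
    also have "\<dots> = h (vproj s j v) k"
      by (rule linear_map_graded_free_eq_sum [OF h v', symmetric])
    finally show ?thesis .
  next
    case False
    then show ?thesis
      using linear_map_closed [OF h v] linear_map_closed [OF h v'] by (simp add: vproj_def)
  qed
qed

lemma graded_linear_mapI:
  fixes h :: "(nat \<Rightarrow> ('n::finite, 'k::field) mpoly) \<Rightarrow> nat \<Rightarrow> ('n, 'k) mpoly"
  assumes h: "linear_map mpoly_ring (graded_free s) (graded_free t) h"
    and e: "\<And>k. k < length s \<Longrightarrow> h (unit_vec k) \<in> component (graded_free t) (s ! k)"
    and v: "v \<in> component (graded_free s) j"
  shows "h v \<in> component (graded_free t) j"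
proof -
  have v': "v \<in> carrier (graded_free s)" using v component_subset_carrier by blast
  have "h v = vproj t j (h v)"
    using vproj_linear_map [OF h e v'] vproj_of_component [OF v] by simp
  then show ?thesis using vproj_component [OF linear_map_closed [OF h v']] by metis
qed

text \<open>The preimages of the basis vectors are chosen homogeneous of the right degree, which by
  linearity makes the whole lift degree-preserving.\<close>

lemma graded_free_lift:
  fixes M :: "(('n::finite, 'k::field) mpoly, 'm, 'y) module_scheme"
  assumes N: "Module.module mpoly_ring M"
    and g: "linear_map mpoly_ring (graded_free s) M g"
    and p: "linear_map mpoly_ring (graded_free t) M p"
    and gp: "\<And>k. k < length s \<Longrightarrow> g (unit_vec k) \<in> p ` component (graded_free t) (s ! k)"
  shows "\<exists>h. linear_map mpoly_ring (graded_free s) (graded_free t) h \<and>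
    (\<forall>j. \<forall>v\<in>component (graded_free s) j. h v \<in> component (graded_free t) j) \<and>
    (\<forall>v\<in>carrier (graded_free s). p (h v) = g v)"
proof -
  have "\<forall>k. \<exists>b. k < length s \<longrightarrow> b \<in> component (graded_free t) (s ! k) \<and> p b = g (unit_vec k)"
    using gp by (metis imageE)
  then obtain b where b: "\<And>k. k < length s \<Longrightarrow> b k \<in> component (graded_free t) (s ! k)"
    and pb: "\<And>k. k < length s \<Longrightarrow> p (b k) = g (unit_vec k)"
    by metis
  have b': "b k \<in> carrier (graded_free t)" if "k < length s" for k
    using b [OF that] component_subset_carrier by blast
  let ?h = "\<lambda>v. lincomb (graded_free t) b v (length s)"
  have h: "linear_map mpoly_ring (graded_free s) (graded_free t) ?h"
    by (rule lincomb_linear_map [OF module_graded_free b'])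
  have "?h v \<in> component (graded_free t) j" if "v \<in> component (graded_free s) j" for v j
  proof (rule graded_linear_mapI [OF h _ that])
    show "?h (unit_vec k) \<in> component (graded_free t) (s ! k)" if "k < length s" for k
      using lincomb_unit_vec_eq [OF module_graded_free b' that] b [OF that] by simp
  qed
  moreover have "p (?h v) = g v" if "v \<in> carrier (graded_free s)" for v
    by (rule free_lift [OF module_graded_free N g p]) (fact b' pb that)+
  ultimately show ?thesis using h by blast
qed

text \<open>The record \<open>graded_module\<close> has no axioms relating \<open>component\<close>
  to the module structure, so surjectivity of the augmentation in each degree is the assumption
  \<open>cover\<close>. Between free modules, homogeneous preimages are obtained by projecting
  arbitrary ones.\<close>

lemma minimal_resolution_chain_map:
  fixes M :: "(('n::finite, 'k::field) mpoly, 'm, 'y) graded_module_scheme"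
  assumes F: "minimal_graded_free_resolution M \<sigma> \<delta> \<epsilon>"
    and G: "minimal_graded_free_resolution M \<tau> \<delta>' \<epsilon>'"
    and M: "Module.module mpoly_ring M"
    and cover: "\<And>j. component M j \<subseteq> \<epsilon>' ` component (graded_free (\<tau> 0)) j"
  shows "\<exists>\<phi>. (\<forall>i. linear_map mpoly_ring (graded_free (\<sigma> i)) (graded_free (\<tau> i)) (\<phi> i) \<and>
      (\<forall>j. \<forall>v\<in>component (graded_free (\<sigma> i)) j. \<phi> i v \<in> component (graded_free (\<tau> i)) j)) \<and>
    (\<forall>x\<in>carrier (graded_free (\<sigma> 0)). \<epsilon>' (\<phi> 0 x) = \<epsilon> x) \<and>
    (\<forall>i. \<forall>x\<in>carrier (graded_free (\<sigma> (Suc i))). \<delta>' i (\<phi> (Suc i) x) = \<phi> i (\<delta> i x))"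
proof (rule comparison_chain_map [OF minimal_resolution [OF F] minimal_resolution [OF G]])
  note resF = minimal_resolution [OF F] and resG = minimal_resolution [OF G]
  have "\<exists>h. linear_map mpoly_ring (graded_free (\<sigma> 0)) (graded_free (\<tau> 0)) h \<and>
    (\<forall>j. \<forall>v\<in>component (graded_free (\<sigma> 0)) j. h v \<in> component (graded_free (\<tau> 0)) j) \<and>
    (\<forall>v\<in>carrier (graded_free (\<sigma> 0)). \<epsilon>' (h v) = \<epsilon> v)"
  proof (rule graded_free_lift [OF M resolution_aug_linear [OF resF] resolution_aug_linear [OF resG]])
    show "\<epsilon> (unit_vec k) \<in> \<epsilon>' ` component (graded_free (\<tau> 0)) (\<sigma> 0 ! k)" if "k < length (\<sigma> 0)" for k
      using cover minimal_aug_graded [OF F unit_vec_component [OF that]] by blast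
  qed
  then show "\<exists>h. linear_map mpoly_ring (graded_free (\<sigma> 0)) (graded_free (\<tau> 0)) h \<and>
    (\<forall>j. \<forall>v\<in>component (graded_free (\<sigma> 0)) j. h v \<in> component (graded_free (\<tau> 0)) j) \<and>
    (\<forall>x\<in>carrier (graded_free (\<sigma> 0)). \<epsilon>' (h x) = \<epsilon> x)" .
next
  note resF = minimal_resolution [OF F] and resG = minimal_resolution [OF G]
  fix i h
  assume h: "linear_map mpoly_ring (graded_free (\<sigma> i)) (graded_free (\<tau> i)) h"
    and hg: "\<forall>j. \<forall>v\<in>component (graded_free (\<sigma> i)) j. h v \<in> component (graded_free (\<tau> i)) j"
    and im: "\<And>x. x \<in> carrier (graded_free (\<sigma> (Suc i))) \<Longrightarrow>
        h (\<delta> i x) \<in> \<delta>' i ` carrier (graded_free (\<tau> (Suc i)))"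
  show "\<exists>h'. linear_map mpoly_ring (graded_free (\<sigma> (Suc i))) (graded_free (\<tau> (Suc i))) h' \<and>
    (\<forall>j. \<forall>v\<in>component (graded_free (\<sigma> (Suc i))) j. h' v \<in> component (graded_free (\<tau> (Suc i))) j) \<and>
    (\<forall>x\<in>carrier (graded_free (\<sigma> (Suc i))). \<delta>' i (h' x) = h (\<delta> i x))"
  proof (rule graded_free_lift [OF module_graded_free linear_map_comp [OF resolution_linear [OF resF] h]
        resolution_linear [OF resG]])
    fix k assume k: "k < length (\<sigma> (Suc i))"
    obtain y where y: "y \<in> carrier (graded_free (\<tau> (Suc i)))" "h (\<delta> i (unit_vec k)) = \<delta>' i y"
      using im [OF unit_vec_carrier [OF k]] by blast
    let ?j = "\<sigma> (Suc i) ! k"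
    have "h (\<delta> i (unit_vec k)) \<in> component (graded_free (\<tau> i)) ?j"
      using hg minimal_graded [OF F unit_vec_component [OF k]] by blast
    \<comment> \<open>\<open>y\<close> need not be homogeneous, but its component of degree
      \<open>?j\<close> has the same image, because that image already has degree
      \<open>?j\<close>.\<close>
    then have "h (\<delta> i (unit_vec k)) = vproj (\<tau> i) ?j (\<delta>' i y)"
      using vproj_of_component y(2) by metis
    also have "\<dots> = \<delta>' i (vproj (\<tau> (Suc i)) ?j y)"
      by (rule vproj_linear_map [OF resolution_linear [OF resG] minimal_graded [OF G unit_vec_component] y(1)])
    finally show "h (\<delta> i (unit_vec k)) \<in> \<delta>' i ` component (graded_free (\<tau> (Suc i))) ?j"
      using vproj_component [OF y(1)] by blast
  qed
qed

text \<open>A rank argument: the unit vectors indexed by \<open>K\<close> are independent and, by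
  \<open>inv\<close>, each is a combination of the rows \<open>b l\<close>, of which there are at
  most \<open>card L\<close>.\<close>

lemma card_le_of_left_inverse:
  fixes a :: "nat \<Rightarrow> nat \<Rightarrow> 'f::field"
  assumes "finite K" "finite L"
    and inv: "\<And>k k'. k \<in> K \<Longrightarrow> k' \<in> K \<Longrightarrow> (\<Sum>l\<in>L. a k l * b l k') = (if k = k' then 1 else 0)"
  shows "card K \<le> card L"
proof -
  \<comment> \<open>Finitely supported sequences serve as the ambient vector space; scaling by
    \<open>c\<close> is the convolution product with the constant \<open>c\<close>.\<close>
  interpret vector_space "\<lambda>c (p :: nat \<Rightarrow>\<^sub>0 'f). Poly_Mapping.single 0 c * p"
    by unfold_locales (auto simp: algebra_simps single_add mult_single simp flip: mult.assoc)
  let ?e = "\<lambda>k. Poly_Mapping.single k (1 :: 'f)"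
  let ?w = "\<lambda>l. \<Sum>k\<in>K. Poly_Mapping.single k (b l k)"
  have inj: "inj_on ?e K"
    by (rule inj_onI) (drule arg_cong [where f = Poly_Mapping.keys], simp)
  have "independent (?e ` K)"
  proof (rule independent_if_scalars_zero)
    fix f x assume sum: "(\<Sum>x\<in>?e ` K. Poly_Mapping.single 0 (f x) * x) = 0" and "x \<in> ?e ` K"
    then obtain k where k: "k \<in> K" "x = ?e k" by blast
    have "0 = Poly_Mapping.lookup (\<Sum>i\<in>K. Poly_Mapping.single i (f (?e i))) k"
      using sum by (simp add: sum.reindex [OF inj] mult_single)
    also have "\<dots> = f (?e k)"
      using k(1) \<open>finite K\<close> by (simp add: lookup_sum lookup_single when_def)
    finally show "f x = 0" using k(2) by simp
  qed (use \<open>finite K\<close> in simp)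
  moreover have "?e ` K \<subseteq> span (?w ` L)"
  proof
    fix x assume "x \<in> ?e ` K"
    then obtain k where k: "k \<in> K" "x = ?e k" by blast
    have "x = (\<Sum>l\<in>L. Poly_Mapping.single 0 (a k l) * ?w l)"
    proof (rule poly_mapping_eqI)
      fix i
      have "Poly_Mapping.lookup (\<Sum>l\<in>L. Poly_Mapping.single 0 (a k l) * ?w l) i =
        (if i \<in> K then \<Sum>l\<in>L. a k l * b l i else 0)"
        using \<open>finite K\<close>
        by (simp add: lookup_sum sum_distrib_left mult_single lookup_single when_def)
      then show "Poly_Mapping.lookup x i =
          Poly_Mapping.lookup (\<Sum>l\<in>L. Poly_Mapping.single 0 (a k l) * ?w l) i"
        using k inv [OF k(1), of i] by (auto simp: lookup_single when_def)
    qed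
    moreover have "(\<Sum>l\<in>L. Poly_Mapping.single 0 (a k l) * ?w l) \<in> span (?w ` L)"
      by (intro span_sum span_scale span_base imageI)
    ultimately show "x \<in> span (?w ` L)" by (simp only:)
  qed
  ultimately have "card (?e ` K) \<le> card (?w ` L)"
    using independent_span_bound [of "?w ` L" "?e ` K"] \<open>finite L\<close> by blast
  moreover have "card (?e ` K) = card K"
    by (rule card_image [OF inj])
  moreover have "card (?w ` L) \<le> card L" by (rule card_image_le [OF \<open>finite L\<close>])
  ultimately show ?thesis by simp
qed

text \<open>Constant coefficients turn the comparison maps into matrices over the field whose
  composite \<open>\<psi> \<phi>\<close> is the identity. A degree-preserving map has nonzero
  constant coefficients only between basis vectors of equal degree, so the identity already holds
  for the blocks of degree \<open>j\<close>, and the rank argument compares their sizes.\<close>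

lemma minimal_resolution_count_le:
  fixes M :: "(('n::finite, 'k::field) mpoly, 'm, 'y) graded_module_scheme"
  assumes F: "minimal_graded_free_resolution M \<sigma> \<delta> \<epsilon>"
    and G: "minimal_graded_free_resolution M \<tau> \<delta>' \<epsilon>'"
    and M: "Module.module mpoly_ring M"
    and coverF: "\<And>j. component M j \<subseteq> \<epsilon> ` component (graded_free (\<sigma> 0)) j"
    and coverG: "\<And>j. component M j \<subseteq> \<epsilon>' ` component (graded_free (\<tau> 0)) j"
  shows "count_list (\<sigma> i) j \<le> count_list (\<tau> i) j"
proof -
  obtain \<phi> where \<phi>: "\<And>i. linear_map mpoly_ring (graded_free (\<sigma> i)) (graded_free (\<tau> i)) (\<phi> i)"
      "\<And>x. x \<in> carrier (graded_free (\<sigma> 0)) \<Longrightarrow> \<epsilon>' (\<phi> 0 x) = \<epsilon> x"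
      "\<And>i x. x \<in> carrier (graded_free (\<sigma> (Suc i))) \<Longrightarrow> \<delta>' i (\<phi> (Suc i) x) = \<phi> i (\<delta> i x)"
    and \<phi>g: "\<And>i j v. v \<in> component (graded_free (\<sigma> i)) j \<Longrightarrow> \<phi> i v \<in> component (graded_free (\<tau> i)) j"
    using minimal_resolution_chain_map [OF F G M coverG] by blast
  obtain \<psi> where \<psi>: "\<And>i. linear_map mpoly_ring (graded_free (\<tau> i)) (graded_free (\<sigma> i)) (\<psi> i)"
      "\<And>x. x \<in> carrier (graded_free (\<tau> 0)) \<Longrightarrow> \<epsilon> (\<psi> 0 x) = \<epsilon>' x"
      "\<And>i x. x \<in> carrier (graded_free (\<tau> (Suc i))) \<Longrightarrow> \<delta> i (\<psi> (Suc i) x) = \<psi> i (\<delta>' i x)"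
    using minimal_resolution_chain_map [OF G F M coverF] by blast
  let ?K = "{k. k < length (\<sigma> i) \<and> \<sigma> i ! k = j}" and ?L = "{l. l < length (\<tau> i) \<and> \<tau> i ! l = j}"
  have "card ?K \<le> card ?L"
  proof (rule card_le_of_left_inverse)
    fix k k' assume k: "k \<in> ?K" and k': "k' \<in> ?K"
    have e: "unit_vec k \<in> carrier (graded_free (\<sigma> i))" using k by (intro unit_vec_carrier) simp
    have "(\<Sum>l\<in>?L. const_coeff (\<phi> i (unit_vec k) l) * const_coeff (\<psi> i (unit_vec l) k')) =
      (\<Sum>l<length (\<tau> i). const_coeff (\<phi> i (unit_vec k) l) * const_coeff (\<psi> i (unit_vec l) k'))"
    \<comment> \<open>Basis vectors of degree other than \<open>j\<close> contribute nothing: the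
      corresponding entry of \<open>\<phi> i\<close> is homogeneous of nonzero degree.\<close>
    proof (rule sum.mono_neutral_left)
      show "\<forall>l\<in>{..<length (\<tau> i)} - ?L.
          const_coeff (\<phi> i (unit_vec k) l) * const_coeff (\<psi> i (unit_vec l) k') = 0"
      proof
        fix l assume l: "l \<in> {..<length (\<tau> i)} - ?L"
        have "unit_vec k \<in> component (graded_free (\<sigma> i)) j"
          using k unit_vec_component [of k "\<sigma> i"] by simp
        from \<phi>g [OF this] have "homogeneous (j - \<tau> i ! l) (\<phi> i (unit_vec k) l)"
          using l by (simp add: component_graded_free)
        then have "const_coeff (\<phi> i (unit_vec k) l) = 0"
          using l by (intro homogeneous_const_coeff) auto
        then show "const_coeff (\<phi> i (unit_vec k) l) * const_coeff (\<psi> i (unit_vec l) k') = 0"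
          by simp
      qed
    qed auto
    also have "\<dots> = const_coeff (\<psi> i (\<phi> i (unit_vec k)) k')"
      by (simp add: linear_map_graded_free_eq_sum [OF \<psi>(1) linear_map_closed [OF \<phi>(1) e]] const_coeff_sum)
    also have "\<dots> = const_coeff (unit_vec k k' :: ('n, 'k) mpoly)"
      by (rule chain_map_retract_const_coeff [where Q = "\<lambda>i. graded_free (\<tau> i)" and \<phi> = \<phi> and \<psi> = \<psi>
            and \<delta>' = \<delta>' and \<epsilon>' = \<epsilon>', OF F M])
        (fact \<phi> \<psi> e)+
    finally show "(\<Sum>l\<in>?L. const_coeff (\<phi> i (unit_vec k) l) * const_coeff (\<psi> i (unit_vec l) k')) =
      (if k = k' then 1 else 0)"
      by (simp add: unit_vec_def)
  qed auto
  then show ?thesis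
    by (simp add: count_list_eq_length_filter length_filter_conv_card eq_commute)
qed

text \<open>Take any preimage of a homogeneous class and project it to degree \<open>j\<close>. On
  the basis, \<open>\<epsilon>\<close> has homogeneous representatives, so the projection amounts to
  taking the component of degree \<open>j\<close> of a representative, and \<open>I\<close> contains
  the components of its elements.\<close>

lemma resolution_quot_module_cover:
  fixes I :: "('n::finite, 'k::field) mpoly set"
  assumes I: "homogeneous_ideal I"
    and res: "resolution mpoly_ring (quot_module I) (\<lambda>i. graded_free (\<sigma> i)) \<delta> \<epsilon>"
    and graded: "\<And>j v. v \<in> component (graded_free (\<sigma> 0)) j \<Longrightarrow> \<epsilon> v \<in> component (quot_module I) j"
  shows "component (quot_module I) j \<subseteq> \<epsilon> ` component (graded_free (\<sigma> 0)) j"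
proof
  note ideal = homogeneous_ideal_imp_ideal [OF I]
  note M = module_quot_module [OF ideal] and aug = resolution_aug_linear [OF res]
  note [simp] = quot_module_simps [OF ideal]
  let ?s = "\<sigma> 0"
  fix y assume "y \<in> component (quot_module I) j"
  then obtain q where q: "y = I +>\<^bsub>mpoly_ring\<^esub> q" "homogeneous j q" by auto
  then have "y \<in> \<epsilon> ` carrier (graded_free ?s)"
    unfolding resolution_aug_surj [OF res] by simp
  then obtain x where x: "x \<in> carrier (graded_free ?s)" "y = \<epsilon> x" by blast
  have "\<forall>k. \<exists>p. k < length ?s \<longrightarrow> homogeneous (?s ! k) p \<and> \<epsilon> (unit_vec k) = I +>\<^bsub>mpoly_ring\<^esub> p"
    using graded [OF unit_vec_component] by fastforce
  then obtain p where p: "\<And>k. k < length ?s \<Longrightarrow> homogeneous (?s ! k) (p k)"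
    "\<And>k. k < length ?s \<Longrightarrow> \<epsilon> (unit_vec k) = I +>\<^bsub>mpoly_ring\<^esub> p k"
    by metis
  have comb: "lincomb (quot_module I) (\<lambda>k. I +>\<^bsub>mpoly_ring\<^esub> p k) v r =
      I +>\<^bsub>mpoly_ring\<^esub> (\<Sum>k<r. v k * p k)" for v r
    by (induction r) simp_all
  have eps: "\<epsilon> v = I +>\<^bsub>mpoly_ring\<^esub> (\<Sum>k<length ?s. v k * p k)" if "v \<in> carrier (graded_free ?s)" for v
  proof -
    have "\<epsilon> v = lincomb (quot_module I) (\<lambda>k. \<epsilon> (unit_vec k)) v (length ?s)"
      by (rule linear_map_eq_lincomb [OF aug M that])
    also have "\<dots> = lincomb (quot_module I) (\<lambda>k. I +>\<^bsub>mpoly_ring\<^esub> p k) v (length ?s)"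
      by (rule lincomb_cong) (rule p(2))
    finally show ?thesis by (simp add: comb)
  qed
  let ?x = "vproj ?s j x"
  have x': "?x \<in> component (graded_free ?s) j" by (rule vproj_component [OF x(1)])
  have "q - (\<Sum>k<length ?s. x k * p k) \<in> I"
    using x q(1) eps coset_eq_iff [OF ideal] by simp
  then have "hcomp j (q - (\<Sum>k<length ?s. x k * p k)) \<in> I"
    by (rule homogeneous_ideal_hcomp [OF I])
  also have "hcomp j (q - (\<Sum>k<length ?s. x k * p k)) = q - (\<Sum>k<length ?s. ?x k * p k)"
  proof -
    have "(\<Sum>k<length ?s. hcomp j (x k * p k)) = (\<Sum>k<length ?s. ?x k * p k)"
      by (rule sum.cong) (auto simp: hcomp_mult [OF p(1)] vproj_def)
    then show ?thesis using q(2) by (simp add: hcomp_diff hcomp_homogeneous hcomp_sum)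
  qed
  finally have "y = \<epsilon> ?x"
    using q(1) eps [OF subsetD [OF component_subset_carrier x']] coset_eq_iff [OF ideal] by simp
  then show "y \<in> \<epsilon> ` component (graded_free ?s) j" using x' by blast
qed

text \<open>Comparison in both directions shows that the resolution chosen by \<open>SOME\<close>
  has the same shifts as the given one, so Betti numbers may be read off any minimal
  resolution.\<close>

lemma graded_betti_quot_module:
  fixes I :: "('n::finite, 'k::field) mpoly set"
  assumes I: "homogeneous_ideal I"
    and min: "minimal_graded_free_resolution (quot_module I) \<sigma> \<delta> \<epsilon>"
  shows "graded_betti (quot_module I) i j = count_list (\<sigma> i) j"
proof -
  let ?\<tau> = "SOME \<sigma>. \<exists>\<delta> \<epsilon>. minimal_graded_free_resolution (quot_module I) \<sigma> \<delta> \<epsilon>"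
  have "\<exists>\<delta> \<epsilon>. minimal_graded_free_resolution (quot_module I) ?\<tau> \<delta> \<epsilon>"
    by (rule someI [where x = \<sigma>]) (use min in blast)
  then obtain \<delta>' \<epsilon>' where min': "minimal_graded_free_resolution (quot_module I) ?\<tau> \<delta>' \<epsilon>'" by blast
  note M = module_quot_module [OF homogeneous_ideal_imp_ideal [OF I]]
  note cover = resolution_quot_module_cover [OF I minimal_resolution minimal_aug_graded]
  show ?thesis
    unfolding graded_betti_def
    using minimal_resolution_count_le [OF min min' M cover [OF min min] cover [OF min' min']]
      minimal_resolution_count_le [OF min' min M cover [OF min' min'] cover [OF min min]]
    by (rule antisym [rotated])
qed

section \<open>Finite generation of submodules of free modules\<close>

lemma mono_subsequence_nat:
  fixes g :: "nat \<Rightarrow> nat"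
  shows "\<exists>\<phi> :: nat \<Rightarrow> nat. strict_mono \<phi> \<and> mono (\<lambda>n. g (\<phi> n))"
proof -
  obtain r :: "nat \<Rightarrow> nat" where r: "strict_mono r" "monoseq (\<lambda>n. g (r n))"
    using seq_monosub [of g] by blast
  show ?thesis
  proof (cases "incseq (\<lambda>n. g (r n))")
    case True
    then show ?thesis using r(1) by (intro exI [of _ r]) simp
  next
    case False
    then have dec: "decseq (\<lambda>n. g (r n))" using r(2) monoseq_iff by blast
    \<comment> \<open>A decreasing sequence of naturals is constant from the place where it attains
      its minimum.\<close>
    obtain N where N: "\<And>n. g (r N) \<le> g (r n)"
      using ex_has_least_nat [of "\<lambda>_. True" 0 "\<lambda>n. g (r n)"] by blast
    have "g (r (n + N)) = g (r N)" for n
      using N [of "n + N"] decseqD [OF dec, of N "n + N"] by simp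
    moreover have "strict_mono (\<lambda>n. r (n + N))"
      using r(1) by (simp add: strict_mono_def)
    ultimately show ?thesis by (intro exI [of _ "\<lambda>n. r (n + N)"]) (simp add: mono_def)
  qed
qed

lemma mono_subsequence_finite:
  fixes f :: "nat \<Rightarrow> 'i \<Rightarrow> nat"
  assumes "finite A"
  shows "\<exists>\<phi> :: nat \<Rightarrow> nat. strict_mono \<phi> \<and> (\<forall>i\<in>A. mono (\<lambda>n. f (\<phi> n) i))"
  using assms
proof (induction A)
  case empty
  show ?case by (rule exI [of _ "\<lambda>n. n"]) (simp add: strict_mono_def)
next
  case (insert a A)
  then obtain \<phi> :: "nat \<Rightarrow> nat" where \<phi>: "strict_mono \<phi>" "\<And>i. i \<in> A \<Longrightarrow> mono (\<lambda>n. f (\<phi> n) i)"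
    by blast
  obtain \<psi> :: "nat \<Rightarrow> nat" where \<psi>: "strict_mono \<psi>" "mono (\<lambda>n. f (\<phi> (\<psi> n)) a)"
    using mono_subsequence_nat [of "\<lambda>n. f (\<phi> n) a"] by blast
  have "mono (\<lambda>n. f (\<phi> (\<psi> n)) i)" if "i \<in> A" for i
    using \<phi>(2) [OF that] strict_mono_mono [OF \<psi>(1)] by (auto simp: mono_def)
  moreover have "strict_mono (\<lambda>n. \<phi> (\<psi> n))"
    using \<phi>(1) \<psi>(1) by (simp add: strict_mono_def)
  ultimately show ?case using \<psi>(2) by (intro exI [of _ "\<lambda>n. \<phi> (\<psi> n)"]) auto
qed

text \<open>\<open>B\<close> consists of the elements that are minimal for divisibility. If there
  were infinitely many, a subsequence nondecreasing in every exponent would contain two distinct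
  ones, the first dividing the second.\<close>

lemma dickson:
  fixes S :: "('n::finite \<Rightarrow>\<^sub>0 nat) set"
  shows "\<exists>B. finite B \<and> B \<subseteq> S \<and> (\<forall>m\<in>S. \<exists>b\<in>B. \<exists>u. m = b + u)"
proof -
  define B where "B = {b\<in>S. \<forall>b'\<in>S. \<forall>u. b = b' + u \<longrightarrow> u = 0}"
  have ex: "\<exists>b\<in>B. \<exists>u. m = b + u" if "m \<in> S" for m
    using that
  proof (induction "mdeg m" arbitrary: m rule: less_induct)
    case less
    show ?case
    proof (cases "m \<in> B")
      case True
      then show ?thesis by (metis add.right_neutral)
    next
      case False
      then obtain b' u where b': "b' \<in> S" "m = b' + u" "u \<noteq> 0"
        using less.prems by (auto simp: B_def)
      then have "mdeg b' < mdeg m"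
        by (simp add: mdeg_add) (metis gr0I mdeg_eq_0_iff)
      then obtain b w where "b \<in> B" "b' = b + w" using less.hyps b'(1) by blast
      then show ?thesis using b'(2) by (metis add.assoc)
    qed
  qed
  have "finite B"
  proof (rule ccontr)
    assume "infinite B"
    then obtain f :: "nat \<Rightarrow> ('n \<Rightarrow>\<^sub>0 nat)" where f: "inj f" "range f \<subseteq> B"
      using infinite_countable_subset by blast
    obtain \<phi> :: "nat \<Rightarrow> nat" where \<phi>: "strict_mono \<phi>" "\<And>i. mono (\<lambda>n. Poly_Mapping.lookup (f (\<phi> n)) i)"
      using mono_subsequence_finite [of UNIV "\<lambda>n. Poly_Mapping.lookup (f n)"] by auto
    \<comment> \<open>Subtraction of exponents is truncated; it is exact here because every exponent
      is nondecreasing along \<open>\<phi>\<close>.\<close>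
    have "f (\<phi> 1) = f (\<phi> 0) + (f (\<phi> 1) - f (\<phi> 0))"
    proof (rule poly_mapping_eqI)
      fix i
      have "Poly_Mapping.lookup (f (\<phi> 0)) i \<le> Poly_Mapping.lookup (f (\<phi> 1)) i"
        using \<phi>(2) [of i] by (auto simp: mono_def)
      then show "Poly_Mapping.lookup (f (\<phi> 1)) i =
          Poly_Mapping.lookup (f (\<phi> 0) + (f (\<phi> 1) - f (\<phi> 0))) i"
        by (simp add: lookup_add lookup_minus)
    qed
    moreover have "f (\<phi> 0) \<in> S" "f (\<phi> 1) \<in> B" using f(2) by (auto simp: B_def)
    ultimately have "f (\<phi> 1) - f (\<phi> 0) = 0" unfolding B_def by blast
    then have "f (\<phi> 1) = f (\<phi> 0)"
      using \<open>f (\<phi> 1) = f (\<phi> 0) + (f (\<phi> 1) - f (\<phi> 0))\<close> by simp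
    then have "\<phi> 1 = \<phi> 0" using f(1) by (simp add: inj_def)
    then show False using \<phi>(1) by (metis strict_mono_eq zero_neq_one)
  qed
  then show ?thesis using ex by (intro exI [of _ B]) (auto simp: B_def)
qed

lemma lex_map_add:
  fixes f g h :: "'a \<Rightarrow> nat"
  shows "(map f xs, map g xs) \<in> lex less_than \<Longrightarrow>
    (map (\<lambda>i. f i + h i) xs, map (\<lambda>i. g i + h i) xs) \<in> lex less_than"
  by (induction xs) auto

lemma lex_total_same_length:
  "length xs = length ys \<Longrightarrow> xs \<noteq> ys \<Longrightarrow> (xs, ys) \<in> lex less_than \<or> (ys, xs) \<in> lex less_than"
  by (induction xs ys rule: list_induct2) auto

lemma lex_trans_nat:
  "(xs, ys) \<in> lex less_than \<Longrightarrow> (ys, zs) \<in> lex less_than \<Longrightarrow> (xs, zs) \<in> lex less_than"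
  by (rule transD [OF lex_transI [OF trans_less_than]])

text \<open>A term order on the monomials of a free module: the position of the basis vector first,
  then the exponents lexicographically.\<close>

definition vars :: "'n::finite list" where
  "vars = (SOME xs. set xs = UNIV)"

lemma set_vars [simp]: "set vars = (UNIV :: 'n::finite set)"
  unfolding vars_def by (rule someI_ex) (rule finite_list [OF finite])

definition term_less :: "(nat \<times> ('n::finite \<Rightarrow>\<^sub>0 nat)) rel" where
  "term_less = inv_image (lex less_than) (\<lambda>(k, m). k # map (Poly_Mapping.lookup m) vars)"

lemma wf_term_less: "wf term_less"
  unfolding term_less_def by (intro wf_inv_image wf_lex wf_less_than)

lemma term_less_trans: "(a, b) \<in> term_less \<Longrightarrow> (b, c) \<in> term_less \<Longrightarrow> (a, c) \<in> term_less"
  unfolding term_less_def in_inv_image by (rule lex_trans_nat)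

lemma term_less_total: "a \<noteq> b \<Longrightarrow> (a, b) \<in> term_less \<or> (b, a) \<in> term_less"
proof -
  assume "a \<noteq> b"
  obtain k m k' m' where ab: "a = (k, m)" "b = (k', m')" by fastforce
  have "k # map (Poly_Mapping.lookup m) vars \<noteq> k' # map (Poly_Mapping.lookup m') vars"
  proof
    assume "k # map (Poly_Mapping.lookup m) vars = k' # map (Poly_Mapping.lookup m') vars"
    then have "k = k'" "\<forall>i\<in>set vars. Poly_Mapping.lookup m i = Poly_Mapping.lookup m' i"
      by (auto simp: map_eq_conv)
    then show False using \<open>a \<noteq> b\<close> ab by (simp add: poly_mapping_eqI)
  qed
  then show ?thesis
    unfolding term_less_def in_inv_image ab split_conv by (intro lex_total_same_length) simp_all
qed

lemma term_less_add: "((k, m), (k', m')) \<in> term_less \<Longrightarrow> ((k, u + m), (k', u + m')) \<in> term_less"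
proof -
  have "Poly_Mapping.lookup (u + n) = (\<lambda>i. Poly_Mapping.lookup n i + Poly_Mapping.lookup u i)" for n
    by (simp add: fun_eq_iff lookup_add add.commute)
  then show "((k, m), (k', m')) \<in> term_less \<Longrightarrow> ((k, u + m), (k', u + m')) \<in> term_less"
    using lex_map_add [of "Poly_Mapping.lookup m" vars "Poly_Mapping.lookup m'" "Poly_Mapping.lookup u"]
    by (auto simp: term_less_def)
qed

section \<open>Leading terms and spans in free modules\<close>

definition vterms :: "(nat \<Rightarrow> ('n::finite, 'k::field) mpoly) \<Rightarrow> (nat \<times> ('n \<Rightarrow>\<^sub>0 nat)) set" where
  "vterms v = {(k, m). m \<in> Poly_Mapping.keys (v k)}"

definition is_lead :: "(nat \<Rightarrow> ('n::finite, 'k::field) mpoly) \<Rightarrow> nat \<times> ('n \<Rightarrow>\<^sub>0 nat) \<Rightarrow> bool" where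
  "is_lead v t \<longleftrightarrow> t \<in> vterms v \<and> (\<forall>t'\<in>vterms v. t' \<noteq> t \<longrightarrow> (t', t) \<in> term_less)"

lemma ex_max_term:
  assumes "finite T" "T \<noteq> {}"
  shows "\<exists>t\<in>T. \<forall>t'\<in>T. t' \<noteq> t \<longrightarrow> (t', t) \<in> term_less"
  using assms
proof (induction T rule: finite_ne_induct)
  case (insert x T)
  then obtain t where t: "t \<in> T" "\<And>t'. t' \<in> T \<Longrightarrow> t' \<noteq> t \<Longrightarrow> (t', t) \<in> term_less"
    by blast
  then have "x \<noteq> t" using insert by blast
  then consider "(x, t) \<in> term_less" | "(t, x) \<in> term_less" using term_less_total by blast
  then show ?case
  proof cases
    case 1
    then show ?thesis using t by blast
  next
    case 2
    then have "(t', x) \<in> term_less" if "t' \<in> T" for t'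
      using t(2) [OF that] term_less_trans by (cases "t' = t") blast+
    then show ?thesis by blast
  qed
qed simp

lemma ex_lead:
  assumes "\<And>k. k \<ge> r \<Longrightarrow> v k = 0" "v \<noteq> (\<lambda>_. 0)"
  shows "\<exists>t. is_lead v t"
proof -
  have "vterms v \<subseteq> (\<Union>k<r. {k} \<times> Poly_Mapping.keys (v k))"
    using assms(1) by (force simp: vterms_def not_less [symmetric])
  then have "finite (vterms v)" by (rule finite_subset) auto
  moreover have "vterms v \<noteq> {}"
  proof -
    obtain k where "v k \<noteq> 0" using assms(2) by auto
    then show ?thesis by (auto simp: vterms_def)
  qed
  ultimately show ?thesis using ex_max_term [of "vterms v"] unfolding is_lead_def by blast
qed

inductive_set vspan ::
  "(nat \<Rightarrow> ('n::finite, 'k::field) mpoly) set \<Rightarrow> (nat \<Rightarrow> ('n, 'k) mpoly) set" for G where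
  zero: "(\<lambda>_. 0) \<in> vspan G"
| step: "v \<in> vspan G \<Longrightarrow> g \<in> G \<Longrightarrow> (\<lambda>k. v k + a * g k) \<in> vspan G"

lemma vspan_add: "w \<in> vspan G \<Longrightarrow> v \<in> vspan G \<Longrightarrow> (\<lambda>k. v k + w k) \<in> vspan G"
proof (induction rule: vspan.induct)
  case (step w g a)
  from vspan.step [OF step.IH [OF step.prems] step.hyps(2), of a]
  show ?case by (simp add: add.assoc)
qed simp

lemma vspan_smult: "v \<in> vspan G \<Longrightarrow> (\<lambda>k. a * v k) \<in> vspan G"
proof (induction rule: vspan.induct)
  case (step v g b)
  from vspan.step [OF step.IH step.hyps(2), of "a * b"]
  show ?case by (simp add: algebra_simps)
qed (simp add: vspan.zero)

lemma vspan_base: "g \<in> G \<Longrightarrow> g \<in> vspan G"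
  using vspan.step [OF vspan.zero, of g G 1] by simp

lemma vspan_sum:
  "(\<And>i. i \<in> A \<Longrightarrow> v i \<in> vspan G) \<Longrightarrow> (\<lambda>k. \<Sum>i\<in>A. v i k) \<in> vspan G"
proof (induction A rule: infinite_finite_induct)
  case (insert i A)
  have "(\<lambda>k. v i k + (\<Sum>i\<in>A. v i k)) \<in> vspan G"
    by (rule vspan_add) (use insert in auto)
  then show ?case using insert.hyps by simp
qed (simp_all add: vspan.zero)

lemma vspan_trans: "v \<in> vspan G \<Longrightarrow> G \<subseteq> vspan H \<Longrightarrow> v \<in> vspan H"
proof (induction rule: vspan.induct)
  case (step v g a)
  have "(\<lambda>k. a * g k) \<in> vspan H" using step by (intro vspan_smult) auto
  then show ?case using step by (intro vspan_add) auto
qed (simp add: vspan.zero)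

lemma vspan_list:
  assumes "v \<in> vspan (set gs)"
  shows "\<exists>a. (\<forall>l\<ge>length gs. a l = 0) \<and> v = (\<lambda>k. \<Sum>l<length gs. a l * (gs ! l) k)"
  using assms
proof (induction rule: vspan.induct)
  case zero
  show ?case by (rule exI [of _ "\<lambda>_. 0"]) simp
next
  case (step v g c)
  then obtain a i where a: "\<forall>l\<ge>length gs. a l = 0" "v = (\<lambda>k. \<Sum>l<length gs. a l * (gs ! l) k)"
    and i: "i < length gs" "g = gs ! i"
    by (auto simp: in_set_conv_nth)
  let ?b = "\<lambda>l. a l + (if l = i then c else 0)"
  have "v k + c * g k = (\<Sum>l<length gs. ?b l * (gs ! l) k)" for k
    using a(2) i by (simp add: distrib_right sum.distrib if_distrib [where f = "\<lambda>x. x * _"] cong: if_cong)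
  then show ?case using a(1) i(1) by (intro exI [of _ ?b]) auto
qed

definition vsubmodule :: "nat \<Rightarrow> (nat \<Rightarrow> ('n::finite, 'k::field) mpoly) set \<Rightarrow> bool" where
  "vsubmodule r K \<longleftrightarrow> (\<forall>v\<in>K. \<forall>k\<ge>r. v k = 0) \<and> (\<lambda>_. 0) \<in> K \<and>
     (\<forall>v\<in>K. \<forall>w\<in>K. (\<lambda>k. v k + w k) \<in> K) \<and> (\<forall>a. \<forall>v\<in>K. (\<lambda>k. a * v k) \<in> K)"

lemma vsubmoduleD:
  assumes "vsubmodule r K"
  shows vsubmodule_out: "v \<in> K \<Longrightarrow> k \<ge> r \<Longrightarrow> v k = 0"
    and vsubmodule_zero: "(\<lambda>_. 0) \<in> K"
    and vsubmodule_add: "v \<in> K \<Longrightarrow> w \<in> K \<Longrightarrow> (\<lambda>k. v k + w k) \<in> K"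
    and vsubmodule_smult: "v \<in> K \<Longrightarrow> (\<lambda>k. a * v k) \<in> K"
  using assms by (simp_all add: vsubmodule_def)

lemma vspan_subset_vsubmodule:
  assumes "vsubmodule r K" "G \<subseteq> K" shows "vspan G \<subseteq> K"
proof
  show "v \<in> K" if "v \<in> vspan G" for v
    using that
  proof induction
    case (step v g a)
    have "(\<lambda>k. a * g k) \<in> K" using step.hyps(2) assms(2) by (intro vsubmodule_smult [OF assms(1)]) auto
    then show ?case by (rule vsubmodule_add [OF assms(1) step.IH])
  qed (rule vsubmodule_zero [OF assms(1)])
qed

lemma lookup_single_mult_add:
  fixes p :: "('n::finite, 'k::field) mpoly"
  shows "Poly_Mapping.lookup (Poly_Mapping.single u c * p) (u + m) = c * Poly_Mapping.lookup p m"
proof -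
  let ?q = "p - Poly_Mapping.single m (Poly_Mapping.lookup p m)"
  have "u + m \<notin> Poly_Mapping.keys (Poly_Mapping.single u c * ?q)"
  proof
    assume "u + m \<in> Poly_Mapping.keys (Poly_Mapping.single u c * ?q)"
    then obtain x y where xy: "u + m = x + y" "x \<in> Poly_Mapping.keys (Poly_Mapping.single u c)"
      "y \<in> Poly_Mapping.keys ?q"
      using keys_mult by blast
    then have "x = u" by (auto split: if_splits)
    then have "y = m" using xy(1) by simp
    then show False using xy(3) by (simp add: in_keys_iff lookup_minus)
  qed
  then have "Poly_Mapping.lookup (Poly_Mapping.single u c * ?q) (u + m) = 0"
    by (simp add: in_keys_iff)
  then show ?thesis by (simp add: right_diff_distrib lookup_minus mult_single)
qed

text \<open>Division by leading terms, as for Groebner bases. For each position \<open>k\<close>,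
  Dickson's lemma selects finitely many leading exponents such that every leading exponent is a
  multiple of one of them. Elements of \<open>K\<close> with these leading terms generate
  \<open>K\<close>, by well-founded induction on the leading term of the element to be
  reduced.\<close>

lemma vsubmodule_finitely_generated:
  fixes K :: "(nat \<Rightarrow> ('n::finite, 'k::field) mpoly) set"
  assumes K: "vsubmodule r K"
  shows "\<exists>G. finite G \<and> G \<subseteq> K \<and> K \<subseteq> vspan G"
proof -
  define S where "S = (\<lambda>k. {m. \<exists>v\<in>K. is_lead v (k, m)})"
  have "\<exists>B. \<forall>k. finite (B k) \<and> B k \<subseteq> S k \<and> (\<forall>m\<in>S k. \<exists>b\<in>B k. \<exists>u. m = b + u)"
    by (rule choice) (intro allI dickson)
  then obtain B where "\<forall>k. finite (B k) \<and> B k \<subseteq> S k \<and> (\<forall>m\<in>S k. \<exists>b\<in>B k. \<exists>u. m = b + u)"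
    by (elim exE) (rule that)
  then have B: "\<And>k. finite (B k)" "\<And>k. B k \<subseteq> S k"
    "\<And>k m. m \<in> S k \<Longrightarrow> \<exists>b\<in>B k. \<exists>u. m = b + u"
    by simp_all
  define g where "g = (\<lambda>k b. SOME g. g \<in> K \<and> is_lead g (k, b))"
  have "g k b \<in> K \<and> is_lead (g k b) (k, b)" if "b \<in> B k" for k b
  proof -
    have "\<exists>g. g \<in> K \<and> is_lead g (k, b)" using that B(2) by (auto simp: S_def)
    from someI_ex [OF this] show ?thesis by (simp add: g_def)
  qed
  then have g: "\<And>k b. b \<in> B k \<Longrightarrow> g k b \<in> K" "\<And>k b. b \<in> B k \<Longrightarrow> is_lead (g k b) (k, b)"
    by simp_all
  define G where "G = (\<Union>k<r. g k ` B k)"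
  have GK: "G \<subseteq> K" using g(1) by (auto simp: G_def)
  have "v \<in> vspan G" if "v \<in> K" "is_lead v t" for v t
    using wf_term_less that
  proof (induction t arbitrary: v rule: wf_induct_rule)
    case (less t v)
    obtain k m where t: "t = (k, m)" by fastforce
    have m: "m \<in> Poly_Mapping.keys (v k)"
      using less.prems(2) by (simp add: t is_lead_def vterms_def)
    have k: "k < r"
      using m vsubmodule_out [OF K less.prems(1), of k] by (cases "k < r") auto
    obtain b u where b: "b \<in> B k" "m = b + u" using B(3) [of m k] less.prems t by (auto simp: S_def)
    have lead_g: "is_lead (g k b) (k, b)" by (rule g(2) [OF b(1)])
    \<comment> \<open>\<open>s\<close> is the monomial for which the leading terms of
      \<open>v\<close> and of the multiple of \<open>g k b\<close> by \<open>s\<close>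
      cancel.\<close>
    define c where "c = Poly_Mapping.lookup (v k) m / Poly_Mapping.lookup (g k b k) b"
    define s where "s = Poly_Mapping.single u c"
    define w where "w = (\<lambda>l. v l + (- s) * g k b l)"
    have wK: "w \<in> K"
      unfolding w_def by (intro vsubmodule_add [OF K] vsubmodule_smult [OF K] g(1) b(1) less.prems(1))
    \<comment> \<open>Every term of \<open>w\<close> comes from \<open>v\<close> or from the
      multiple of \<open>g k b\<close>. In both the largest possible term is \<open>t\<close>, and
      in \<open>w\<close> it has cancelled.\<close>
    have w_terms: "(t', t) \<in> term_less" if t': "t' \<in> vterms w" for t'
    proof -
      obtain l n where ln: "t' = (l, n)" by fastforce
      have n: "Poly_Mapping.lookup (w l) n \<noteq> 0"
        using t' by (simp add: ln vterms_def in_keys_iff)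
      have gb: "Poly_Mapping.lookup (g k b k) b \<noteq> 0"
        using lead_g by (simp add: is_lead_def vterms_def in_keys_iff)
      have "t' \<noteq> t"
      proof
        assume "t' = t"
        then have "l = k" "n = u + b" using t ln b(2) by (auto simp: add.commute)
        then have "Poly_Mapping.lookup (w l) n = 0"
          using gb lookup_single_mult_add [of u c "g k b k" b] b(2)
          by (simp add: w_def s_def lookup_add lookup_minus c_def add.commute)
        then show False using n by simp
      qed
      consider "n \<in> Poly_Mapping.keys (v l)" | "n \<in> Poly_Mapping.keys (s * g k b l)"
        using n by (cases "Poly_Mapping.lookup (v l) n = 0")
          (auto simp: w_def lookup_add lookup_minus in_keys_iff)
      then show ?thesis
      proof cases
        case 1
        then show ?thesis
          using less.prems(2) \<open>t' \<noteq> t\<close> by (simp add: is_lead_def vterms_def ln)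
      next
        case 2
        then obtain x y where xy: "n = x + y" "x \<in> Poly_Mapping.keys s" "y \<in> Poly_Mapping.keys (g k b l)"
          using keys_mult by blast
        then have "x = u" by (auto simp: s_def split: if_splits)
        then have "(l, y) \<noteq> (k, b)" using \<open>t' \<noteq> t\<close> xy(1) ln t b(2) by (auto simp: add.commute)
        then have "((l, y), (k, b)) \<in> term_less"
          using lead_g xy(3) by (simp add: is_lead_def vterms_def)
        from term_less_add [OF this, of u] show ?thesis
          using ln t xy(1) \<open>x = u\<close> b(2) by (simp add: add.commute)
      qed
    qed
    have wG: "w \<in> vspan G"
    proof (cases "w = (\<lambda>_. 0)")
      case True
      then show ?thesis by (simp add: vspan.zero)
    next
      case False
      obtain t' where t': "is_lead w t'"
        using ex_lead [OF vsubmodule_out [OF K wK] False] by blast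
      then have "(t', t) \<in> term_less" using w_terms by (simp add: is_lead_def)
      then show ?thesis by (rule less.IH [OF _ wK t'])
    qed
    have "g k b \<in> G" using k b(1) by (auto simp: G_def)
    from vspan.step [OF wG this, of s] show ?case by (simp add: w_def)
  qed
  moreover have "\<exists>t. is_lead v t" if "v \<in> K" "v \<noteq> (\<lambda>_. 0)" for v
    using ex_lead [OF vsubmodule_out [OF K that(1)] that(2)] by blast
  ultimately have "K \<subseteq> vspan G" by (metis subsetI vspan.zero)
  moreover have "finite G" using B(1) by (simp add: G_def)
  ultimately show ?thesis using GK by blast
qed

section \<open>Existence of minimal graded free resolutions\<close>

definition graded_submodule :: "int list \<Rightarrow> (nat \<Rightarrow> ('n::finite, 'k::field) mpoly) set \<Rightarrow> bool" where
  "graded_submodule s K \<longleftrightarrow> vsubmodule (length s) K \<and> (\<forall>v\<in>K. \<forall>j. vproj s j v \<in> K)"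

lemma sum_vproj:
  assumes "v \<in> carrier (graded_free s)"
  shows "\<exists>J. finite J \<and> v = (\<lambda>k. \<Sum>j\<in>J. vproj s j v k)"
proof (intro exI conjI)
  let ?J = "\<Union>k<length s. (\<lambda>m. int (mdeg m) + s ! k) ` Poly_Mapping.keys (v k)"
  show "finite ?J" by auto
  show "v = (\<lambda>k. \<Sum>j\<in>?J. vproj s j v k)"
  proof
    fix k
    show "v k = (\<Sum>j\<in>?J. vproj s j v k)"
    proof (cases "k < length s")
      case True
      show ?thesis
      proof (rule poly_mapping_eqI)
        fix m
        have "Poly_Mapping.lookup (\<Sum>j\<in>?J. vproj s j v k) m =
          (\<Sum>j\<in>?J. if j = int (mdeg m) + s ! k then Poly_Mapping.lookup (v k) m else 0)"
          unfolding lookup_sum by (rule sum.cong) (auto simp: vproj_def lookup_hcomp when_def)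
        also have "\<dots> = (if int (mdeg m) + s ! k \<in> ?J then Poly_Mapping.lookup (v k) m else 0)"
          using \<open>finite ?J\<close> by (subst sum.delta) auto
        also have "\<dots> = Poly_Mapping.lookup (v k) m"
        proof (cases "m \<in> Poly_Mapping.keys (v k)")
          case mem: True
          have "int (mdeg m) + s ! k \<in> ?J" by (rule UN_I [of k]) (use True mem in auto)
          then show ?thesis by simp
        qed (simp add: in_keys_iff)
        finally show "Poly_Mapping.lookup (v k) m = Poly_Mapping.lookup (\<Sum>j\<in>?J. vproj s j v k) m"
          by simp
      qed
    next
      case False
      then show ?thesis using assms by (simp add: vproj_def)
    qed
  qed
qed

text \<open>Replacing each generator by its finitely many homogeneous components stays inside
  \<open>K\<close>, since \<open>K\<close> is graded, and can only enlarge the span.\<close>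

lemma graded_submodule_generators:
  fixes K :: "(nat \<Rightarrow> ('n::finite, 'k::field) mpoly) set"
  assumes K: "graded_submodule s K"
  shows "\<exists>G. finite G \<and> G \<subseteq> K \<and> (\<forall>g\<in>G. \<exists>j. g \<in> component (graded_free s) j) \<and> K \<subseteq> vspan G"
proof -
  have sub: "vsubmodule (length s) K" using K by (simp add: graded_submodule_def)
  have car: "v \<in> carrier (graded_free s)" if "v \<in> K" for v
    using vsubmodule_out [OF sub that] by simp
  obtain G where G: "finite G" "G \<subseteq> K" "K \<subseteq> vspan G"
    using vsubmodule_finitely_generated [OF sub] by blast
  define J where "J = (\<lambda>g :: nat \<Rightarrow> ('n, 'k) mpoly. SOME J. finite J \<and> g = (\<lambda>k. \<Sum>j\<in>J. vproj s j g k))"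
  have "finite (J g) \<and> g = (\<lambda>k. \<Sum>j\<in>J g. vproj s j g k)" if "g \<in> G" for g
    unfolding J_def by (rule someI_ex) (rule sum_vproj [OF car [OF subsetD [OF G(2) that]]])
  then have J: "finite (J g)" "g = (\<lambda>k. \<Sum>j\<in>J g. vproj s j g k)" if "g \<in> G" for g
    using that by simp_all
  define H where "H = (\<Union>g\<in>G. (\<lambda>j. vproj s j g) ` J g)"
  have "finite H" unfolding H_def using G(1) J(1) by blast
  moreover have "H \<subseteq> K" using K G(2) by (auto simp: H_def graded_submodule_def)
  moreover have "\<forall>h\<in>H. \<exists>j. h \<in> component (graded_free s) j"
  proof
    fix h assume "h \<in> H"
    then obtain g j where "g \<in> G" "h = vproj s j g" unfolding H_def by blast
    then show "\<exists>j. h \<in> component (graded_free s) j"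
      using vproj_component [OF car] G(2) by blast
  qed
  moreover have "K \<subseteq> vspan H"
  proof
    have "g \<in> vspan H" if "g \<in> G" for g
    proof (subst J(2) [OF that], rule vspan_sum, rule vspan_base)
      show "vproj s j g \<in> H" if "j \<in> J g" for j
        using that \<open>g \<in> G\<close> unfolding H_def by blast
    qed
    then show "v \<in> vspan H" if "v \<in> K" for v
      using vspan_trans [of v G H] G(3) that by blast
  qed
  ultimately show ?thesis by blast
qed

text \<open>Graded Nakayama in elementary form: a homogeneous generating set of least cardinality
  admits no relation with a nonzero constant coefficient, for otherwise one generator could be
  expressed by the others. The last clause records this; it will put the image of the next
  differential into the irrelevant ideal times the free module.\<close>

lemma minimal_cover:
  fixes K :: "(nat \<Rightarrow> ('n::finite, 'k::field) mpoly) set"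
  assumes K: "graded_submodule s K"
  shows "\<exists>t \<delta>. linear_map mpoly_ring (graded_free t) (graded_free s) \<delta> \<and>
    (\<forall>j. \<forall>v\<in>component (graded_free t) j. \<delta> v \<in> component (graded_free s) j) \<and>
    \<delta> ` carrier (graded_free t) = K \<and>
    (\<forall>v\<in>carrier (graded_free t). \<delta> v = (\<lambda>_. 0) \<longrightarrow> (\<forall>k. const_coeff (v k) = 0))"
proof -
  have sub: "vsubmodule (length s) K" using K by (simp add: graded_submodule_def)
  define gen where "gen G \<longleftrightarrow> finite G \<and> G \<subseteq> K \<and>
    (\<forall>g\<in>G. \<exists>j. g \<in> component (graded_free s) j) \<and> K \<subseteq> vspan G" for G
  have "\<exists>G. gen G" unfolding gen_def by (rule graded_submodule_generators [OF K])
  then obtain G0 where "gen G0" by blast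
  from ex_has_least_nat [of gen, OF this, of card]
  obtain G where "gen G \<and> (\<forall>H. gen H \<longrightarrow> card G \<le> card H)"
    by (elim exE) (rule that)
  then have gen: "gen G" and least: "\<And>H. gen H \<Longrightarrow> card G \<le> card H" by simp_all
  have G: "finite G" "G \<subseteq> K" "\<And>g. g \<in> G \<Longrightarrow> \<exists>j. g \<in> component (graded_free s) j" "K \<subseteq> vspan G"
    using gen by (simp_all add: gen_def)
  obtain gs where gs: "set gs = G" "distinct gs" using finite_distinct_list [OF G(1)] by blast
  define t where "t = map (\<lambda>g. SOME j. g \<in> component (graded_free s) j) gs"
  have len [simp]: "length t = length gs" by (simp add: t_def)
  have gs_comp: "gs ! l \<in> component (graded_free s) (t ! l)" if "l < length gs" for l
  proof -
    have "\<exists>j. gs ! l \<in> component (graded_free s) j" using G(3) gs(1) nth_mem [OF that] by simp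
    from someI_ex [OF this] show ?thesis using that by (simp add: t_def)
  qed
  have gs_car: "gs ! l \<in> carrier (graded_free s)" if "l < length t" for l
    using gs_comp [of l] that component_subset_carrier by auto
  define \<delta> where "\<delta> = (\<lambda>v. lincomb (graded_free s) ((!) gs) v (length t))"
  have \<delta>_eq: "\<delta> v = (\<lambda>k. \<Sum>l<length gs. v l * (gs ! l) k)" for v
    by (simp add: \<delta>_def lincomb_graded_free)
  have lin: "linear_map mpoly_ring (graded_free t) (graded_free s) \<delta>"
    unfolding \<delta>_def by (rule lincomb_linear_map [OF module_graded_free gs_car])
  have e: "\<delta> (unit_vec l) \<in> component (graded_free s) (t ! l)" if "l < length t" for l
    using lincomb_unit_vec_eq [OF module_graded_free gs_car that] gs_comp [of l] that
    by (simp add: \<delta>_def)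
  have "\<delta> v \<in> component (graded_free s) j" if "v \<in> component (graded_free t) j" for v j
    by (rule graded_linear_mapI [OF lin e that])
  moreover have "\<delta> ` carrier (graded_free t) = K"
  proof (intro equalityI subsetI)
    fix w assume "w \<in> \<delta> ` carrier (graded_free t)"
    then obtain v where "w = \<delta> v" by blast
    have "\<delta> v \<in> vspan G"
      unfolding \<delta>_eq by (intro vspan_sum vspan_smult vspan_base) (use gs(1) in auto)
    then have "w \<in> vspan G" by (simp only: \<open>w = \<delta> v\<close>)
    then show "w \<in> K" using vspan_subset_vsubmodule [OF sub G(2)] by blast
  next
    fix w assume "w \<in> K"
    then have "w \<in> vspan (set gs)" using G(4) gs(1) by blast
    from vspan_list [OF this] show "w \<in> \<delta> ` carrier (graded_free t)"
      by (auto simp: \<delta>_eq)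
  qed
  moreover have "const_coeff (v k) = 0"
    if v: "v \<in> carrier (graded_free t)" and 0: "\<delta> v = (\<lambda>_. 0)" for v k
  proof (rule ccontr)
    define c where "c = const_coeff (v k)"
    assume "const_coeff (v k) \<noteq> 0"
    then have c: "c \<noteq> 0" by (simp add: c_def)
    have k: "k < length gs"
    proof (rule ccontr)
      assume "\<not> k < length gs"
      then have "v k = 0" using v by simp
      then show False using c by (simp add: c_def)
    qed
    \<comment> \<open>Project the relation to the degree of the \<open>k\<close>-th generator. There
      the coefficient of that generator is the constant \<open>c\<close> alone, which is a unit, so
      the relation can be solved for the generator.\<close>
    define w where "w = vproj t (t ! k) v"
    have wk: "w k = Poly_Mapping.single 0 c"
      by (simp add: w_def vproj_def hcomp_0_eq c_def)
    have "\<delta> w = vproj s (t ! k) (\<delta> v)"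
      unfolding w_def by (rule vproj_linear_map [OF lin e v, symmetric])
    then have dw: "(\<Sum>l<length gs. w l * (gs ! l) i) = 0" for i
      using fun_cong [OF \<delta>_eq [of w], of i] 0 by (simp add: vproj_def)
    let ?H = "G - {gs ! k}"
    let ?a = "Poly_Mapping.single 0 (- inverse c)"
    have "gs ! k = (\<lambda>i. \<Sum>l\<in>{..<length gs} - {k}. ?a * w l * (gs ! l) i)"
    proof
      fix i
      have "w k * (gs ! k) i + (\<Sum>l\<in>{..<length gs} - {k}. w l * (gs ! l) i) = 0"
        using dw [of i] k by (simp add: sum.remove [of _ k])
      then have "?a * (w k * (gs ! k) i) + ?a * (\<Sum>l\<in>{..<length gs} - {k}. w l * (gs ! l) i) = 0"
        by (simp only: distrib_left [symmetric] mult_zero_right)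
      moreover have "?a * (w k * (gs ! k) i) = - (gs ! k) i"
        using c by (simp add: wk mult_single single_uminus flip: mult.assoc)
      ultimately show "(gs ! k) i = (\<Sum>l\<in>{..<length gs} - {k}. ?a * w l * (gs ! l) i)"
        by (simp add: sum_distrib_left mult.assoc)
    qed
    moreover have "(\<lambda>i. \<Sum>l\<in>{..<length gs} - {k}. ?a * w l * (gs ! l) i) \<in> vspan ?H"
    proof (intro vspan_sum vspan_smult vspan_base)
      fix l assume "l \<in> {..<length gs} - {k}"
      then show "gs ! l \<in> ?H" using gs k nth_eq_iff_index_eq [OF gs(2), of l k] by auto
    qed
    ultimately have "gs ! k \<in> vspan ?H" by simp
    then have "G \<subseteq> vspan ?H" using vspan_base [of _ ?H] by blast
    then have "K \<subseteq> vspan ?H" using G(4) vspan_trans by blast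
    then have "gen ?H" unfolding gen_def using G(1-3) by (intro conjI ballI) auto
    then have "card G \<le> card ?H" by (rule least)
    moreover have "card ?H < card G"
      by (rule card_Diff1_less [OF G(1)]) (use gs(1) k in auto)
    ultimately show False by simp
  qed
  ultimately show ?thesis using lin by blast
qed

lemma graded_submodule_kernel:
  fixes \<delta> :: "(nat \<Rightarrow> ('n::finite, 'k::field) mpoly) \<Rightarrow> nat \<Rightarrow> ('n, 'k) mpoly"
  assumes lin: "linear_map mpoly_ring (graded_free t) (graded_free s) \<delta>"
    and graded: "\<And>j v. v \<in> component (graded_free t) j \<Longrightarrow> \<delta> v \<in> component (graded_free s) j"
  shows "graded_submodule t {v \<in> carrier (graded_free t). \<delta> v = (\<lambda>_. 0)}"
proof -
  have "\<delta> (\<lambda>_. 0) = (\<lambda>_. 0)"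
    using linear_map_zero [OF lin module_graded_free module_graded_free] by simp
  moreover have "\<delta> (\<lambda>k. v k + w k) = (\<lambda>k. \<delta> v k + \<delta> w k)"
    if "v \<in> carrier (graded_free t)" "w \<in> carrier (graded_free t)" for v w
    using linear_map_add [OF lin that] by simp
  moreover have "\<delta> (\<lambda>k. a * v k) = (\<lambda>k. a * \<delta> v k)" if "v \<in> carrier (graded_free t)" for a v
    using linear_map_smult [OF lin _ that, of a] by simp
  moreover have "\<delta> (vproj t j v) = (\<lambda>_. 0)"
    if "v \<in> carrier (graded_free t)" "\<delta> v = (\<lambda>_. 0)" for j v
  proof -
    have "\<delta> (vproj t j v) = vproj s j (\<lambda>_. 0)"
      using vproj_linear_map [OF lin graded [OF unit_vec_component] that(1), of j] that(2) by simp
    then show ?thesis by (simp add: vproj_def fun_eq_iff)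
  qed
  ultimately show ?thesis
    by (auto simp: graded_submodule_def vsubmodule_def vproj_def)
qed

text \<open>Starting from the given \<open>graded_free s\<close>, minimal covers of kernels are
  iterated. Minimality of a differential is a condition on its image, so it comes from the
  constant-coefficient clause of the cover one step earlier, and from \<open>min\<close> at the
  start.\<close>

lemma ex_minimal_resolution:
  fixes M :: "(('n::finite, 'k::field) mpoly, 'm, 'y) graded_module_scheme"
  assumes aug: "linear_map mpoly_ring (graded_free s) M \<epsilon>"
    and surj: "\<epsilon> ` carrier (graded_free s) = carrier M"
    and graded: "\<And>j v. v \<in> component (graded_free s) j \<Longrightarrow> \<epsilon> v \<in> component M j"
    and ker: "graded_submodule s {v \<in> carrier (graded_free s). \<epsilon> v = \<zero>\<^bsub>M\<^esub>}"
    and min: "\<And>v k. v \<in> carrier (graded_free s) \<Longrightarrow> \<epsilon> v = \<zero>\<^bsub>M\<^esub> \<Longrightarrow> const_coeff (v k) = 0"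
  shows "\<exists>\<sigma> \<delta>. minimal_graded_free_resolution M \<sigma> \<delta> \<epsilon>"
proof -
  let ?K0 = "{v \<in> carrier (graded_free s). \<epsilon> v = \<zero>\<^bsub>M\<^esub>}"
  \<comment> \<open>A state consists of the shifts of the current free module and the submodule of
    it to be covered next, namely the kernel of the map leaving it. The clause for
    \<open>n = 0\<close> anchors the sequence at \<open>\<epsilon>\<close>.\<close>
  define ok :: "nat \<Rightarrow> int list \<times> (nat \<Rightarrow> ('n, 'k) mpoly) set \<Rightarrow> bool" where
    "ok n x \<longleftrightarrow> graded_submodule (fst x) (snd x) \<and> (\<forall>v\<in>snd x. \<forall>k. const_coeff (v k) = 0) \<and>
      (n = 0 \<longrightarrow> x = (s, ?K0))" for n x
  define next_syz :: "int list \<times> (nat \<Rightarrow> ('n, 'k) mpoly) set \<Rightarrow> _ \<Rightarrow> _ \<Rightarrow> bool" where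
    "next_syz x y \<delta> \<longleftrightarrow> linear_map mpoly_ring (graded_free (fst y)) (graded_free (fst x)) \<delta> \<and>
      (\<forall>j. \<forall>v\<in>component (graded_free (fst y)) j. \<delta> v \<in> component (graded_free (fst x)) j) \<and>
      \<delta> ` carrier (graded_free (fst y)) = snd x \<and>
      snd y = {v \<in> carrier (graded_free (fst y)). \<delta> v = (\<lambda>_. 0)}" for x y \<delta>
  have "\<exists>f. \<forall>n. ok n (f n) \<and> (\<exists>\<delta>. next_syz (f n) (f (Suc n)) \<delta>)"
  proof (rule dependent_nat_choice)
    show "\<exists>x. ok 0 x"
      using ker min by (intro exI [of _ "(s, ?K0)"]) (simp add: ok_def del: graded_free_simps)
    fix x n assume "ok n x"
    then have "graded_submodule (fst x) (snd x)" by (simp add: ok_def)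
    from minimal_cover [OF this] obtain t \<delta>
      where lin: "linear_map mpoly_ring (graded_free t) (graded_free (fst x)) \<delta>"
        and gr: "\<forall>j. \<forall>v\<in>component (graded_free t) j. \<delta> v \<in> component (graded_free (fst x)) j"
        and im: "\<delta> ` carrier (graded_free t) = snd x"
        and cc: "\<forall>v\<in>carrier (graded_free t). \<delta> v = (\<lambda>_. 0) \<longrightarrow> (\<forall>k. const_coeff (v k) = 0)"
      by (elim exE conjE) (rule that)
    let ?y = "(t, {v \<in> carrier (graded_free t). \<delta> v = (\<lambda>_. 0)})"
    have "ok (Suc n) ?y"
      using graded_submodule_kernel [OF lin gr [rule_format]] cc
      by (simp add: ok_def del: graded_free_simps)
    moreover have "next_syz x ?y \<delta>"
      using lin gr im by (simp add: next_syz_def del: graded_free_simps)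
    ultimately show "\<exists>y. ok (Suc n) y \<and> (\<exists>\<delta>. next_syz x y \<delta>)" by blast
  qed
  then obtain f where "\<forall>n. ok n (f n) \<and> (\<exists>\<delta>. next_syz (f n) (f (Suc n)) \<delta>)"
    by (elim exE) (rule that)
  then have ok: "ok n (f n)" and ex: "\<exists>\<delta>. next_syz (f n) (f (Suc n)) \<delta>" for n by simp_all
  define \<sigma> where "\<sigma> n = fst (f n)" for n
  define \<delta> where "\<delta> n = (SOME \<delta>. next_syz (f n) (f (Suc n)) \<delta>)" for n
  have syz: "next_syz (f n) (f (Suc n)) (\<delta> n)" for n
    unfolding \<delta>_def by (rule someI_ex [OF ex])
  have f0: "f 0 = (s, ?K0)" using ok [of 0] by (simp add: ok_def)
  then have \<sigma>0: "\<sigma> 0 = s" by (simp add: \<sigma>_def)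
  have lin: "linear_map mpoly_ring (graded_free (\<sigma> (Suc n))) (graded_free (\<sigma> n)) (\<delta> n)"
    and gr: "\<forall>j. \<forall>v\<in>component (graded_free (\<sigma> (Suc n))) j. \<delta> n v \<in> component (graded_free (\<sigma> n)) j"
    and im: "\<delta> n ` carrier (graded_free (\<sigma> (Suc n))) = snd (f n)"
    and kern: "snd (f (Suc n)) = {v \<in> carrier (graded_free (\<sigma> (Suc n))). \<delta> n v = (\<lambda>_. 0)}" for n
    using syz [of n] unfolding next_syz_def \<sigma>_def by (auto simp del: graded_free_simps)
  have "resolution mpoly_ring M (\<lambda>i. graded_free (\<sigma> i)) \<delta> \<epsilon>"
    unfolding resolution_def
  proof (intro conjI allI)
    show "\<delta> 0 ` carrier (graded_free (\<sigma> 1)) = {x \<in> carrier (graded_free (\<sigma> 0)). \<epsilon> x = \<zero>\<^bsub>M\<^esub>}"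
      using im [of 0] by (simp add: f0 \<sigma>0)
    show "\<delta> (Suc i) ` carrier (graded_free (\<sigma> (Suc (Suc i)))) =
        {x \<in> carrier (graded_free (\<sigma> (Suc i))). \<delta> i x = \<zero>\<^bsub>graded_free (\<sigma> i)\<^esub>}" for i
      using im [of "Suc i"] kern [of i] by simp
    show "Module.module mpoly_ring (graded_free (\<sigma> i))" for i by (rule module_graded_free)
  qed (use lin aug surj in \<open>simp_all only: \<sigma>0\<close>)
  moreover have "\<delta> i v k \<in> irrelevant_ideal" if "v \<in> carrier (graded_free (\<sigma> (Suc i)))" for i v k
  proof -
    have "\<delta> i v \<in> snd (f i)" using im [of i] that by blast
    then show ?thesis using ok [of i] by (simp add: ok_def irrelevant_ideal_iff)
  qed
  ultimately have "minimal_graded_free_resolution M \<sigma> \<delta> \<epsilon>"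
    unfolding minimal_graded_free_resolution_def using gr graded \<sigma>0 by blast
  then show ?thesis by blast
qed

lemma ex_minimal_resolution_quot_module:
  fixes I :: "('n::finite, 'k::field) mpoly set"
  assumes I: "homogeneous_ideal I"
  shows "\<exists>\<sigma> \<delta> \<epsilon>. minimal_graded_free_resolution (quot_module I) \<sigma> \<delta> \<epsilon>"
proof -
  note ideal = homogeneous_ideal_imp_ideal [OF I]
  note [simp] = quot_module_simps [OF ideal]
  \<comment> \<open>For \<open>I = R\<close> the quotient is zero and the free module must be zero
    too: a generator would lie in the kernel with constant coefficient 1.\<close>
  define s :: "int list" where "s = (if 1 \<in> I then [] else [0])"
  define \<epsilon> where "\<epsilon> = (\<lambda>v :: nat \<Rightarrow> ('n, 'k) mpoly. I +>\<^bsub>mpoly_ring\<^esub> v 0)"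
  have top: "p \<in> I" if "1 \<in> I" for p
    using ideal_mult [OF ideal that, of p] by simp
  have zero_iff: "\<epsilon> v = \<zero>\<^bsub>quot_module I\<^esub> \<longleftrightarrow> v 0 \<in> I" for v
    by (simp add: \<epsilon>_def coset_eq_iff [OF ideal])
  \<comment> \<open>If an element of \<open>I\<close> had a nonzero constant term, rescaling its
    component of degree 0 would put 1 into \<open>I\<close>.\<close>
  have proper: "const_coeff p = 0" if "1 \<notin> I" "p \<in> I" for p
  proof (rule ccontr)
    assume c: "const_coeff p \<noteq> 0"
    have "Poly_Mapping.single 0 (inverse (const_coeff p)) * hcomp 0 p \<in> I"
      by (intro ideal_mult [OF ideal] homogeneous_ideal_hcomp [OF I] that)
    then show False using c that(1) by (simp add: hcomp_0_eq mult_single)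
  qed
  have "\<exists>\<sigma> \<delta>. minimal_graded_free_resolution (quot_module I) \<sigma> \<delta> \<epsilon>"
  proof (rule ex_minimal_resolution [where s = s])
    show "linear_map mpoly_ring (graded_free s) (quot_module I) \<epsilon>"
      by (simp add: linear_map_def \<epsilon>_def)
    show "\<epsilon> ` carrier (graded_free s) = carrier (quot_module I)"
    proof (intro equalityI subsetI)
      fix y assume "y \<in> carrier (quot_module I)"
      then obtain p where p: "y = I +>\<^bsub>mpoly_ring\<^esub> p" by auto
      let ?v = "\<lambda>k. if k = 0 \<and> 1 \<notin> I then p else 0"
      have "?v \<in> carrier (graded_free s)" by (simp add: s_def)
      moreover have "y = \<epsilon> ?v"
        using top by (auto simp: p \<epsilon>_def coset_eq_iff [OF ideal] ideal_zero [OF ideal])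
      ultimately show "y \<in> \<epsilon> ` carrier (graded_free s)" by blast
    qed (auto simp: \<epsilon>_def)
    show "\<epsilon> v \<in> component (quot_module I) j" if "v \<in> component (graded_free s) j" for j v
      using that by (auto simp: \<epsilon>_def component_graded_free s_def split: if_splits)
    show "graded_submodule s {v \<in> carrier (graded_free s). \<epsilon> v = \<zero>\<^bsub>quot_module I\<^esub>}"
      unfolding zero_iff graded_submodule_def vsubmodule_def
      by (auto simp: vproj_def intro: ideal_zero [OF ideal] ideal_add [OF ideal] ideal_mult [OF ideal]
          homogeneous_ideal_hcomp [OF I])
    show "const_coeff (v k) = 0" if "v \<in> carrier (graded_free s)" "\<epsilon> v = \<zero>\<^bsub>quot_module I\<^esub>" for v k
    proof (cases "k < length s")
      case True
      then have "1 \<notin> I" "k = 0" by (auto simp: s_def split: if_splits)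
      then show ?thesis using proper that(2) zero_iff by blast
    next
      case False
      then have "v k = 0" using that(1) by simp
      then show ?thesis by simp
    qed
  qed
  then show ?thesis by blast
qed

section \<open>The mapping cone of multiplication by a form\<close>

text \<open>Splitting coordinates at the length of \<open>s\<close> presents
  \<open>graded_free (s @ t)\<close> as the direct sum of \<open>graded_free s\<close> and
  \<open>graded_free t\<close>: \<open>vfst\<close> and \<open>vsnd\<close> are the projections, and
  \<open>vjoin\<close> assembles a pair.\<close>

definition vfst :: "nat \<Rightarrow> (nat \<Rightarrow> 'a::zero) \<Rightarrow> nat \<Rightarrow> 'a" where
  "vfst r v k = (if k < r then v k else 0)"

definition vsnd :: "nat \<Rightarrow> (nat \<Rightarrow> 'a) \<Rightarrow> nat \<Rightarrow> 'a" where
  "vsnd r v k = v (k + r)"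

definition vjoin :: "nat \<Rightarrow> (nat \<Rightarrow> 'a) \<Rightarrow> (nat \<Rightarrow> 'a) \<Rightarrow> nat \<Rightarrow> 'a" where
  "vjoin r x y k = (if k < r then x k else y (k - r))"

lemma vfst_carrier: "vfst (length s) v \<in> carrier (graded_free s)"
  by (simp add: vfst_def)

lemma vsnd_carrier:
  "v \<in> carrier (graded_free (s @ t)) \<Longrightarrow> vsnd (length s) v \<in> carrier (graded_free t)"
  by (simp add: vsnd_def)

lemma vjoin_carrier:
  "y \<in> carrier (graded_free t) \<Longrightarrow> vjoin (length s) x y \<in> carrier (graded_free (s @ t))"
  by (simp add: vjoin_def)

lemma vfst_vjoin: "x \<in> carrier (graded_free s) \<Longrightarrow> vfst (length s) (vjoin (length s) x y) = x"
  by (auto simp: fun_eq_iff vfst_def vjoin_def)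

lemma vsnd_vjoin: "vsnd r (vjoin r x y) = y"
  by (simp add: fun_eq_iff vsnd_def vjoin_def)

lemma vjoin_vfst_vsnd: "vjoin r (vfst r v) (vsnd r v) = v"
  by (simp add: fun_eq_iff vfst_def vsnd_def vjoin_def)

lemma vjoin_eq_zero:
  assumes "x \<in> carrier (graded_free s)" "vjoin (length s) x y = (\<lambda>_. 0)"
  shows "x = (\<lambda>_. 0)" "y = (\<lambda>_. 0)"
  using vfst_vjoin [OF assms(1), of y] vsnd_vjoin [of "length s" x y]
  unfolding assms(2) by (auto simp: fun_eq_iff vfst_def vsnd_def)

lemma vfst_vsnd_linear:
  fixes v w :: "nat \<Rightarrow> 'a::comm_ring_1"
  shows "vfst r (\<lambda>k. v k + w k) = (\<lambda>k. vfst r v k + vfst r w k)"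
    and "vfst r (\<lambda>k. a * v k) = (\<lambda>k. a * vfst r v k)"
    and "vsnd r (\<lambda>k. v k + w k) = (\<lambda>k. vsnd r v k + vsnd r w k)"
    and "vsnd r (\<lambda>k. a * v k) = (\<lambda>k. a * vsnd r v k)"
  by (simp_all add: fun_eq_iff vfst_def vsnd_def)

lemma vfst_component:
  assumes "v \<in> component (graded_free (s @ t)) j"
  shows "vfst (length s) v \<in> component (graded_free s) j"
proof -
  have "homogeneous (j - (s @ t) ! k) (v k)" if "k < length s" for k
    using assms that by (simp add: component_graded_free)
  then show ?thesis by (simp add: component_graded_free vfst_def nth_append)
qed

lemma vsnd_component:
  assumes "v \<in> component (graded_free (s @ t)) j"
  shows "vsnd (length s) v \<in> component (graded_free t) j"
proof -
  have "homogeneous (j - (s @ t) ! (k + length s)) (v (k + length s))" if "k < length t" for k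
    using assms that by (simp add: component_graded_free)
  then show ?thesis using assms by (simp add: component_graded_free vsnd_def nth_append)
qed

lemma vjoin_component:
  assumes "x \<in> component (graded_free s) j" "y \<in> component (graded_free t) j"
  shows "vjoin (length s) x y \<in> component (graded_free (s @ t)) j"
  using assms by (auto simp: component_graded_free vjoin_def nth_append)

lemma component_shift:
  "component (graded_free (map (\<lambda>j. j + c) t)) j = component (graded_free t) (j - c)"
  by (auto simp: component_graded_free algebra_simps)

lemma carrier_shift: "carrier (graded_free (map (\<lambda>j. j + c) t)) = carrier (graded_free t)"
  by simp

lemma component_add:
  "x \<in> component (graded_free s) j \<Longrightarrow> y \<in> component (graded_free s) j \<Longrightarrow>
    (\<lambda>k. x k + y k) \<in> component (graded_free s) j"
  by (simp add: component_graded_free homogeneous_add)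

lemma component_uminus:
  "x \<in> component (graded_free s) j \<Longrightarrow> (\<lambda>k. - x k) \<in> component (graded_free s) j"
  by (simp add: component_graded_free homogeneous_uminus)

lemma component_smult:
  assumes "homogeneous c f" "x \<in> component (graded_free s) (j - c)"
  shows "(\<lambda>k. f * x k) \<in> component (graded_free s) j"
proof -
  have "homogeneous (j - s ! k) (f * x k)" if "k < length s" for k
    using homogeneous_mult [OF assms(1), of "j - c - s ! k" "x k"] assms(2) that
    by (simp add: component_graded_free)
  then show ?thesis using assms(2) by (simp add: component_graded_free)
qed

text \<open>The cone in degree \<open>i\<close> is the sum of the \<open>i\<close>-th free module
  and of the one before it, twisted by \<open>-c\<close>. Adding \<open>c\<close> to the shifts
  makes multiplication by a form of degree \<open>c\<close> preserve degrees.\<close>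

definition cone_shifts :: "int \<Rightarrow> (nat \<Rightarrow> int list) \<Rightarrow> nat \<Rightarrow> int list" where
  "cone_shifts c \<sigma> i = \<sigma> i @ (case i of 0 \<Rightarrow> [] | Suc l \<Rightarrow> map (\<lambda>j. j + c) (\<sigma> l))"

lemma cone_shifts_simps [simp]:
  "cone_shifts c \<sigma> 0 = \<sigma> 0"
  "cone_shifts c \<sigma> (Suc i) = \<sigma> (Suc i) @ map (\<lambda>j. j + c) (\<sigma> i)"
  by (simp_all add: cone_shifts_def)

text \<open>The differential sends \<open>(x, y)\<close> to
  \<open>(\<delta> x + f y, - \<delta> y)\<close>; the sign makes consecutive maps compose to zero.
  For \<open>i = 0\<close> the target has no second summand, hence the case distinction.\<close>

definition cone_map ::
  "('n::finite, 'k::field) mpoly \<Rightarrow> (nat \<Rightarrow> int list) \<Rightarrow>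
   (nat \<Rightarrow> (nat \<Rightarrow> ('n, 'k) mpoly) \<Rightarrow> nat \<Rightarrow> ('n, 'k) mpoly) \<Rightarrow>
   nat \<Rightarrow> (nat \<Rightarrow> ('n, 'k) mpoly) \<Rightarrow> nat \<Rightarrow> ('n, 'k) mpoly" where
  "cone_map f \<sigma> \<delta> i v =
     (let r = length (\<sigma> (Suc i)); x = (\<lambda>k. \<delta> i (vfst r v) k + f * vsnd r v k)
      in case i of 0 \<Rightarrow> x | Suc l \<Rightarrow> vjoin (length (\<sigma> i)) x (\<lambda>k. - \<delta> l (vsnd r v) k))"

lemma cone_map_simps:
  "cone_map f \<sigma> \<delta> 0 v =
    (\<lambda>k. \<delta> 0 (vfst (length (\<sigma> (Suc 0))) v) k + f * vsnd (length (\<sigma> (Suc 0))) v k)"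
  "cone_map f \<sigma> \<delta> (Suc i) v = vjoin (length (\<sigma> (Suc i)))
    (\<lambda>k. \<delta> (Suc i) (vfst (length (\<sigma> (Suc (Suc i)))) v) k + f * vsnd (length (\<sigma> (Suc (Suc i)))) v k)
    (\<lambda>k. - \<delta> i (vsnd (length (\<sigma> (Suc (Suc i)))) v) k)"
  by (simp_all add: cone_map_def Let_def)

lemma homogeneous_ideal_Idl_insert:
  fixes I :: "('n::finite, 'k::field) mpoly set"
  assumes "homogeneous_ideal I" "homogeneous c f"
  shows "homogeneous_ideal (Idl\<^bsub>mpoly_ring\<^esub> (insert f I))"
proof -
  from assms(1) obtain S where S: "\<forall>p\<in>S. \<exists>j. homogeneous j p" and I: "I = Idl\<^bsub>mpoly_ring\<^esub> S"
    by (auto simp: homogeneous_ideal_def)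
  have ideal: "ideal (Idl\<^bsub>mpoly_ring\<^esub> T) mpoly_ring" and self: "T \<subseteq> Idl\<^bsub>mpoly_ring\<^esub> T"
    for T :: "('n, 'k) mpoly set"
    by (auto intro: mpoly_ring.genideal_ideal mpoly_ring.genideal_self [THEN subsetD])
  have "I \<subseteq> Idl\<^bsub>mpoly_ring\<^esub> (insert f S)"
    unfolding I by (rule mpoly_ring.genideal_minimal [OF ideal]) (use self [of "insert f S"] in blast)
  then have "Idl\<^bsub>mpoly_ring\<^esub> (insert f I) \<subseteq> Idl\<^bsub>mpoly_ring\<^esub> (insert f S)"
    by (intro mpoly_ring.genideal_minimal [OF ideal]) (use self [of "insert f S"] in blast)
  moreover have "S \<subseteq> I" unfolding I by (rule self)
  then have "Idl\<^bsub>mpoly_ring\<^esub> (insert f S) \<subseteq> Idl\<^bsub>mpoly_ring\<^esub> (insert f I)"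
    by (intro mpoly_ring.genideal_minimal [OF ideal]) (use self [of "insert f I"] in blast)
  ultimately have "Idl\<^bsub>mpoly_ring\<^esub> (insert f I) = Idl\<^bsub>mpoly_ring\<^esub> (insert f S)" by blast
  then show ?thesis
    unfolding homogeneous_ideal_def using S assms(2) by (intro exI [of _ "insert f S"]) auto
qed

text \<open>Exactness is checked on elements. The nonzerodivisor property enters for cycles of the
  first differential; in higher degrees acyclicity of the resolution of \<open>R/I\<close> yields
  the boundary. The hypothesis \<open>c \<noteq> 0\<close> makes \<open>f\<close> vanish modulo the
  irrelevant ideal, which gives minimality.\<close>

lemma mapping_cone:
  fixes I :: "('n::finite, 'k::field) mpoly set"
  assumes I: "ideal I mpoly_ring" and f: "homogeneous c f" and c: "c \<noteq> 0"
    and nzd: "\<And>g. g * f \<in> I \<Longrightarrow> g \<in> I"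
    and min: "minimal_graded_free_resolution (quot_module I) \<sigma> \<delta> \<epsilon>"
  shows "\<exists>\<delta>' \<epsilon>'. minimal_graded_free_resolution
    (quot_module (Idl\<^bsub>mpoly_ring\<^esub> (insert f I))) (cone_shifts c \<sigma>) \<delta>' \<epsilon>'"
proof -
  define J where "J = Idl\<^bsub>mpoly_ring\<^esub> (insert f I)"
  have J: "ideal J mpoly_ring" unfolding J_def by (rule mpoly_ring.genideal_ideal) simp
  have J_eq: "J = {i + a * f | i a. i \<in> I}" unfolding J_def by (rule Idl_insert [OF I])
  have IJ: "i \<in> J" if "i \<in> I" for i
  proof -
    have "i = i + 0 * f" by simp
    then show ?thesis using that unfolding J_eq by blast
  qed
  have fJ: "f \<in> J" unfolding J_def by (rule subsetD [OF mpoly_ring.genideal_self]) auto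
  note [simp] = quot_module_simps [OF J] quot_module_simps [OF I]
  let ?F = "\<lambda>i. graded_free (\<sigma> i) :: (('n, 'k) mpoly, nat \<Rightarrow> ('n, 'k) mpoly) graded_module"
  let ?C = "\<lambda>i. graded_free (cone_shifts c \<sigma> i) :: (('n, 'k) mpoly, nat \<Rightarrow> ('n, 'k) mpoly) graded_module"
  let ?r = "\<lambda>i. length (\<sigma> i)"
  let ?D = "cone_map f \<sigma> \<delta>"
  note res = minimal_resolution [OF min]
  note d_lin = resolution_linear [OF res] and aug = resolution_aug_linear [OF res]
  note MI = module_quot_module [OF I]
  have d_add: "\<delta> i (\<lambda>k. x k + y k) = (\<lambda>k. \<delta> i x k + \<delta> i y k)"
    if "x \<in> carrier (?F (Suc i))" "y \<in> carrier (?F (Suc i))" for i x y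
    using linear_map_add [OF d_lin that] by simp
  have d_smult: "\<delta> i (\<lambda>k. a * x k) = (\<lambda>k. a * \<delta> i x k)" if "x \<in> carrier (?F (Suc i))" for i a x
    using linear_map_smult [OF d_lin _ that, of a] by simp
  have d_uminus: "\<delta> i (\<lambda>k. - x k) = (\<lambda>k. - \<delta> i x k)" if "x \<in> carrier (?F (Suc i))" for i x
    using d_smult [OF that, of "-1"] by simp
  have d_zero: "\<delta> i (\<lambda>_. 0) = (\<lambda>_. 0)" for i
    using linear_map_zero [OF d_lin module_graded_free module_graded_free] by simp
  have dd: "\<delta> i (\<delta> (Suc i) x) = (\<lambda>_. 0)" if "x \<in> carrier (?F (Suc (Suc i)))" for i x
    using resolution_diff_diff [OF res that] by simp
  have exact: "\<exists>z\<in>carrier (?F (Suc (Suc i))). x = \<delta> (Suc i) z"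
    if "x \<in> carrier (?F (Suc i))" "\<delta> i x = (\<lambda>_. 0)" for i x
  proof -
    have "x \<in> \<delta> (Suc i) ` carrier (?F (Suc (Suc i)))"
      unfolding resolution_exact [OF res] using that by simp
    then show ?thesis by blast
  qed
  have exact0: "\<exists>z\<in>carrier (?F (Suc 0)). x = \<delta> 0 z"
    if "x \<in> carrier (?F 0)" "\<epsilon> x = \<zero>\<^bsub>quot_module I\<^esub>" for x
  proof -
    have "x \<in> \<delta> 0 ` carrier (?F (Suc 0))"
      unfolding resolution_exact_0 [OF res] using that by simp
    then show ?thesis by blast
  qed
  have d_car: "\<delta> i x \<in> carrier (?F i)" if "x \<in> carrier (?F (Suc i))" for i x
    by (rule linear_map_closed [OF d_lin that])
  have fst_car: "vfst (?r i) v \<in> carrier (?F i)" for i v by (rule vfst_carrier)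
  have snd_car: "vsnd (?r (Suc i)) v \<in> carrier (?F i)" if "v \<in> carrier (?C (Suc i))" for i v
    using vsnd_carrier [OF that [unfolded cone_shifts_simps(2)]] unfolding carrier_shift .
  have join_car: "vjoin (?r (Suc i)) x y \<in> carrier (?C (Suc i))" if "y \<in> carrier (?F i)" for i x y
    unfolding cone_shifts_simps(2) by (rule vjoin_carrier) (simp only: carrier_shift that)

  \<comment> \<open>The augmentation of the cone is \<open>\<epsilon>\<close> followed by the
    projection from \<open>R/I\<close> to \<open>R/J\<close>, expressed through a chosen
    representative. \<open>rep\<close> is linear only modulo \<open>I\<close>, and
    \<open>rep_cong\<close> controls the difference.\<close>
  define rep where "rep v = (SOME p. \<epsilon> v = I +>\<^bsub>mpoly_ring\<^esub> p)" for v
  have rep: "\<epsilon> v = I +>\<^bsub>mpoly_ring\<^esub> rep v" if "v \<in> carrier (?F 0)" for v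
  proof -
    have "\<exists>p. \<epsilon> v = I +>\<^bsub>mpoly_ring\<^esub> p" using linear_map_closed [OF aug that] by auto
    then show ?thesis unfolding rep_def by (rule someI_ex)
  qed
  have rep_cong: "p - rep v \<in> I" if "v \<in> carrier (?F 0)" "\<epsilon> v = I +>\<^bsub>mpoly_ring\<^esub> p" for v p
    using rep [OF that(1)] that(2) coset_eq_iff [OF I, of p "rep v"] by simp
  define \<epsilon>' where "\<epsilon>' v = J +>\<^bsub>mpoly_ring\<^esub> rep v" for v
  have \<epsilon>'_eq: "\<epsilon>' v = J +>\<^bsub>mpoly_ring\<^esub> p" if "v \<in> carrier (?F 0)" "\<epsilon> v = I +>\<^bsub>mpoly_ring\<^esub> p" for v p
    unfolding \<epsilon>'_def using IJ [OF rep_cong [OF that]] coset_eq_iff [OF J, of p "rep v"] by simp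
  have eps_add: "\<epsilon> (\<lambda>k. x k + y k) = I +>\<^bsub>mpoly_ring\<^esub> (rep x + rep y)"
    if "x \<in> carrier (?F 0)" "y \<in> carrier (?F 0)" for x y
    using linear_map_add [OF aug that] rep [OF that(1)] rep [OF that(2)] by simp
  have eps_smult: "\<epsilon> (\<lambda>k. a * x k) = I +>\<^bsub>mpoly_ring\<^esub> (a * rep x)" if "x \<in> carrier (?F 0)" for a x
    using linear_map_smult [OF aug _ that, of a] rep [OF that] by simp
  have eps_zero_iff: "\<epsilon> x = \<zero>\<^bsub>quot_module I\<^esub> \<longleftrightarrow> rep x \<in> I" if "x \<in> carrier (?F 0)" for x
    using rep [OF that] by (simp add: coset_eq_iff [OF I])
  have eps'_zero_iff: "\<epsilon>' x = \<zero>\<^bsub>quot_module J\<^esub> \<longleftrightarrow> rep x \<in> J" for x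
    by (simp add: \<epsilon>'_def coset_eq_iff [OF J])
  have aug': "linear_map mpoly_ring (?C 0) (quot_module J) \<epsilon>'"
    unfolding linear_map_def cone_shifts_simps(1)
  proof (intro conjI ballI)
    show "\<epsilon>' \<in> carrier (?F 0) \<rightarrow> carrier (quot_module J)" by (auto simp: \<epsilon>'_def)
    fix x assume x: "x \<in> carrier (?F 0)"
    show "\<epsilon>' (x \<oplus>\<^bsub>?F 0\<^esub> y) = \<epsilon>' x \<oplus>\<^bsub>quot_module J\<^esub> \<epsilon>' y" if y: "y \<in> carrier (?F 0)" for y
    proof -
      have "(\<lambda>k. x k + y k) \<in> carrier (?F 0)" using x y by simp
      from \<epsilon>'_eq [OF this eps_add [OF x y]] show ?thesis by (simp add: \<epsilon>'_def)
    qed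
    show "\<epsilon>' (a \<odot>\<^bsub>?F 0\<^esub> x) = a \<odot>\<^bsub>quot_module J\<^esub> \<epsilon>' x" for a
    proof -
      have "(\<lambda>k. a * x k) \<in> carrier (?F 0)" using x by simp
      from \<epsilon>'_eq [OF this eps_smult [OF x]] show ?thesis by (simp add: \<epsilon>'_def)
    qed
  qed

  have lin: "linear_map mpoly_ring (?C (Suc i)) (?C i) (?D i)" for i
    unfolding linear_map_def
  proof (intro conjI ballI)
    have closed: "?D i v \<in> carrier (?C i)" if v: "v \<in> carrier (?C (Suc i))" for v
    proof (cases i)
      case 0
      then show ?thesis
        using d_car [OF fst_car, of 0 v] snd_car [of v 0] v by (simp add: cone_map_simps)
    next
      case (Suc l)
      have "(\<lambda>k. - \<delta> l (vsnd (?r (Suc (Suc l))) v) k) \<in> carrier (?F l)"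
        using d_car [OF snd_car, of v l] v Suc by simp
      then show ?thesis unfolding Suc cone_map_simps by (rule join_car)
    qed
    then show "?D i \<in> carrier (?C (Suc i)) \<rightarrow> carrier (?C i)" by blast
    fix v assume v: "v \<in> carrier (?C (Suc i))"
    show "?D i (v \<oplus>\<^bsub>?C (Suc i)\<^esub> w) = ?D i v \<oplus>\<^bsub>?C i\<^esub> ?D i w" if w: "w \<in> carrier (?C (Suc i))" for w
    proof (cases i)
      case 0
      then show ?thesis
        by (simp add: cone_map_simps vfst_vsnd_linear d_add [OF fst_car fst_car] fun_eq_iff algebra_simps)
    next
      case (Suc l)
      then show ?thesis
        using d_add [OF snd_car snd_car, of v l w] v w
        by (simp add: cone_map_simps vfst_vsnd_linear d_add [OF fst_car fst_car] fun_eq_iff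
            algebra_simps vjoin_def)
    qed
    show "?D i (a \<odot>\<^bsub>?C (Suc i)\<^esub> v) = a \<odot>\<^bsub>?C i\<^esub> ?D i v" for a
    proof (cases i)
      case 0
      then show ?thesis
        by (simp add: cone_map_simps vfst_vsnd_linear d_smult [OF fst_car] fun_eq_iff algebra_simps)
    next
      case (Suc l)
      then show ?thesis
        using d_smult [OF snd_car, of v l a] v
        by (simp add: cone_map_simps vfst_vsnd_linear d_smult [OF fst_car] fun_eq_iff
            algebra_simps vjoin_def)
    qed
  qed

  \<comment> \<open>Write \<open>v\<close> as \<open>(x, y)\<close> with
    \<open>y = \<delta> z\<close>. Then \<open>x + f z\<close> is a cycle of the original
    resolution, hence \<open>\<delta> u\<close> for some \<open>u\<close>, and
    \<open>(u, - z)\<close> is the required preimage.\<close>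
  have kernel_imp: "\<exists>w\<in>carrier (?C (Suc (Suc i))). v = ?D (Suc i) w"
    if v: "v \<in> carrier (?C (Suc i))"
      and x0: "\<And>k. \<delta> i (vfst (?r (Suc i)) v) k + f * vsnd (?r (Suc i)) v k = 0"
      and y: "\<exists>z\<in>carrier (?F (Suc i)). vsnd (?r (Suc i)) v = \<delta> i z" for v i
  proof -
    let ?x = "vfst (?r (Suc i)) v" and ?y = "vsnd (?r (Suc i)) v"
    obtain z where z: "z \<in> carrier (?F (Suc i))" "?y = \<delta> i z" using y by blast
    have fz: "(\<lambda>k. f * z k) \<in> carrier (?F (Suc i))" using z(1) by simp
    have xfz: "(\<lambda>k. ?x k + f * z k) \<in> carrier (?F (Suc i))"
      using fz fst_car [of "Suc i" v] by simp
    have "\<delta> i (\<lambda>k. ?x k + f * z k) = (\<lambda>_. 0)"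
      using x0 by (simp add: d_add [OF fst_car fz] d_smult [OF z(1)] z(2) [symmetric])
    from exact [OF xfz this] obtain u where u: "u \<in> carrier (?F (Suc (Suc i)))"
      "(\<lambda>k. ?x k + f * z k) = \<delta> (Suc i) u"
      by blast
    let ?w = "vjoin (?r (Suc (Suc i))) u (\<lambda>k. - z k)"
    have "?w \<in> carrier (?C (Suc (Suc i)))" by (rule join_car) (use z(1) in simp)
    moreover have "?D (Suc i) ?w = v"
    proof -
      have "?D (Suc i) ?w = vjoin (?r (Suc i)) ?x ?y"
        unfolding cone_map_simps vfst_vjoin [OF u(1)] vsnd_vjoin d_uminus [OF z(1)] u(2) [symmetric] z(2)
        by simp
      then show ?thesis by (simp add: vjoin_vfst_vsnd)
    qed
    ultimately show ?thesis by blast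
  qed

  have "resolution mpoly_ring (quot_module J) ?C ?D \<epsilon>'"
    unfolding resolution_def
  proof (intro conjI allI)
    show "Module.module mpoly_ring (?C i)" for i by (rule module_graded_free)
    show "linear_map mpoly_ring (?C (Suc i)) (?C i) (?D i)" for i by (rule lin)
    show "linear_map mpoly_ring (?C 0) (quot_module J) \<epsilon>'" by (rule aug')
    show "\<epsilon>' ` carrier (?C 0) = carrier (quot_module J)"
    proof (intro equalityI subsetI)
      fix y assume "y \<in> carrier (quot_module J)"
      then obtain p where p: "y = J +>\<^bsub>mpoly_ring\<^esub> p" by auto
      have "I +>\<^bsub>mpoly_ring\<^esub> p \<in> \<epsilon> ` carrier (?F 0)"
        unfolding resolution_aug_surj [OF res] by simp
      then obtain v where "v \<in> carrier (?F 0)" "\<epsilon> v = I +>\<^bsub>mpoly_ring\<^esub> p" by force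
      then show "y \<in> \<epsilon>' ` carrier (?C 0)" using \<epsilon>'_eq [of v p] p by auto
    qed (auto simp: \<epsilon>'_def)
    show "?D 0 ` carrier (?C 1) = {x \<in> carrier (?C 0). \<epsilon>' x = \<zero>\<^bsub>quot_module J\<^esub>}"
    proof (intro equalityI subsetI)
      fix x assume "x \<in> ?D 0 ` carrier (?C 1)"
      then obtain v where v: "v \<in> carrier (?C (Suc 0))" "x = ?D 0 v" by auto
      have x: "x \<in> carrier (?C 0)" using linear_map_closed [OF lin v(1)] v(2) by simp
      let ?a = "\<delta> 0 (vfst (?r (Suc 0)) v)" and ?y = "vsnd (?r (Suc 0)) v"
      have a: "?a \<in> carrier (?F 0)" by (rule d_car [OF fst_car])
      have y: "?y \<in> carrier (?F 0)" by (rule snd_car [OF v(1)])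
      have fy: "(\<lambda>k. f * ?y k) \<in> carrier (?F 0)" using y by simp
      have "rep ?a \<in> I"
        using resolution_aug_diff [OF res fst_car, of v] eps_zero_iff [OF a] by simp
      moreover have "f * rep ?y - rep (\<lambda>k. f * ?y k) \<in> I"
        by (rule rep_cong [OF fy eps_smult [OF y]])
      moreover have "\<epsilon> x = I +>\<^bsub>mpoly_ring\<^esub> (rep ?a + rep (\<lambda>k. f * ?y k))"
        using eps_add [OF a fy] v(2) by (simp add: cone_map_simps)
      then have "(rep ?a + rep (\<lambda>k. f * ?y k)) - rep x \<in> I"
        by (rule rep_cong [rotated]) (use x in simp)
      ultimately have h: "rep ?a \<in> J" "f * rep ?y - rep (\<lambda>k. f * ?y k) \<in> J"
        "(rep ?a + rep (\<lambda>k. f * ?y k)) - rep x \<in> J"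
        using IJ by blast+
      have "f * rep ?y \<in> J" using ideal_mult [OF J fJ, of "rep ?y"] by (simp add: mult.commute)
      from ideal_diff [OF J ideal_add [OF J h(1) ideal_diff [OF J this h(2)]] h(3)]
      have "rep x \<in> J" by simp
      then show "x \<in> {x \<in> carrier (?C 0). \<epsilon>' x = \<zero>\<^bsub>quot_module J\<^esub>}"
        using x eps'_zero_iff by blast
    next
      fix x assume "x \<in> {x \<in> carrier (?C 0). \<epsilon>' x = \<zero>\<^bsub>quot_module J\<^esub>}"
      then have x: "x \<in> carrier (?F 0)" and "rep x \<in> J" using eps'_zero_iff by auto
      \<comment> \<open>Lift the class of \<open>a\<close> to \<open>y\<close>. Then
        \<open>?z\<close>, that is \<open>x - f y\<close>, is sent to zero by
        \<open>\<epsilon>\<close>, so it equals \<open>\<delta> 0 u\<close> for some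
        \<open>u\<close>, and \<open>(u, y)\<close> is a preimage of \<open>x\<close>.\<close>
      then obtain i a where ia: "rep x = i + a * f" "i \<in> I" unfolding J_eq by blast
      have "I +>\<^bsub>mpoly_ring\<^esub> a \<in> \<epsilon> ` carrier (?F 0)"
        unfolding resolution_aug_surj [OF res] by simp
      then obtain y where y: "y \<in> carrier (?F 0)" "\<epsilon> y = I +>\<^bsub>mpoly_ring\<^esub> a" by force
      let ?z = "\<lambda>k. x k + (- f) * y k"
      have fy: "(\<lambda>k. (- f) * y k) \<in> carrier (?F 0)" using y(1) by simp
      have z: "?z \<in> carrier (?F 0)" using x fy by simp
      have "rep x + rep (\<lambda>k. (- f) * y k) - rep ?z \<in> I"
        by (rule rep_cong [OF z eps_add [OF x fy]])
      moreover have "(- f) * rep y - rep (\<lambda>k. (- f) * y k) \<in> I"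
        by (rule rep_cong [OF fy eps_smult [OF y(1)]])
      moreover have "f * (a - rep y) \<in> I" by (rule ideal_mult [OF I rep_cong [OF y]])
      \<comment> \<open>Since \<open>rep\<close> respects sums and multiples only modulo
        \<open>I\<close>, this combination of elements of \<open>I\<close> is arranged so that all
        error terms cancel and \<open>rep ?z\<close> remains.\<close>
      ultimately have "i + f * (a - rep y) - ((- f) * rep y - rep (\<lambda>k. (- f) * y k)) -
          (rep x + rep (\<lambda>k. (- f) * y k) - rep ?z) \<in> I"
        using ia(2) by (meson I ideal_diff ideal_add)
      moreover have "i + f * (a - rep y) - ((- f) * rep y - rep (\<lambda>k. (- f) * y k)) -
          (rep x + rep (\<lambda>k. (- f) * y k) - rep ?z) = rep ?z"
        by (simp only: ia(1)) (simp add: algebra_simps)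
      ultimately have "rep ?z \<in> I" by (simp only:)
      then obtain u where u: "u \<in> carrier (?F (Suc 0))" "?z = \<delta> 0 u"
        using exact0 [OF z] eps_zero_iff [OF z] by blast
      let ?w = "vjoin (?r (Suc 0)) u y"
      have "?w \<in> carrier (?C 1)" using join_car [OF y(1), of u] by simp
      moreover have "x = ?D 0 ?w"
        unfolding cone_map_simps vfst_vjoin [OF u(1)] vsnd_vjoin u(2) [symmetric] by simp
      ultimately show "x \<in> ?D 0 ` carrier (?C 1)" by blast
    qed
    show "?D (Suc i) ` carrier (?C (Suc (Suc i))) =
        {x \<in> carrier (?C (Suc i)). ?D i x = \<zero>\<^bsub>?C i\<^esub>}" for i
    proof (intro equalityI subsetI)
      fix v assume "v \<in> ?D (Suc i) ` carrier (?C (Suc (Suc i)))"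
      then obtain w where w: "w \<in> carrier (?C (Suc (Suc i)))" "v = ?D (Suc i) w" by blast
      have v: "v \<in> carrier (?C (Suc i))" using linear_map_closed [OF lin w(1)] w(2) by simp
      let ?x = "vfst (?r (Suc (Suc i))) w" and ?y = "vsnd (?r (Suc (Suc i))) w"
      have y: "?y \<in> carrier (?F (Suc i))" by (rule snd_car [OF w(1)])
      have fy: "(\<lambda>k. f * ?y k) \<in> carrier (?F (Suc i))" using y by simp
      have dx: "\<delta> (Suc i) ?x \<in> carrier (?F (Suc i))" by (rule d_car [OF fst_car])
      have a: "(\<lambda>k. \<delta> (Suc i) ?x k + f * ?y k) \<in> carrier (?F (Suc i))" using dx fy by simp
      have fst: "vfst (?r (Suc i)) v = (\<lambda>k. \<delta> (Suc i) ?x k + f * ?y k)"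
        unfolding w(2) cone_map_simps by (rule vfst_vjoin [OF a])
      have snd: "vsnd (?r (Suc i)) v = (\<lambda>k. - \<delta> i ?y k)"
        unfolding w(2) cone_map_simps by (rule vsnd_vjoin)
      have top: "\<delta> i (vfst (?r (Suc i)) v) k + f * vsnd (?r (Suc i)) v k = 0" for k
        unfolding fst snd d_add [OF dx fy] dd [OF fst_car] d_smult [OF y] by simp
      have "?D i v = (\<lambda>_. 0)"
      proof (cases i)
        case 0
        then show ?thesis using top by (simp add: cone_map_simps)
      next
        case (Suc l)
        have "\<delta> l (\<lambda>k. - \<delta> i ?y k) = (\<lambda>_. 0)"
          using d_uminus [of "\<delta> i ?y" l] d_car [OF y] dd [of ?y l] y Suc by simp
        then have "\<delta> l (vsnd (?r (Suc i)) v) = (\<lambda>_. 0)" unfolding snd .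
        then show ?thesis
          using top unfolding Suc cone_map_simps by (simp add: vjoin_def fun_eq_iff)
      qed
      then show "v \<in> {x \<in> carrier (?C (Suc i)). ?D i x = \<zero>\<^bsub>?C i\<^esub>}" using v by simp
    next
      fix v assume "v \<in> {x \<in> carrier (?C (Suc i)). ?D i x = \<zero>\<^bsub>?C i\<^esub>}"
      then have v: "v \<in> carrier (?C (Suc i))" and Dv: "?D i v = (\<lambda>_. 0)"
        by (simp_all del: cone_shifts_simps)
      let ?x = "vfst (?r (Suc i)) v" and ?y = "vsnd (?r (Suc i)) v"
      have y: "?y \<in> carrier (?F i)" by (rule snd_car [OF v])
      have dx: "\<delta> i ?x \<in> carrier (?F i)" by (rule d_car [OF fst_car])
      have fy: "(\<lambda>k. f * ?y k) \<in> carrier (?F i)" using y by simp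
      have a: "(\<lambda>k. \<delta> i ?x k + f * ?y k) \<in> carrier (?F i)" using dx fy by simp
      have top: "(\<lambda>k. \<delta> i ?x k + f * ?y k) = (\<lambda>_. 0)"
      proof (cases i)
        case 0
        then show ?thesis using Dv by (simp add: cone_map_simps)
      next
        case (Suc l)
        show ?thesis
          using vjoin_eq_zero(1) [OF a [unfolded Suc], of "\<lambda>k. - \<delta> l (vsnd (?r (Suc i)) v) k"] Dv
          unfolding Suc cone_map_simps by blast
      qed
      \<comment> \<open>For \<open>i = 0\<close> the relation \<open>\<delta> x + f y = 0\<close>
        gives \<open>f * rep y \<in> I\<close>, and the nonzerodivisor property cancels
        \<open>f\<close>, so \<open>\<epsilon> y\<close> is zero. For larger \<open>i\<close> the
        second component of the differential shows that \<open>y\<close> is itself a cycle.\<close>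
      have "\<exists>z\<in>carrier (?F (Suc i)). ?y = \<delta> i z"
      proof (cases i)
        case 0
        have a0: "\<delta> 0 ?x \<in> carrier (?F 0)" and y0: "?y \<in> carrier (?F 0)"
          using dx y 0 by simp_all
        have "(\<lambda>k. f * ?y k) = (\<lambda>k. (- 1) * \<delta> 0 ?x k)"
        proof
          fix k
          have "\<delta> 0 ?x k + f * ?y k = 0" using fun_cong [OF top, of k] unfolding 0 .
          from minus_unique [OF this] show "f * ?y k = (- 1) * \<delta> 0 ?x k" by simp
        qed
        then have "\<epsilon> (\<lambda>k. f * ?y k) = I +>\<^bsub>mpoly_ring\<^esub> ((- 1) * rep (\<delta> 0 ?x))"
          using eps_smult [OF a0, of "- 1"] by simp
        moreover have "\<epsilon> (\<lambda>k. f * ?y k) = I +>\<^bsub>mpoly_ring\<^esub> (f * rep ?y)" by (rule eps_smult [OF y0])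
        ultimately have "f * rep ?y + rep (\<delta> 0 ?x) \<in> I"
          using coset_eq_iff [OF I, of "f * rep ?y" "(- 1) * rep (\<delta> 0 ?x)"] by simp
        moreover have "rep (\<delta> 0 ?x) \<in> I"
          using resolution_aug_diff [OF res fst_car, of v] eps_zero_iff [OF a0] 0 by simp
        ultimately have "f * rep ?y \<in> I"
          using ideal_diff [OF I, of "f * rep ?y + rep (\<delta> 0 ?x)" "rep (\<delta> 0 ?x)"] by simp
        then have "rep ?y * f \<in> I" by (simp only: mult.commute)
        then have "rep ?y \<in> I" by (rule nzd)
        then show ?thesis using exact0 [OF y0] eps_zero_iff [OF y0] 0 by simp
      next
        case (Suc l)
        have "(\<lambda>k. - \<delta> l ?y k) = (\<lambda>_. 0)"
          using vjoin_eq_zero(2) [OF a [unfolded Suc], of "\<lambda>k. - \<delta> l (vsnd (?r (Suc i)) v) k"] Dv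
          unfolding Suc cone_map_simps by blast
        then have "\<delta> l ?y = (\<lambda>_. 0)" by (simp add: fun_eq_iff)
        moreover have "?y \<in> carrier (?F (Suc l))" using y unfolding Suc .
        ultimately show ?thesis using exact [of ?y l] unfolding Suc by blast
      qed
      then obtain w where "w \<in> carrier (?C (Suc (Suc i)))" "v = ?D (Suc i) w"
        using kernel_imp [OF v fun_cong [OF top]] by blast
      then show "v \<in> ?D (Suc i) ` carrier (?C (Suc (Suc i)))" by blast
    qed
  qed
  moreover have "?D i v \<in> component (?C i) j" if v: "v \<in> component (?C (Suc i)) j" for i j v
  proof -
    let ?x = "vfst (?r (Suc i)) v" and ?y = "vsnd (?r (Suc i)) v"
    have x: "?x \<in> component (?F (Suc i)) j"
      using v unfolding cone_shifts_simps by (rule vfst_component)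
    have y: "?y \<in> component (?F i) (j - c)"
      using vsnd_component [OF v [unfolded cone_shifts_simps(2)]] unfolding component_shift .
    have a: "(\<lambda>k. \<delta> i ?x k + f * ?y k) \<in> component (?F i) j"
      by (intro component_add minimal_graded [OF min x] component_smult [OF f y])
    show ?thesis
    proof (cases i)
      case 0
      then show ?thesis using a by (simp add: cone_map_simps)
    next
      case (Suc l)
      have "(\<lambda>k. - \<delta> l ?y k) \<in> component (graded_free (map (\<lambda>j. j + c) (\<sigma> l))) j"
        unfolding component_shift using minimal_graded [OF min, of ?y l] y Suc
        by (intro component_uminus) simp
      then show ?thesis
        using a unfolding Suc cone_map_simps cone_shifts_simps by (intro vjoin_component)
    qed
  qed
  moreover have "\<epsilon>' v \<in> component (quot_module J) j" if v: "v \<in> component (?C 0) j" for v j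
  proof -
    have v0: "v \<in> component (?F 0) j" using v by simp
    obtain p where p: "homogeneous j p" "\<epsilon> v = I +>\<^bsub>mpoly_ring\<^esub> p"
      using minimal_aug_graded [OF min v0] by auto
    have "\<epsilon>' v = J +>\<^bsub>mpoly_ring\<^esub> p"
      by (rule \<epsilon>'_eq [OF subsetD [OF component_subset_carrier v0] p(2)])
    then show ?thesis using p(1) by simp
  qed
  moreover have "?D i v k \<in> irrelevant_ideal" if v: "v \<in> carrier (?C (Suc i))" for i v k
  proof -
    have cf: "const_coeff f = 0" by (rule homogeneous_const_coeff [OF f c])
    have a: "const_coeff (\<delta> i (vfst (?r (Suc i)) v) k + f * vsnd (?r (Suc i)) v k) = 0" for k
      using minimal_const_coeff [OF min fst_car] cf by simp
    have b: "const_coeff (\<delta> l (vsnd (?r (Suc i)) v) k) = 0" if "i = Suc l" for l k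
      using minimal_const_coeff [OF min, of "vsnd (?r (Suc i)) v" l k] snd_car [OF v] that by simp
    show ?thesis
      unfolding irrelevant_ideal_iff using a b
      by (cases i) (simp_all add: cone_map_simps vjoin_def)
  qed
  ultimately have "minimal_graded_free_resolution (quot_module J) (cone_shifts c \<sigma>) ?D \<epsilon>'"
    unfolding minimal_graded_free_resolution_def by blast
  then show ?thesis unfolding J_def by blast
qed

section \<open>Subadditivity\<close>

definition top_shift :: "int list \<Rightarrow> ereal" where
  "top_shift s = (SUP j\<in>set s. ereal (real_of_int j))"

lemma top_shift_Nil [simp]: "top_shift [] = -\<infinity>"
  by (simp add: top_shift_def bot_ereal_def)

lemma top_shift_append: "top_shift (s @ t) = max (top_shift s) (top_shift t)"
  by (simp add: top_shift_def SUP_union sup_max)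

lemma ereal_max_add: "max (a + c) (b + c) = max a b + (c :: ereal)"
  by (cases "a \<le> b") (simp_all add: max_def add_right_mono antisym)

lemma top_shift_shift: "top_shift (map (\<lambda>j. j + c) s) = top_shift s + ereal (real_of_int c)"
proof (induction s)
  case (Cons j s)
  have Cons': "top_shift (j # s) = max (ereal (real_of_int j)) (top_shift s)" for j s
    by (simp add: top_shift_def sup_max)
  show ?case by (simp add: Cons' Cons flip: ereal_max_add)
qed simp

lemma max_shift_quot_module:
  assumes "homogeneous_ideal I"
    and "minimal_graded_free_resolution (quot_module I) \<sigma> \<delta> \<epsilon>"
  shows "max_shift (quot_module I) i = top_shift (\<sigma> i)"
proof -
  have "{ereal (real_of_int j) | j. graded_betti (quot_module I) i j \<noteq> 0} =
      (\<lambda>j. ereal (real_of_int j)) ` set (\<sigma> i)"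
    by (auto simp: graded_betti_quot_module [OF assms] count_list_0_iff)
  then show ?thesis by (simp add: max_shift_def top_shift_def)
qed

text \<open>The top shift of the cone in degree \<open>i\<close> is the larger of \<open>T i\<close>
  and \<open>T (i - 1) + c\<close>. For the second of these at \<open>a + b\<close>, the extra
  \<open>c\<close> is absorbed by an index among \<open>a\<close> and \<open>b\<close> that is
  positive, after lowering it by one.\<close>

lemma cone_subadditive:
  assumes sub: "\<And>a b. top_shift (\<sigma> (a + b)) \<le> top_shift (\<sigma> a) + top_shift (\<sigma> b)"
  shows "top_shift (cone_shifts c \<sigma> (a + b)) \<le>
    top_shift (cone_shifts c \<sigma> a) + top_shift (cone_shifts c \<sigma> b)"
proof -
  let ?T = "\<lambda>i. top_shift (\<sigma> i)" and ?U = "\<lambda>i. top_shift (cone_shifts c \<sigma> i)"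
  let ?c = "ereal (real_of_int c)"
  have U: "?T i \<le> ?U i" "?T i + ?c \<le> ?U (Suc i)" for i
    by (simp_all add: cone_shifts_def top_shift_append top_shift_shift)
  have shift: "?T (i + j) + ?c \<le> ?U (Suc i) + ?U j" for i j
  proof -
    have "?T (i + j) + ?c \<le> (?T i + ?c) + ?T j"
      using add_right_mono [OF sub [of i j], of ?c] by (simp add: ac_simps)
    also have "\<dots> \<le> ?U (Suc i) + ?U j" by (intro add_mono U)
    finally show ?thesis .
  qed
  have plain: "?T (a + b) \<le> ?U a + ?U b"
    using sub [of a b] add_mono [OF U(1) [of a] U(1) [of b]] by (rule order_trans)
  show ?thesis
  proof (cases "a + b")
    case 0
    then show ?thesis using plain by (simp add: 0)
  next
    case (Suc n)
    have "?T n + ?c \<le> ?U a + ?U b"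
    proof (cases a)
      case 0
      then show ?thesis using shift [of n 0] Suc by (simp add: add.commute)
    next
      case (Suc a')
      then show ?thesis using shift [of a' b] \<open>a + b = Suc n\<close> by simp
    qed
    then show ?thesis
      using plain unfolding Suc cone_shifts_simps top_shift_append top_shift_shift by simp
  qed
qed

theorem theorem2p3:
  fixes I :: "('n::finite, 'k::field) mpoly set" and f :: "('n, 'k) mpoly" and d :: nat
  assumes "homogeneous_ideal I"
    and "homogeneous (int d) f" and "d > 0"
    and "colon_ideal I f = I"
    and "subadditivity (quot_module I)"
  shows "subadditivity (quot_module (Idl\<^bsub>mpoly_ring\<^esub> (insert f I)))"
proof -
  let ?J = "Idl\<^bsub>mpoly_ring\<^esub> (insert f I)"
  note ideal = homogeneous_ideal_imp_ideal [OF assms(1)]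
  have J: "homogeneous_ideal ?J" by (rule homogeneous_ideal_Idl_insert [OF assms(1,2)])
  have nzd: "g \<in> I" if "g * f \<in> I" for g
    using assms(4) that by (auto simp: colon_ideal_def)
  obtain \<sigma> \<delta> \<epsilon> where min: "minimal_graded_free_resolution (quot_module I) \<sigma> \<delta> \<epsilon>"
    using ex_minimal_resolution_quot_module [OF assms(1)] by blast
  obtain \<delta>' \<epsilon>' where
    min': "minimal_graded_free_resolution (quot_module ?J) (cone_shifts (int d) \<sigma>) \<delta>' \<epsilon>'"
    using mapping_cone [OF ideal assms(2) _ nzd min] assms(3) by auto
  have "top_shift (\<sigma> (a + b)) \<le> top_shift (\<sigma> a) + top_shift (\<sigma> b)" for a b
  proof (cases "enat (a + b) \<le> proj_dim mpoly_ring (quot_module I)")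
    case True
    then show ?thesis
      using assms(5) by (simp add: subadditivity_def max_shift_quot_module [OF assms(1) min])
  next
    case False
    then have "\<sigma> (a + b) = []"
      by (intro minimal_resolution_beyond_proj_dim [OF min module_quot_module [OF ideal]]) simp
    then show ?thesis by simp
  qed
  then show ?thesis
    by (simp add: subadditivity_def max_shift_quot_module [OF J min'] cone_subadditive)
qed

end
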